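(* Let $F':(A,\partial,\boldsymbol\mu')\to(B,\partial,\boldsymbol\nu')$ and $F'':(A,\partial,\boldsymbol\mu'')\to(B,\partial,\boldsymbol\nu'')$ be $A_\infty$-morphisms whose underlying chain maps $f',f'':(A,\partial)\to(B,\partial)$ are chain homotopy equivalences. Then the following are equivalent: (i) $f'\sim f''$, and $(A,\partial,\boldsymbol\mu')$ and $(A,\partial,\boldsymbol\mu'')$ are isotopic; (ii) $f'\sim f''$, and $(B,\partial,\boldsymbol\nu')$ and $(B,\partial,\boldsymbol\nu'')$ are isotopic; (iii) $f'\sim f''$, $(A,\partial,\boldsymbol\mu')$ and $(A,\partial,\boldsymbol\mu'')$ are isotopic, and also $(B,\partial,\boldsymbol\nu')$ and $(B,\partial,\boldsymbol\nu'')$ are isotopic; (iv) there are isotopies $S:(A,\partial,\boldsymbol\mu')\to(A,\partial,\boldsymbol\mu'')$ and $T:(B,\partial,\boldsymbol\nu')\to(B,\partial,\boldsymbol\nu'')$ such that the $A_\infty$-morphisms $TF'$ and $F''S$ from $(A,\partial,\boldsymbol\mu')$ to $(B,\partial,\boldsymbol\nu'')$ are $A_\infty$-homotopic.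
   Context: Fix an arbitrary commutative unital ring $R$; all modules are over $R$ and $\otimes$ is over $R$. Chain complexes $(A,\partial)$ are $\mathbb{Z}$-graded, possibly unbounded, with differential of degree $-1$; the symbol $\partial$ is used for all differentials. The notation $f'\sim f''$ means that the chain maps are chain homotopic. For a graded module $A$, $T^c(\uparrow A)=\bigoplus_{n\ge1}(\uparrow A)^{\otimes n}$ is the tensor coalgebra (deconcatenation coproduct) on the suspension of $A$. An $A_\infty$-algebra $(A,\partial,\boldsymbol\mu)$ is a chain complex $(A,\partial)$ with linear maps $\mu_k:A^{\otimes k}\to A$, $k\ge2$, of degree $k-2$, such that the degree $-1$ coderivation $\delta$ of $T^c(\uparrow A)$ determined (after the usual suspension) by $\partial,\mu_2,\mu_3,\ldots$ satisfies $\delta^2=0$. An $A_\infty$-morphism $F=(f,f_2,f_3,\ldots):(A',\partial,\boldsymbol\mu')\to(A'',\partial,\boldsymbol\mu'')$ consists of linear maps $f:A'\to A''$ of degree $0$ and $f_k:A'^{\otimes k}\to A''$ of degree $k-1$, $k\ge 2$, such that the coalgebra morphism $\phi:T^c(\uparrow A')\to T^c(\uparrow A'')$ they determine satisfies $\delta''\phi=\phi\delta'$. Then $f$ is a chain map, called the linear part (or underlying chain map) of $F$. Composition is composition of coalgebra morphisms. An $A_\infty$-homotopy between $G=(g,g_2,\ldots)$ and $F=(f,f_2,\ldots)$ is a family $h:A'\to A''$ of degree $1$, $h_k:A'^{\otimes k}\to A''$ of degree $k$ ($k\geq 2$), whose associated degree $+1$ map $\eta:T^c(\uparrow A')\to T^c(\uparrow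 A'')$ satisfying $\Delta''\eta=(\phi\otimes\eta)\Delta'+(\eta\otimes\psi)\Delta'$ fulfills $\psi-\phi=\delta''\eta+\eta\delta'$, where $\phi,\psi$ are the coalgebra morphisms of $F,G$ and $\Delta',\Delta''$ are the coproducts. An isotopy is an $A_\infty$-morphism whose linear part is the identity; two $A_\infty$-structures on the same chain complex are isotopic if there is an isotopy between them. *)

theory Defs
  imports Complex_Main "HOL-Library.Poly_Mapping"
begin

section \<open>Graded modules and chain complexes\<close>

text \<open>
  A \<open>\<int>\<close>-graded module is a family \<open>part A n\<close> of submodules of one ambient module. The family is
  external: the submodules need not be independent, so an element of the graded module is a pair
  \<open>(n, a)\<close> with \<open>a \<in> part A n\<close>. The field \<open>diff\<close> is ignored by the notions that only concern
  graded modules.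
\<close>

record ('r, 'a) dgmod =
  scl :: "'r \<Rightarrow> 'a \<Rightarrow> 'a"
  part :: "int \<Rightarrow> 'a set"
  diff :: "int \<Rightarrow> 'a \<Rightarrow> 'a"

definition graded_module :: "('r::comm_ring_1, 'a::ab_group_add) dgmod \<Rightarrow> bool" where
  "graded_module A \<longleftrightarrow> module (scl A) \<and> (\<forall>n. module.subspace (scl A) (part A n))"

definition graded_linear ::
  "('r::comm_ring_1, 'a::ab_group_add) dgmod \<Rightarrow> ('r, 'b::ab_group_add) dgmod \<Rightarrow> int \<Rightarrow>
   (int \<Rightarrow> 'a \<Rightarrow> 'b) \<Rightarrow> bool" where
  "graded_linear A B e f \<longleftrightarrow>
     (\<forall>n. \<forall>a\<in>part A n.
        f n a \<in> part B (n + e) \<and>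
        (\<forall>b\<in>part A n. f n (a + b) = f n a + f n b) \<and>
        (\<forall>c. f n (scl A c a) = scl B c (f n a)))"

definition chain_complex :: "('r::comm_ring_1, 'a::ab_group_add) dgmod \<Rightarrow> bool" where
  "chain_complex A \<longleftrightarrow>
     graded_module A \<and> graded_linear A A (-1) (diff A) \<and>
     (\<forall>n. \<forall>a\<in>part A n. diff A (n - 1) (diff A n a) = 0)"

definition chain_map ::
  "('r::comm_ring_1, 'a::ab_group_add) dgmod \<Rightarrow> ('r, 'b::ab_group_add) dgmod \<Rightarrow>
   (int \<Rightarrow> 'a \<Rightarrow> 'b) \<Rightarrow> bool" where
  "chain_map A B f \<longleftrightarrow>
     graded_linear A B 0 f \<and>
     (\<forall>n. \<forall>a\<in>part A n. diff B n (f n a) = f (n - 1) (diff A n a))"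

definition chain_homotopic ::
  "('r::comm_ring_1, 'a::ab_group_add) dgmod \<Rightarrow> ('r, 'b::ab_group_add) dgmod \<Rightarrow>
   (int \<Rightarrow> 'a \<Rightarrow> 'b) \<Rightarrow> (int \<Rightarrow> 'a \<Rightarrow> 'b) \<Rightarrow> bool" where
  "chain_homotopic A B f g \<longleftrightarrow>
     (\<exists>h. graded_linear A B 1 h \<and>
        (\<forall>n. \<forall>a\<in>part A n.
           g n a - f n a = diff B (n + 1) (h n a) + h (n - 1) (diff A n a)))"

definition chain_homotopy_equivalence ::
  "('r::comm_ring_1, 'a::ab_group_add) dgmod \<Rightarrow> ('r, 'b::ab_group_add) dgmod \<Rightarrow>
   (int \<Rightarrow> 'a \<Rightarrow> 'b) \<Rightarrow> bool" where
  "chain_homotopy_equivalence A B f \<longleftrightarrow>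
     chain_map A B f \<and>
     (\<exists>g. chain_map B A g \<and>
        chain_homotopic A A (\<lambda>n a. g n (f n a)) (\<lambda>n a. a) \<and>
        chain_homotopic B B (\<lambda>n b. f n (g n b)) (\<lambda>n b. b))"


section \<open>Multilinear families\<close>

type_synonym 'a word = "(int \<times> 'a) list"

definition words :: "('r, 'a) dgmod \<Rightarrow> 'a word set" where
  "words A = {w. w \<noteq> [] \<and> (\<forall>(n, a)\<in>set w. a \<in> part A n)}"

definition deg :: "'a word \<Rightarrow> int" where
  "deg w = sum_list (map fst w)"

text \<open>
  A family of linear maps \<open>A\<^sup>\<otimes>\<^sup>k \<rightarrow> B\<close> of degree \<open>e k\<close>, one for each \<open>k \<ge> m\<close>, is given as one function
  on words: its restriction to words of length \<open>k\<close> is the \<open>k\<close>-linear map on homogeneous elements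
  that corresponds to the \<open>k\<close>-th member of the family.
\<close>

definition multilinear_family ::
  "('r::comm_ring_1, 'a::ab_group_add) dgmod \<Rightarrow> ('r, 'b::ab_group_add) dgmod \<Rightarrow> nat \<Rightarrow>
   (nat \<Rightarrow> int) \<Rightarrow> ('a word \<Rightarrow> 'b) \<Rightarrow> bool" where
  "multilinear_family A B m e F \<longleftrightarrow>
     (\<forall>w\<in>words A. length w \<ge> m \<longrightarrow> F w \<in> part B (deg w + e (length w))) \<and>
     (\<forall>u n a v. u @ (n, a) # v \<in> words A \<and> length (u @ (n, a) # v) \<ge> m \<longrightarrow>
        (\<forall>b\<in>part A n. F (u @ (n, a + b) # v) = F (u @ (n, a) # v) + F (u @ (n, b) # v)) \<and>
        (\<forall>c. F (u @ (n, scl A c a) # v) = scl B c (F (u @ (n, a) # v))))"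


section \<open>The tensor coalgebra\<close>

text \<open>
  The module \<open>T\<^sup>c(V) = \<Oplus>\<^sub>n\<^sub>\<ge>\<^sub>1 V\<^sup>\<otimes>\<^sup>n\<close> is the quotient of the free module on words in \<open>V\<close> by the
  submodule \<open>tensor_rel V\<close> of multilinearity relations. Its elements are handled through
  representatives: equality in \<open>T\<^sup>c(V)\<close> is congruence modulo \<open>tensor_rel V\<close>, and a linear map
  \<open>T\<^sup>c(V) \<rightarrow> T\<^sup>c(W)\<close> is given by a linear map of free modules that respects the relations. Every
  linear map between the quotients has such a lift, because its source is a quotient of a free module.
\<close>

definition fscale :: "'r::comm_ring_1 \<Rightarrow> ('k \<Rightarrow>\<^sub>0 'r) \<Rightarrow> ('k \<Rightarrow>\<^sub>0 'r)" where
  "fscale c p = Poly_Mapping.map ((*) c) p"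

lemma lookup_fscale [simp]: "Poly_Mapping.lookup (fscale c p) k = c * Poly_Mapping.lookup p k"
  by (simp add: fscale_def Poly_Mapping.map.rep_eq when_def)

global_interpretation free: module fscale
  by unfold_locales (auto intro!: poly_mapping_eqI simp: lookup_add algebra_simps)

definition lin_ext :: "('k \<Rightarrow> 'l \<Rightarrow>\<^sub>0 'r::comm_ring_1) \<Rightarrow> ('k \<Rightarrow>\<^sub>0 'r) \<Rightarrow> ('l \<Rightarrow>\<^sub>0 'r)" where
  "lin_ext f p = (\<Sum>k\<in>Poly_Mapping.keys p. fscale (Poly_Mapping.lookup p k) (f k))"

definition tensor_elts :: "('r::comm_ring_1, 'a) dgmod \<Rightarrow> ('a word \<Rightarrow>\<^sub>0 'r) set" where
  "tensor_elts V = {x. Poly_Mapping.keys x \<subseteq> words V}"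

definition tensor_elts_deg :: "('r::comm_ring_1, 'a) dgmod \<Rightarrow> int \<Rightarrow> ('a word \<Rightarrow>\<^sub>0 'r) set" where
  "tensor_elts_deg V d = {x. Poly_Mapping.keys x \<subseteq> {w \<in> words V. deg w = d}}"

definition tensor_rel ::
  "('r::comm_ring_1, 'a::ab_group_add) dgmod \<Rightarrow> ('a word \<Rightarrow>\<^sub>0 'r) set" where
  "tensor_rel V = free.span
     ({Poly_Mapping.single (u @ (n, a + b) # v) 1 - Poly_Mapping.single (u @ (n, a) # v) 1
        - Poly_Mapping.single (u @ (n, b) # v) 1 | u n a b v.
        u @ (n, a) # v \<in> words V \<and> b \<in> part V n} \<union>
      {Poly_Mapping.single (u @ (n, scl V c a) # v) 1
        - fscale c (Poly_Mapping.single (u @ (n, a) # v) 1) | u n c a v.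
        u @ (n, a) # v \<in> words V})"

definition tensor_hom ::
  "('r::comm_ring_1, 'a::ab_group_add) dgmod \<Rightarrow> ('r, 'b::ab_group_add) dgmod \<Rightarrow> int \<Rightarrow>
   (('a word \<Rightarrow>\<^sub>0 'r) \<Rightarrow> ('b word \<Rightarrow>\<^sub>0 'r)) \<Rightarrow> bool" where
  "tensor_hom V W e \<Phi> \<longleftrightarrow>
     module_hom fscale fscale \<Phi> \<and>
     (\<forall>d. \<Phi> ` tensor_elts_deg V d \<subseteq> tensor_elts_deg W (d + e)) \<and>
     \<Phi> ` tensor_rel V \<subseteq> tensor_rel W"

definition tensor_maps_eq ::
  "('r::comm_ring_1, 'a::ab_group_add) dgmod \<Rightarrow> ('r, 'b::ab_group_add) dgmod \<Rightarrow>
   (('a word \<Rightarrow>\<^sub>0 'r) \<Rightarrow> ('b word \<Rightarrow>\<^sub>0 'r)) \<Rightarrow> (('a word \<Rightarrow>\<^sub>0 'r) \<Rightarrow> ('b word \<Rightarrow>\<^sub>0 'r)) \<Rightarrow> bool" where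
  "tensor_maps_eq V W \<Phi> \<Psi> \<longleftrightarrow> (\<forall>x\<in>tensor_elts V. \<Phi> x - \<Psi> x \<in> tensor_rel W)"

text \<open>
  In the same way \<open>T\<^sup>c(V) \<otimes> T\<^sup>c(V)\<close> is the quotient of the free module on pairs of words by
  \<open>tensor_rel2 V\<close>.
\<close>

definition tens ::
  "('k \<Rightarrow>\<^sub>0 'r::comm_ring_1) \<Rightarrow> ('l \<Rightarrow>\<^sub>0 'r) \<Rightarrow> ('k \<times> 'l \<Rightarrow>\<^sub>0 'r)" where
  "tens x y = (\<Sum>u\<in>Poly_Mapping.keys x. \<Sum>v\<in>Poly_Mapping.keys y.
     Poly_Mapping.single (u, v) (Poly_Mapping.lookup x u * Poly_Mapping.lookup y v))"

definition tensor_rel2 ::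
  "('r::comm_ring_1, 'a::ab_group_add) dgmod \<Rightarrow> ('a word \<times> 'a word \<Rightarrow>\<^sub>0 'r) set" where
  "tensor_rel2 V = free.span
     ({tens x y | x y. x \<in> tensor_rel V \<and> y \<in> tensor_elts V} \<union>
      {tens x y | x y. x \<in> tensor_elts V \<and> y \<in> tensor_rel V})"

definition ksign :: "int \<Rightarrow> 'x::ab_group_add \<Rightarrow> 'x" where
  "ksign n x = (if even n then x else - x)"

text \<open>\<open>tens_map e \<Phi> \<Psi>\<close> is \<open>\<Phi> \<otimes> \<Psi>\<close> for \<open>\<Psi>\<close> of degree \<open>e\<close>, with the Koszul sign.\<close>

definition tens_map ::
  "int \<Rightarrow> (('a word \<Rightarrow>\<^sub>0 'r) \<Rightarrow> ('b word \<Rightarrow>\<^sub>0 'r)) \<Rightarrow> (('a word \<Rightarrow>\<^sub>0 'r) \<Rightarrow> ('b word \<Rightarrow>\<^sub>0 'r)) \<Rightarrow>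
   ('a word \<times> 'a word \<Rightarrow>\<^sub>0 'r) \<Rightarrow> ('b word \<times> 'b word \<Rightarrow>\<^sub>0 'r::comm_ring_1)" where
  "tens_map e \<Phi> \<Psi> =
     lin_ext (\<lambda>(u, v). ksign (e * deg u)
       (tens (\<Phi> (Poly_Mapping.single u 1)) (\<Psi> (Poly_Mapping.single v 1))))"

definition coprod :: "('a word \<Rightarrow>\<^sub>0 'r::comm_ring_1) \<Rightarrow> ('a word \<times> 'a word \<Rightarrow>\<^sub>0 'r)" where
  "coprod = lin_ext (\<lambda>w. \<Sum>i\<in>{1..<length w}. Poly_Mapping.single (take i w, drop i w) 1)"

definition coderivation ::
  "('r::comm_ring_1, 'a::ab_group_add) dgmod \<Rightarrow> (('a word \<Rightarrow>\<^sub>0 'r) \<Rightarrow> ('a word \<Rightarrow>\<^sub>0 'r)) \<Rightarrow> bool" where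
  "coderivation V \<delta> \<longleftrightarrow>
     tensor_hom V V (-1) \<delta> \<and>
     (\<forall>x\<in>tensor_elts V.
        coprod (\<delta> x) - (tens_map 0 \<delta> id (coprod x) + tens_map (-1) id \<delta> (coprod x))
          \<in> tensor_rel2 V)"

definition coalgebra_morphism ::
  "('r::comm_ring_1, 'a::ab_group_add) dgmod \<Rightarrow> ('r, 'b::ab_group_add) dgmod \<Rightarrow>
   (('a word \<Rightarrow>\<^sub>0 'r) \<Rightarrow> ('b word \<Rightarrow>\<^sub>0 'r)) \<Rightarrow> bool" where
  "coalgebra_morphism V W \<phi> \<longleftrightarrow>
     tensor_hom V W 0 \<phi> \<and>
     (\<forall>x\<in>tensor_elts V. coprod (\<phi> x) - tens_map 0 \<phi> \<phi> (coprod x) \<in> tensor_rel2 W)"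

definition homotopy_coderivation ::
  "('r::comm_ring_1, 'a::ab_group_add) dgmod \<Rightarrow> ('r, 'b::ab_group_add) dgmod \<Rightarrow>
   (('a word \<Rightarrow>\<^sub>0 'r) \<Rightarrow> ('b word \<Rightarrow>\<^sub>0 'r)) \<Rightarrow> (('a word \<Rightarrow>\<^sub>0 'r) \<Rightarrow> ('b word \<Rightarrow>\<^sub>0 'r)) \<Rightarrow>
   (('a word \<Rightarrow>\<^sub>0 'r) \<Rightarrow> ('b word \<Rightarrow>\<^sub>0 'r)) \<Rightarrow> bool" where
  "homotopy_coderivation V W \<phi> \<psi> \<eta> \<longleftrightarrow>
     tensor_hom V W 1 \<eta> \<and>
     (\<forall>x\<in>tensor_elts V.
        coprod (\<eta> x) - (tens_map 1 \<phi> \<eta> (coprod x) + tens_map 0 \<eta> \<psi> (coprod x))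
          \<in> tensor_rel2 W)"


section \<open>Suspension and components\<close>

definition susp :: "('r, 'a) dgmod \<Rightarrow> ('r, 'a) dgmod" where
  "susp A = A\<lparr>part := \<lambda>n. part A (n - 1)\<rparr>"

definition up :: "'a word \<Rightarrow> 'a word" where
  "up w = map (\<lambda>(n, a). (n + 1, a)) w"

text \<open>
  The Koszul sign exponent of \<open>\<down>\<^sup>\<otimes>\<^sup>k\<close> on \<open>\<up>a\<^sub>1 \<otimes> \<dots> \<otimes> \<up>a\<^sub>k\<close>: the factor \<open>\<up>a\<^sub>i\<close> is passed by the
  \<open>k - i\<close> desuspensions to its right (the index in the sum starts at 0).
\<close>

definition desusp_sign :: "'a word \<Rightarrow> int" where
  "desusp_sign w = (\<Sum>i<length w. (fst (w ! i) + 1) * int (length w - 1 - i))"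

text \<open>The projection of \<open>T\<^sup>c(W)\<close> onto the degree \<open>m\<close> part of its summand \<open>W\<close>.\<close>

definition proj :: "('r::comm_ring_1, 'b::ab_group_add) dgmod \<Rightarrow> int \<Rightarrow> ('b word \<Rightarrow>\<^sub>0 'r) \<Rightarrow> 'b" where
  "proj W m x =
     (\<Sum>w\<in>Poly_Mapping.keys x. scl W (Poly_Mapping.lookup x w)
       (case w of [(n, b)] \<Rightarrow> if n = m then b else 0 | _ \<Rightarrow> 0))"

text \<open>
  The components \<open>M\<^sub>k : A\<^sup>\<otimes>\<^sup>k \<rightarrow> B\<close> of a map \<open>\<Phi>\<close> of degree \<open>e\<close> from \<open>T\<^sup>c(\<up>A)\<close> to \<open>T\<^sup>c(\<up>B)\<close>,
  normalised by the requirement that \<open>\<up> M\<^sub>k \<down>\<^sup>\<otimes>\<^sup>k\<close> is the restriction of \<open>\<Phi>\<close> to \<open>(\<up>A)\<^sup>\<otimes>\<^sup>k\<close>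
  followed by the projection onto \<open>\<up>B\<close>.
\<close>

definition component ::
  "('r::comm_ring_1, 'b::ab_group_add) dgmod \<Rightarrow> int \<Rightarrow>
   (('a word \<Rightarrow>\<^sub>0 'r) \<Rightarrow> ('b word \<Rightarrow>\<^sub>0 'r)) \<Rightarrow> 'a word \<Rightarrow> 'b" where
  "component B e \<Phi> w =
     ksign (desusp_sign w) (proj (susp B) (deg (up w) + e) (\<Phi> (Poly_Mapping.single (up w) 1)))"

definition has_components ::
  "('r::comm_ring_1, 'a::ab_group_add) dgmod \<Rightarrow> ('r, 'b::ab_group_add) dgmod \<Rightarrow> int \<Rightarrow>
   (('a word \<Rightarrow>\<^sub>0 'r) \<Rightarrow> ('b word \<Rightarrow>\<^sub>0 'r)) \<Rightarrow> ('a word \<Rightarrow> 'b) \<Rightarrow> bool" where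
  "has_components A B e \<Phi> M \<longleftrightarrow> (\<forall>w\<in>words A. component B e \<Phi> w = M w)"


section \<open>\<open>A\<^sub>\<infinity>\<close>-algebras, morphisms and homotopies\<close>

text \<open>
  Coderivations, coalgebra morphisms and homotopies between them are determined by their components,
  as maps between tensor coalgebras; the choice operator below only selects a lift to the free modules.

  The operations \<open>\<mu>\<^sub>k\<close> with \<open>k \<ge> 2\<close> are the values of \<open>\<mu>\<close> on words of length \<open>k\<close>; the value of \<open>\<mu>\<close>
  on words of length 1 is irrelevant. In a morphism \<open>F = (f, f\<^sub>2, \<dots>)\<close> and in a homotopy
  \<open>(h, h\<^sub>2, \<dots>)\<close>, the value on words of length 1 is \<open>f\<close>, respectively \<open>h\<close>.
\<close>

definition ainf_ops :: "('r, 'a) dgmod \<Rightarrow> ('a word \<Rightarrow> 'a) \<Rightarrow> 'a word \<Rightarrow> 'a" where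
  "ainf_ops A \<mu> w = (case w of [(n, a)] \<Rightarrow> diff A n a | _ \<Rightarrow> \<mu> w)"

definition coder ::
  "('r::comm_ring_1, 'a::ab_group_add) dgmod \<Rightarrow> ('a word \<Rightarrow> 'a) \<Rightarrow>
   ('a word \<Rightarrow>\<^sub>0 'r) \<Rightarrow> ('a word \<Rightarrow>\<^sub>0 'r)" where
  "coder A \<mu> =
     (SOME \<delta>. coderivation (susp A) \<delta> \<and> has_components A A (-1) \<delta> (ainf_ops A \<mu>))"

definition ainf_algebra ::
  "('r::comm_ring_1, 'a::ab_group_add) dgmod \<Rightarrow> ('a word \<Rightarrow> 'a) \<Rightarrow> bool" where
  "ainf_algebra A \<mu> \<longleftrightarrow>
     chain_complex A \<and>
     multilinear_family A A 2 (\<lambda>k. int k - 2) \<mu> \<and>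
     tensor_maps_eq (susp A) (susp A) (coder A \<mu> \<circ> coder A \<mu>) (\<lambda>x. 0)"

definition comor ::
  "('r::comm_ring_1, 'a::ab_group_add) dgmod \<Rightarrow> ('r, 'b::ab_group_add) dgmod \<Rightarrow>
   ('a word \<Rightarrow> 'b) \<Rightarrow> ('a word \<Rightarrow>\<^sub>0 'r) \<Rightarrow> ('b word \<Rightarrow>\<^sub>0 'r)" where
  "comor A B F =
     (SOME \<phi>. coalgebra_morphism (susp A) (susp B) \<phi> \<and> has_components A B 0 \<phi> F)"

definition ainf_morphism ::
  "('r::comm_ring_1, 'a::ab_group_add) dgmod \<Rightarrow> ('a word \<Rightarrow> 'a) \<Rightarrow>
   ('r, 'b::ab_group_add) dgmod \<Rightarrow> ('b word \<Rightarrow> 'b) \<Rightarrow> ('a word \<Rightarrow> 'b) \<Rightarrow> bool" where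
  "ainf_morphism A \<mu> B \<nu> F \<longleftrightarrow>
     multilinear_family A B 1 (\<lambda>k. int k - 1) F \<and>
     tensor_maps_eq (susp A) (susp B) (coder B \<nu> \<circ> comor A B F) (comor A B F \<circ> coder A \<mu>)"

definition linear_part :: "('a word \<Rightarrow> 'b) \<Rightarrow> int \<Rightarrow> 'a \<Rightarrow> 'b" where
  "linear_part F n a = F [(n, a)]"

definition ainf_comp ::
  "('r::comm_ring_1, 'a::ab_group_add) dgmod \<Rightarrow> ('r, 'b::ab_group_add) dgmod \<Rightarrow>
   ('r, 'c::ab_group_add) dgmod \<Rightarrow> ('b word \<Rightarrow> 'c) \<Rightarrow> ('a word \<Rightarrow> 'b) \<Rightarrow> 'a word \<Rightarrow> 'c" where
  "ainf_comp A B C G F = component C 0 (comor B C G \<circ> comor A B F)"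

definition cohtp ::
  "('r::comm_ring_1, 'a::ab_group_add) dgmod \<Rightarrow> ('r, 'b::ab_group_add) dgmod \<Rightarrow>
   ('a word \<Rightarrow> 'b) \<Rightarrow> ('a word \<Rightarrow> 'b) \<Rightarrow> ('a word \<Rightarrow> 'b) \<Rightarrow>
   ('a word \<Rightarrow>\<^sub>0 'r) \<Rightarrow> ('b word \<Rightarrow>\<^sub>0 'r)" where
  "cohtp A B F G h =
     (SOME \<eta>. homotopy_coderivation (susp A) (susp B) (comor A B F) (comor A B G) \<eta> \<and>
              has_components A B 1 \<eta> h)"

definition ainf_homotopy ::
  "('r::comm_ring_1, 'a::ab_group_add) dgmod \<Rightarrow> ('a word \<Rightarrow> 'a) \<Rightarrow>
   ('r, 'b::ab_group_add) dgmod \<Rightarrow> ('b word \<Rightarrow> 'b) \<Rightarrow>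
   ('a word \<Rightarrow> 'b) \<Rightarrow> ('a word \<Rightarrow> 'b) \<Rightarrow> ('a word \<Rightarrow> 'b) \<Rightarrow> bool" where
  "ainf_homotopy A \<mu> B \<nu> G F h \<longleftrightarrow>
     multilinear_family A B 1 (\<lambda>k. int k) h \<and>
     tensor_maps_eq (susp A) (susp B)
       (\<lambda>x. comor A B G x - comor A B F x)
       (\<lambda>x. coder B \<nu> (cohtp A B F G h x) + cohtp A B F G h (coder A \<mu> x))"

definition ainf_homotopic ::
  "('r::comm_ring_1, 'a::ab_group_add) dgmod \<Rightarrow> ('a word \<Rightarrow> 'a) \<Rightarrow>
   ('r, 'b::ab_group_add) dgmod \<Rightarrow> ('b word \<Rightarrow> 'b) \<Rightarrow> ('a word \<Rightarrow> 'b) \<Rightarrow> ('a word \<Rightarrow> 'b) \<Rightarrow> bool" where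
  "ainf_homotopic A \<mu> B \<nu> G F \<longleftrightarrow> (\<exists>h. ainf_homotopy A \<mu> B \<nu> G F h)"

definition isotopy ::
  "('r::comm_ring_1, 'a::ab_group_add) dgmod \<Rightarrow> ('a word \<Rightarrow> 'a) \<Rightarrow> ('a word \<Rightarrow> 'a) \<Rightarrow>
   ('a word \<Rightarrow> 'a) \<Rightarrow> bool" where
  "isotopy A \<mu>' \<mu>'' S \<longleftrightarrow>
     ainf_morphism A \<mu>' A \<mu>'' S \<and> (\<forall>n. \<forall>a\<in>part A n. linear_part S n a = a)"

definition isotopic ::
  "('r::comm_ring_1, 'a::ab_group_add) dgmod \<Rightarrow> ('a word \<Rightarrow> 'a) \<Rightarrow> ('a word \<Rightarrow> 'a) \<Rightarrow> bool" where
  "isotopic A \<mu>' \<mu>'' \<longleftrightarrow> (\<exists>S. isotopy A \<mu>' \<mu>'' S)"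

end

theory Submission
  imports Defs
begin

text \<open>
  Conditions (i), (ii) follow from (iii), and (iii) follows from (iv) by looking at linear parts: an
  isotopy has linear part the identity, so the linear part of a homotopy between \<open>TF'\<close> and \<open>F''S\<close> is
  a chain homotopy between \<open>f'\<close> and \<open>f''\<close>. The content is that (i) and (ii) each imply (iv).

  Suppose that the isotopy \<open>S\<close> and a chain homotopy between \<open>f'\<close> and \<open>f''\<close> are given. The isotopy \<open>T\<close>
  and the homotopy are constructed together, one arity at a time. If the components of arity less than
  \<open>n\<close> satisfy the morphism equation for \<open>T\<close> and the homotopy equation on words of length less than \<open>n\<close>,
  then the two equations fail on words of length \<open>n\<close> by multilinear maps \<open>D : B\<^sup>\<otimes>\<^sup>n \<rightarrow> B\<close> and
  \<open>E : A\<^sup>\<otimes>\<^sup>n \<rightarrow> B\<close>. Since the differentials of the tensor coalgebras square to zero,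
  \<open>\<partial>D + D\<partial> = 0\<close> and \<open>\<partial>E - E\<partial> = D f'\<^sup>\<otimes>\<^sup>n\<close> (\<open>D_cycle\<close>, \<open>E_cycle\<close>): up to sign conventions, \<open>(D, E)\<close> is a cycle
  in the mapping cone of the precomposition map \<open>Hom(B\<^sup>\<otimes>\<^sup>n, B) \<rightarrow> Hom(A\<^sup>\<otimes>\<^sup>n, B)\<close> with \<open>f'\<^sup>\<otimes>\<^sup>n\<close>, and the new
  components have to bound it. Over every commutative ring the map \<open>f'\<^sup>\<otimes>\<^sup>n\<close> is a chain homotopy
  equivalence together with \<open>f'\<close>, so the cone is contractible and a bounding pair exists; it is
  written down in \<open>extension_solution\<close>. This gives \<open>morphism_extension\<close>. If \<open>T\<close> is given instead,
  the same argument with postcomposition by \<open>f''\<close> constructs \<open>S\<close> (\<open>lifting_solution\<close>,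
  \<open>morphism_lifting\<close>).

  The mechanism behind the cycle equations is that a homogeneous element of the tensor coalgebra with
  vanishing coproduct is a single letter (\<open>primitive_rel\<close>). The failure of
  the morphism or homotopy equation is a map of coderivation type; once it vanishes on shorter words,
  its value on a word of length \<open>n\<close> is primitive, hence is the letter \<open>D\<close> or \<open>E\<close>
  (\<open>leading_letter\<close>). The same principle shows that morphisms and coderivations are determined by their
  corestrictions, hence that the lifts picked by the choice operator may be replaced by
  explicit ones, which satisfy the coproduct identities already in the free module on words, before
  passing to the quotient by multilinearity.

  Everything is done with families on words of the suspended modules. There all components of
  a map of degree \<open>e\<close> have degree \<open>e\<close>, and the only signs are those of the coalgebra formulas; the signs of
  the suspension are confined to \<open>sus\<close>.
\<close>


abbreviation sng :: "'k \<Rightarrow> ('k \<Rightarrow>\<^sub>0 'r::comm_ring_1)" where "sng k \<equiv> Poly_Mapping.single k 1"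

section \<open>Linear maps out of free modules\<close>

text \<open>
  The linear extension of \<open>f\<close> to the free module. The target is an arbitrary module, so
  that the same facts apply to \<open>lin_ext\<close> and to the evaluation of multilinear families
  on sums of words.
\<close>

definition ev :: "('r::comm_ring_1 \<Rightarrow> 'x \<Rightarrow> 'x::ab_group_add) \<Rightarrow> ('k \<Rightarrow> 'x) \<Rightarrow> ('k \<Rightarrow>\<^sub>0 'r) \<Rightarrow> 'x" where
  "ev s f x = (\<Sum>k\<in>Poly_Mapping.keys x. s (Poly_Mapping.lookup x k) (f k))"

lemma lin_ext_ev: "lin_ext f = ev fscale f"
  by (rule ext) (simp add: lin_ext_def ev_def)

lemma ev_superset:
  assumes "module s" "finite S" "Poly_Mapping.keys x \<subseteq> S"
  shows "ev s f x = (\<Sum>k\<in>S. s (Poly_Mapping.lookup x k) (f k))"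
proof -
  interpret module s by fact
  show ?thesis unfolding ev_def
    by (rule sum.mono_neutral_left) (use assms in \<open>auto simp: not_in_keys_iff_lookup_eq_zero\<close>)
qed

lemma ev_hom:
  fixes s :: "'r::comm_ring_1 \<Rightarrow> 'x \<Rightarrow> 'x::ab_group_add" and f :: "'k \<Rightarrow> 'x"
  assumes "module s"
  shows "module_hom fscale s (ev s f)"
proof -
  interpret module s by fact
  show ?thesis unfolding module_hom_iff
  proof (intro conjI allI)
    show "module fscale" by (rule free.module_axioms)
    show "module s" by fact
  next
    fix x y :: "'k \<Rightarrow>\<^sub>0 'r"
    let ?S = "Poly_Mapping.keys x \<union> Poly_Mapping.keys y"
    have "ev s f (x + y) = (\<Sum>k\<in>?S. s (Poly_Mapping.lookup (x + y) k) (f k))"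
      by (rule ev_superset) (use assms Poly_Mapping.keys_add[of x y] in auto)
    also have "\<dots> = (\<Sum>k\<in>?S. s (Poly_Mapping.lookup x k) (f k)) + (\<Sum>k\<in>?S. s (Poly_Mapping.lookup y k) (f k))"
      by (simp add: lookup_add scale_left_distrib sum.distrib)
    also have "\<dots> = ev s f x + ev s f y"
      by (simp add: ev_superset[OF assms, of ?S])
    finally show "ev s f (x + y) = ev s f x + ev s f y" .
  next
    fix c and x :: "'k \<Rightarrow>\<^sub>0 'r"
    have "Poly_Mapping.keys (fscale c x) \<subseteq> Poly_Mapping.keys x"
      by (metis in_keys_iff lookup_fscale mult_zero_right subsetI)
    then have "ev s f (fscale c x) = (\<Sum>k\<in>Poly_Mapping.keys x. s (Poly_Mapping.lookup (fscale c x) k) (f k))"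
      by (intro ev_superset) (use assms in auto)
    then show "ev s f (fscale c x) = s c (ev s f x)"
      by (simp add: ev_def scale_sum_right)
  qed
qed

lemma ev_sng: "module s \<Longrightarrow> ev s f (sng k) = f k"
  by (simp add: ev_def module.scale_one)

definition supp :: "'k set \<Rightarrow> ('k \<Rightarrow>\<^sub>0 'r::comm_ring_1) set" where
  "supp S = {x. Poly_Mapping.keys x \<subseteq> S}"

lemma supp_mono: "S \<subseteq> T \<Longrightarrow> x \<in> supp S \<Longrightarrow> x \<in> supp T"
  by (auto simp: supp_def)

lemma subspace_supp: "free.subspace (supp S)"
  unfolding free.subspace_def supp_def
proof (intro conjI ballI allI, goal_cases)
  case (2 x y) then show ?case using Poly_Mapping.keys_add[of x y] by auto
next
  case (3 x c) then show ?case by (auto simp: in_keys_iff) (metis in_keys_iff mult_zero_right subsetD)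
qed auto

lemma sng_supp: "k \<in> S \<Longrightarrow> sng k \<in> supp S"
  by (simp add: supp_def)

text \<open>
  This reduces statements about elements with prescribed support to statements about basis elements.
\<close>

lemma supp_span: "(supp S :: ('k \<Rightarrow>\<^sub>0 'r::comm_ring_1) set) = free.span (sng ` S)"
proof
  show "free.span (sng ` S) \<subseteq> (supp S :: ('k \<Rightarrow>\<^sub>0 'r) set)"
    by (rule free.span_minimal) (auto simp: subspace_supp sng_supp)
  show "supp S \<subseteq> free.span (sng ` S :: ('k \<Rightarrow>\<^sub>0 'r) set)"
  proof
    fix x :: "'k \<Rightarrow>\<^sub>0 'r" assume x: "x \<in> supp S"
    have "x = (\<Sum>k\<in>Poly_Mapping.keys x. fscale (Poly_Mapping.lookup x k) (sng k))"
      by (rule poly_mapping_eqI)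
        (simp add: lookup_sum lookup_single when_def in_keys_iff if_distrib[of "\<lambda>x. _ * x"] cong: if_cong)
    also have "\<dots> \<in> free.span (sng ` S)"
      using x by (intro free.span_sum free.span_scale free.span_base) (auto simp: supp_def)
    finally show "x \<in> free.span (sng ` S)" .
  qed
qed

lemma hom_supp:
  assumes "module_hom fscale s F" "module.subspace s T" "\<And>k. k \<in> S \<Longrightarrow> F (sng k) \<in> T" "x \<in> supp S"
  shows "F x \<in> T"
proof -
  interpret F: module_hom fscale s F by fact
  have "x \<in> F -` T"
    using assms(4) free.span_minimal[of "sng ` S" "F -` T"] F.subspace_vimage[OF assms(2)] assms(3)
    by (auto simp: supp_span)
  then show ?thesis by simp
qed

abbreviation lin :: "(('k \<Rightarrow>\<^sub>0 'r::comm_ring_1) \<Rightarrow> ('l \<Rightarrow>\<^sub>0 'r)) \<Rightarrow> bool" where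
  "lin \<equiv> module_hom fscale fscale"

lemma lin_lin_ext [simp]: "lin (lin_ext f)"
  unfolding lin_ext_ev by (rule ev_hom) (rule free.module_axioms)

lemma lin_ext_sng [simp]: "lin_ext f (sng k) = f k"
  unfolding lin_ext_ev by (rule ev_sng) (rule free.module_axioms)

lemma ksign_simps:
  "ksign 0 x = x" "ksign n 0 = 0" "ksign n (x + y) = ksign n x + ksign n y"
  "ksign n (x - y) = ksign n x - ksign n y" "ksign n (- x) = - ksign n x"
  "ksign n (ksign m x) = ksign (n + m) x"
  by (auto simp: ksign_def)

lemma ksign_sum: "ksign n (sum f S) = (\<Sum>x\<in>S. ksign n (f x))"
  by (simp add: ksign_def sum_negf)

lemma ksign_subspace: "module s \<Longrightarrow> module.subspace s S \<Longrightarrow> x \<in> S \<Longrightarrow> ksign n x \<in> S"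
  by (simp add: ksign_def module.subspace_neg)

lemma ksign_hom: "module_hom s t F \<Longrightarrow> F (ksign n x) = ksign n (F x)"
  by (simp add: ksign_def module_hom.neg)

lemma ksign_scale: "module s \<Longrightarrow> s c (ksign n x) = ksign n (s c x)"
  by (simp add: ksign_def module.scale_minus_right)

lemma hom_comp:
  "module_hom s t F \<Longrightarrow> module_hom t r G \<Longrightarrow> module_hom s r (\<lambda>x. G (F x))"
  using module_hom_compose[of s t F r G] by (simp add: o_def)

lemma hom_add: "module_hom s t F \<Longrightarrow> module_hom s t G \<Longrightarrow> module_hom s t (\<lambda>x. F x + G x)"
  unfolding module_hom_iff by (auto simp: module.scale_right_distrib)

lemma hom_diff: "module_hom s t F \<Longrightarrow> module_hom s t G \<Longrightarrow> module_hom s t (\<lambda>x. F x - G x)"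
  unfolding module_hom_iff by (auto simp: module.scale_right_diff_distrib)

lemma hom_neg: "module_hom s t F \<Longrightarrow> module_hom s t (\<lambda>x. - F x)"
  unfolding module_hom_iff by (auto simp: module.scale_minus_right)

lemma hom_ksign: "module_hom s t F \<Longrightarrow> module_hom s t (\<lambda>x. ksign n (F x))"
  unfolding module_hom_iff by (auto simp: ksign_simps ksign_scale)

lemma lin_id: "lin (\<lambda>x. x)" "lin id"
  by (simp_all add: free.module_hom_ident[unfolded id_def] free.module_hom_id id_def)

text \<open>
  Most identities between linear maps below are only checked on the words of a module, which is why
  the support is a parameter here.
\<close>

lemma hom_eq_supp:
  assumes "module_hom fscale s F" "module_hom fscale s G" "\<And>k. k \<in> S \<Longrightarrow> F (sng k) = G (sng k)" "x \<in> supp S"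
  shows "F x = G x"
proof -
  interpret F: module_hom fscale s F by fact
  have "(\<lambda>x. F x - G x) x \<in> {0}"
    by (rule hom_supp[OF hom_diff[OF assms(1,2)] F.m2.subspace_single_0 _ assms(4)]) (simp add: assms(3))
  then show ?thesis by simp
qed

lemma in_supp_UNIV: "x \<in> supp UNIV" by (simp add: supp_def)

lemma hom_eqI:
  assumes "module_hom fscale s F" "module_hom fscale s G" "\<And>k. F (sng k) = G (sng k)"
  shows "F = G"
  by (rule ext) (rule hom_eq_supp[OF assms(1,2) assms(3) in_supp_UNIV])

lemma hom_0: "module s \<Longrightarrow> module t \<Longrightarrow> module_hom s t (\<lambda>x. 0)"
  unfolding module_hom_iff by (auto simp: module.scale_zero_right)

section \<open>Tensor and concatenation products\<close>

lemma tens_alt: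
  fixes x :: "'k \<Rightarrow>\<^sub>0 'r::comm_ring_1" and y :: "'l \<Rightarrow>\<^sub>0 'r"
  shows "tens x y = lin_ext (\<lambda>u. lin_ext (\<lambda>v. sng (u, v)) y) x"
proof -
  have "fscale a (fscale b (sng k)) = Poly_Mapping.single k (a * b)" for a b :: 'r and k :: "'k \<times> 'l"
    by (rule poly_mapping_eqI) (simp add: lookup_single when_def)
  then show ?thesis by (simp add: tens_def lin_ext_def free.scale_sum_right)
qed

text \<open>
  The product of the free algebra on letters; it restores a tensor from its two pieces after
  deconcatenation.
\<close>

definition conc :: "('a list \<Rightarrow>\<^sub>0 'r::comm_ring_1) \<Rightarrow> ('a list \<Rightarrow>\<^sub>0 'r) \<Rightarrow> ('a list \<Rightarrow>\<^sub>0 'r)" where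
  "conc x y = lin_ext (\<lambda>(u, v). sng (u @ v)) (tens x y)"

lemma lin_ext_family:
  fixes f :: "'k \<Rightarrow> ('m \<Rightarrow>\<^sub>0 'r::comm_ring_1) \<Rightarrow> ('l \<Rightarrow>\<^sub>0 'r)"
  assumes "\<And>k. lin (\<lambda>y. f k y)"
  shows "lin (\<lambda>y. lin_ext (\<lambda>k. f k y) x)"
proof -
  have "fscale a (fscale b z) = fscale b (fscale a z)" for a b and z :: "'l \<Rightarrow>\<^sub>0 'r"
    by (simp add: mult.commute)
  with assms show ?thesis unfolding module_hom_iff lin_ext_def
    by (auto simp: free.scale_right_distrib sum.distrib free.scale_sum_right mult.commute
        free.module_axioms)
qed

lemma lin_tens1: "lin (\<lambda>x. tens x y)" and lin_tens2: "lin (\<lambda>y. tens x y)"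
  unfolding tens_alt by (simp_all add: lin_ext_family)

lemma tens_sng [simp]: "tens (sng u) (sng v) = sng (u, v)"
  by (simp add: tens_alt)

lemma lin_conc1: "lin (\<lambda>x. conc x y)" and lin_conc2: "lin (\<lambda>y. conc x y)"
  unfolding conc_def
  by (rule hom_comp[OF lin_tens1 lin_lin_ext], rule hom_comp[OF lin_tens2 lin_lin_ext])

lemma conc_sng [simp]: "conc (sng u) (sng v) = sng (u @ v)"
  by (simp add: conc_def)

lemmas tens_simps =
  module_hom.zero[OF lin_tens1] module_hom.zero[OF lin_tens2]
  module_hom.add[OF lin_tens1] module_hom.add[OF lin_tens2]
  module_hom.diff[OF lin_tens1] module_hom.diff[OF lin_tens2]
  module_hom.neg[OF lin_tens1] module_hom.neg[OF lin_tens2]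
  ksign_hom[OF lin_tens1] ksign_hom[OF lin_tens2]
  module_hom.sum[OF lin_tens1] module_hom.sum[OF lin_tens2]
  module_hom.scale[OF lin_tens1] module_hom.scale[OF lin_tens2]

lemmas conc_simps =
  module_hom.zero[OF lin_conc1] module_hom.zero[OF lin_conc2]
  module_hom.add[OF lin_conc1] module_hom.add[OF lin_conc2]
  module_hom.diff[OF lin_conc1] module_hom.diff[OF lin_conc2]
  module_hom.neg[OF lin_conc1] module_hom.neg[OF lin_conc2]
  ksign_hom[OF lin_conc1] ksign_hom[OF lin_conc2]
  module_hom.sum[OF lin_conc1] module_hom.sum[OF lin_conc2]
  module_hom.scale[OF lin_conc1] module_hom.scale[OF lin_conc2]

lemma bilin_supp:
  fixes F :: "('k \<Rightarrow>\<^sub>0 'r) \<Rightarrow> ('l \<Rightarrow>\<^sub>0 'r) \<Rightarrow> ('x \<Rightarrow>\<^sub>0 'r::comm_ring_1)"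
  assumes "\<And>y. lin (\<lambda>x. F x y)" "\<And>x. lin (\<lambda>y. F x y)" "free.subspace U"
    "\<And>k l. k \<in> S \<Longrightarrow> l \<in> T \<Longrightarrow> F (sng k) (sng l) \<in> U" "x \<in> supp S" "y \<in> supp T"
  shows "F x y \<in> U"
  by (rule hom_supp[OF assms(1) assms(3) _ assms(5)]) (rule hom_supp[OF assms(2) assms(3) assms(4) assms(6)])

lemma bilin_eq:
  fixes F :: "('k \<Rightarrow>\<^sub>0 'r) \<Rightarrow> ('l \<Rightarrow>\<^sub>0 'r) \<Rightarrow> ('x \<Rightarrow>\<^sub>0 'r::comm_ring_1)"
  assumes "\<And>y. lin (\<lambda>x. F x y)" "\<And>x. lin (\<lambda>y. F x y)" "\<And>y. lin (\<lambda>x. G x y)" "\<And>x. lin (\<lambda>y. G x y)"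
    "\<And>k l. k \<in> S \<Longrightarrow> l \<in> T \<Longrightarrow> F (sng k) (sng l) = G (sng k) (sng l)" "x \<in> supp S" "y \<in> supp T"
  shows "F x y = G x y"
  by (rule hom_eq_supp[OF assms(1) assms(3) _ assms(6)]) (rule hom_eq_supp[OF assms(2) assms(4) assms(5) assms(7)])

lemma conc_supp:
  "x \<in> supp S \<Longrightarrow> y \<in> supp T \<Longrightarrow> (\<And>u v. u \<in> S \<Longrightarrow> v \<in> T \<Longrightarrow> u @ v \<in> U) \<Longrightarrow> conc x y \<in> supp U"
  by (rule bilin_supp[where F=conc]) (simp_all add: lin_conc1 lin_conc2 subspace_supp sng_supp)

section \<open>Words and the multilinearity relations\<close>

lemma words_append: "u @ v \<in> words V \<longleftrightarrow> (u = [] \<or> u \<in> words V) \<and> (v = [] \<or> v \<in> words V) \<and> (u \<noteq> [] \<or> v \<noteq> [])"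
  by (auto simp: words_def)

lemma words_Cons: "(n, a) # v \<in> words V \<longleftrightarrow> a \<in> part V n \<and> (v = [] \<or> v \<in> words V)"
  by (auto simp: words_def)

lemma words_take: "w \<in> words V \<Longrightarrow> 0 < i \<Longrightarrow> i \<le> length w \<Longrightarrow> take i w \<in> words V"
  by (auto simp: words_def dest: in_set_takeD)
lemma words_drop: "w \<in> words V \<Longrightarrow> i < length w \<Longrightarrow> drop i w \<in> words V"
  by (auto simp: words_def dest: in_set_dropD)
lemma words_nonempty: "w \<in> words V \<Longrightarrow> w \<noteq> []"
  by (simp add: words_def)

lemma deg_simps [simp]: "deg (u @ v) = deg u + deg v" "deg ((n, a) # v) = n + deg v" "deg [] = 0"
  by (auto simp: deg_def)

lemma deg_take_drop: "deg (take i w) + deg (drop i w) = deg w"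
  by (metis append_take_drop_id deg_simps(1))

lemma elts_supp: "tensor_elts V = supp (words V)" "tensor_elts_deg V d = supp {w \<in> words V. deg w = d}"
  by (simp_all add: tensor_elts_def tensor_elts_deg_def supp_def)

lemma gm_module: "graded_module V \<Longrightarrow> module (scl V)"
  by (simp add: graded_module_def)

lemma gm_part: "graded_module V \<Longrightarrow> module.subspace (scl V) (part V n)"
  by (simp add: graded_module_def)

lemma words_comb:
  assumes "graded_module V" "u @ (n, a) # v \<in> words V" "b \<in> part V n"
  shows "u @ (n, b) # v \<in> words V" "u @ (n, a + scl V c b) # v \<in> words V"
proof -
  interpret module "scl V" using assms(1) by (rule gm_module)
  show "u @ (n, b) # v \<in> words V" "u @ (n, a + scl V c b) # v \<in> words V"
    using assms gm_part[OF assms(1), of n] by (auto simp: words_append words_Cons subspace_add subspace_scale)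
qed

text \<open>
  Additivity and homogeneity in one letter are both instances of linearity in the combination
  \<open>a + c \<cdot> b\<close>, so a single family of relations is enough.
\<close>

definition relator :: "('r::comm_ring_1, 'a::ab_group_add) dgmod \<Rightarrow> 'a word \<Rightarrow> int \<Rightarrow> 'a \<Rightarrow> 'r \<Rightarrow> 'a \<Rightarrow> 'a word \<Rightarrow> ('a word \<Rightarrow>\<^sub>0 'r)" where
  "relator V u n a c b v = sng (u @ (n, a + scl V c b) # v) - sng (u @ (n, a) # v) - fscale c (sng (u @ (n, b) # v))"

lemma subspace_rel: "free.subspace (tensor_rel V)"
  by (simp add: tensor_rel_def)

lemma relator_rel:
  assumes V: "graded_module V" and w: "u @ (n, a) # v \<in> words V" "b \<in> part V n"
  shows "relator V u n a c b v \<in> tensor_rel V"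
proof -
  interpret module "scl V" using V by (rule gm_module)
  have b: "scl V c b \<in> part V n" using w gm_part[OF V, of n] by (simp add: subspace_scale)
  have 1: "sng (u @ (n, a + scl V c b) # v) - sng (u @ (n, a) # v) - sng (u @ (n, scl V c b) # v) \<in> tensor_rel V"
    unfolding tensor_rel_def by (rule free.span_base) (use w b in blast)
  have 2: "sng (u @ (n, scl V c b) # v) - fscale c (sng (u @ (n, b) # v)) \<in> tensor_rel V"
    unfolding tensor_rel_def by (rule free.span_base) (use w words_comb[OF V w] in blast)
  show ?thesis using free.subspace_add[OF subspace_rel 1 2] by (simp add: relator_def)
qed

text \<open>
  The generators of \<open>tensor_rel\<close> are recovered from \<open>relator\<close>: additivity
  is the case \<open>c = 1\<close>, and homogeneity is the case \<open>a = 0\<close> up to the word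
  with letter \<open>0\<close>, which is itself a relator up to sign.
\<close>

lemma rel_induct:
  assumes V: "graded_module V" and F: "module_hom fscale s F" "module.subspace s T"
    and gen: "\<And>u n a c b v. u @ (n, a) # v \<in> words V \<Longrightarrow> b \<in> part V n \<Longrightarrow> F (relator V u n a c b v) \<in> T"
    and x: "x \<in> tensor_rel V"
  shows "F x \<in> T"
proof -
  interpret V: module "scl V" using V by (rule gm_module)
  interpret F: module_hom fscale s F by fact
  \<comment> \<open>words with a letter \<open>0\<close> are relators up to sign\<close>
  have sub: "free.subspace (F -` T)" by (rule F.subspace_vimage) fact
  have z: "0 \<in> part V n" for n using V.subspace_0[OF gm_part[OF V]] .
  have zero: "sng (u @ (n, 0) # v) \<in> F -` T" if "u @ (n, a) # v \<in> words V" for u n a v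
  proof -
    have "u @ (n, 0) # v \<in> words V" using words_comb(1)[OF V that z] .
    from gen[OF this z, of 1] have "relator V u n 0 1 0 v \<in> F -` T" by simp
    moreover have "relator V u n 0 1 0 v = - sng (u @ (n, 0) # v)"
      by (simp add: relator_def)
    ultimately show ?thesis using free.subspace_neg[OF sub] by fastforce
  qed
  have "tensor_rel V \<subseteq> F -` T" unfolding tensor_rel_def
  proof (rule free.span_minimal[OF _ sub], rule subsetI)
    fix y assume "y \<in> {sng (u @ (n, a + b) # v) - sng (u @ (n, a) # v) - sng (u @ (n, b) # v) | u n a b v.
        u @ (n, a) # v \<in> words V \<and> b \<in> part V n} \<union>
      {sng (u @ (n, scl V c a) # v) - fscale c (sng (u @ (n, a) # v)) | u n c a v. u @ (n, a) # v \<in> words V}"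
    then consider u n a b v where "y = sng (u @ (n, a + b) # v) - sng (u @ (n, a) # v) - sng (u @ (n, b) # v)"
        "u @ (n, a) # v \<in> words V" "b \<in> part V n"
      | u n a c v where "y = sng (u @ (n, scl V c a) # v) - fscale c (sng (u @ (n, a) # v))" "u @ (n, a) # v \<in> words V"
      by blast
    then show "y \<in> F -` T"
    proof cases
      case 1 then show ?thesis using gen[OF 1(2,3), of 1] by (simp add: relator_def)
    next
      case 2
      have a: "a \<in> part V n" using 2 by (simp add: words_append words_Cons)
      from gen[OF words_comb(1)[OF V 2(2) z] a, of c]
      have "relator V u n 0 c a v \<in> F -` T" by simp
      from free.subspace_add[OF sub this zero[OF 2(2)]] show ?thesis by (simp add: relator_def 2)
    qed
  qed
  with x show ?thesis by auto
qed

lemma conc_sng_relator: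
  "conc (sng p) (relator V u n a c b v) = relator V (p @ u) n a c b v"
  "conc (relator V u n a c b v) (sng p) = relator V u n a c b (v @ p)"
  by (simp_all add: relator_def conc_simps)

lemma rel_conc1:
  assumes V: "graded_module V" and x: "x \<in> tensor_rel V" and y: "y \<in> tensor_elts V"
  shows "conc x y \<in> tensor_rel V"
proof (rule rel_induct[OF V lin_conc1 subspace_rel _ x])
  fix u n a c b v assume w: "u @ (n, a) # v \<in> words V" "b \<in> part V n"
  show "conc (relator V u n a c b v) y \<in> tensor_rel V"
  proof (rule hom_supp[OF lin_conc2 subspace_rel _ y[unfolded elts_supp]])
    fix p assume "p \<in> words V"
    with w show "conc (relator V u n a c b v) (sng p) \<in> tensor_rel V"
      unfolding conc_sng_relator by (intro relator_rel[OF V]) (auto simp: words_append words_Cons)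
  qed
qed

lemma rel_conc2:
  assumes V: "graded_module V" and x: "x \<in> tensor_rel V" and y: "y \<in> tensor_elts V"
  shows "conc y x \<in> tensor_rel V"
proof (rule rel_induct[OF V lin_conc2 subspace_rel _ x])
  fix u n a c b v assume w: "u @ (n, a) # v \<in> words V" "b \<in> part V n"
  show "conc y (relator V u n a c b v) \<in> tensor_rel V"
  proof (rule hom_supp[OF lin_conc1 subspace_rel _ y[unfolded elts_supp]])
    fix p assume "p \<in> words V"
    with w show "conc (sng p) (relator V u n a c b v) \<in> tensor_rel V"
      unfolding conc_sng_relator by (intro relator_rel[OF V]) (auto simp: words_append words_Cons)
  qed
qed


section \<open>Deconcatenation\<close>

lemma lin_coprod: "lin coprod"
  by (simp add: coprod_def)

lemma coprod_sng: "coprod (sng w) = (\<Sum>i\<in>{1..<length w}. sng (take i w, drop i w))"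
  by (simp add: coprod_def)

text \<open>
  The value on \<open>w\<close> of \<open>(G \<otimes> H) \<circ> \<Delta>\<close>, without signs.
\<close>

definition cuts :: "('a list \<Rightarrow> ('b word \<Rightarrow>\<^sub>0 'r::comm_ring_1)) \<Rightarrow> ('a list \<Rightarrow> ('b word \<Rightarrow>\<^sub>0 'r)) \<Rightarrow>
    'a list \<Rightarrow> ('b word \<times> 'b word \<Rightarrow>\<^sub>0 'r)" where
  "cuts G H w = (\<Sum>i\<in>{1..<length w}. tens (G (take i w)) (H (drop i w)))"

text \<open>
  The convolution product of two maps on words, that is, \<open>cuts\<close> followed by
  concatenation.
\<close>

definition convol :: "('a list \<Rightarrow> ('b word \<Rightarrow>\<^sub>0 'r::comm_ring_1)) \<Rightarrow> ('a list \<Rightarrow> ('b word \<Rightarrow>\<^sub>0 'r)) \<Rightarrow>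
    'a list \<Rightarrow> ('b word \<Rightarrow>\<^sub>0 'r)" where
  "convol G H w = (\<Sum>i\<in>{1..<length w}. conc (G (take i w)) (H (drop i w)))"

text \<open>The Koszul sign of a map of degree \<open>e\<close> that moves past \<open>w\<close>.\<close>

definition twist :: "int \<Rightarrow> ('a word \<Rightarrow> 'x::ab_group_add) \<Rightarrow> 'a word \<Rightarrow> 'x" where
  "twist e G w = ksign (e * deg w) (G w)"

text \<open>Left concatenation on the first tensor factor.\<close>

definition conc_left :: "('a list \<Rightarrow>\<^sub>0 'r::comm_ring_1) \<Rightarrow> ('a list \<times> 'a list \<Rightarrow>\<^sub>0 'r) \<Rightarrow> ('a list \<times> 'a list \<Rightarrow>\<^sub>0 'r)" where
  "conc_left x = lin_ext (\<lambda>(u, v). tens (conc x (sng u)) (sng v))"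

lemma lin_conc_left: "lin (conc_left x)"
  by (simp add: conc_left_def)

lemma lin_conc_left1: "lin (\<lambda>x. conc_left x z)"
  unfolding conc_left_def
  by (rule lin_ext_family) (auto split: prod.split intro: hom_comp[OF lin_conc1 lin_tens1])

lemma conc_left_tens: "conc_left x (tens y z) = tens (conc x y) z"
  by (rule bilin_eq[where F="\<lambda>y z. conc_left x (tens y z)" and G="\<lambda>y z. tens (conc x y) z" and S=UNIV and T=UNIV])
    (auto intro: hom_comp lin_tens1 lin_tens2 lin_conc_left lin_conc2 in_supp_UNIV simp: conc_left_def)

text \<open>
  A word \<open>l # v\<close> is cut either directly after \<open>l\<close> or inside
  \<open>v\<close>.
\<close>

lemma coprod_conc:
  assumes x: "x \<in> supp {w. length w = 1}" and y: "y \<in> supp {w. w \<noteq> []}"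
  shows "coprod (conc x y) = tens x y + conc_left x (coprod y)"
proof (rule bilin_eq[where F="\<lambda>x y. coprod (conc x y)" and G="\<lambda>x y. tens x y + conc_left x (coprod y)", OF _ _ _ _ _ x y])
  fix u v :: "'a word" assume "u \<in> {w. length w = 1}" "v \<in> {w. w \<noteq> []}"
  then obtain l where u: "u = [l]" and v: "0 < length v"
    by (auto simp: length_Suc_conv)
  have "coprod (sng (l # v)) = (\<Sum>i\<in>{Suc 0..<Suc (length v)}. sng (take i (l # v), drop i (l # v)) :: _ \<Rightarrow>\<^sub>0 'b)"
    by (simp add: coprod_sng)
  also have "\<dots> = (\<Sum>i\<in>{0..<length v}. sng (l # take i v, drop i v))"
    by (subst sum.shift_bounds_Suc_ivl) simp
  also have "\<dots> = sng ([l], v) + (\<Sum>i\<in>{1..<length v}. sng (l # take i v, drop i v))"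
    using v by (subst sum.atLeast_Suc_lessThan) auto
  finally show "coprod (conc (sng u) (sng v)) = tens (sng u) (sng v) + conc_left (sng u) (coprod (sng v) :: _ \<Rightarrow>\<^sub>0 'b)"
    by (simp add: u coprod_sng module_hom.sum[OF lin_conc_left]) (simp add: conc_left_def)
qed (auto intro!: hom_add intro: hom_comp lin_conc1 lin_conc2 lin_tens1 lin_tens2 lin_coprod lin_conc_left lin_conc_left1)

text \<open>
  Coassociativity: cutting first at \<open>i\<close> and then inside the rest is cutting at
  \<open>j\<close> and then inside the beginning.
\<close>

lemma sum_conc_left_cuts:
  "(\<Sum>i\<in>{1..<length w}. conc_left (c (take i w)) (cuts G H (drop i w))) = cuts (convol c G) H w"
proof -
  let ?n = "length w"
  have "(\<Sum>i\<in>{1..<?n}. conc_left (c (take i w)) (cuts G H (drop i w))) =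
      (\<Sum>i\<in>{1..<?n}. \<Sum>k\<in>{1..<?n - i}. tens (conc (c (take i w)) (G (take k (drop i w)))) (H (drop k (drop i w))))"
    by (simp add: cuts_def module_hom.sum[OF lin_conc_left] conc_left_tens)
  also have "\<dots> = (\<Sum>(i,k)\<in>(SIGMA i:{1..<?n}. {1..<?n - i}). tens (conc (c (take i w)) (G (take k (drop i w)))) (H (drop k (drop i w))))"
    by (rule sum.Sigma) auto
  also have "\<dots> = (\<Sum>(j,i)\<in>(SIGMA j:{1..<?n}. {1..<j}). tens (conc (c (take i w)) (G (drop i (take j w)))) (H (drop j w)))"
    \<comment> \<open>\<open>j = i + k\<close> is the position of the second cut\<close>
    by (rule sum.reindex_bij_witness[where i="\<lambda>(j,i). (i, j - i)" and j="\<lambda>(i,k). (i + k, i)"])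
      (auto simp: drop_take add.commute)
  also have "\<dots> = (\<Sum>j\<in>{1..<?n}. \<Sum>i\<in>{1..<j}. tens (conc (c (take i w)) (G (drop i (take j w)))) (H (drop j w)))"
    by (rule sum.Sigma[symmetric]) auto
  also have "\<dots> = cuts (convol c G) H w"
    unfolding cuts_def convol_def by (rule sum.cong) (auto simp: tens_simps min_def intro!: sum.cong)
  finally show ?thesis .
qed

lemma cuts_add:
  "cuts (\<lambda>w. G w + G' w) H w = cuts G H w + cuts G' H w"
  "cuts G (\<lambda>w. H w + H' w) w = cuts G H w + cuts G H' w"
  by (simp_all add: cuts_def tens_simps sum.distrib)

lemma cuts_diff:
  "cuts (\<lambda>w. G w - G' w) H w = cuts G H w - cuts G' H w"
  "cuts G (\<lambda>w. H w - H' w) w = cuts G H w - cuts G H' w"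
  by (simp_all add: cuts_def tens_simps sum_subtractf)

lemma twist_convol: "twist e (convol G H) w = convol (twist e G) (twist e H) w"
  unfolding twist_def convol_def ksign_sum
  by (rule sum.cong) (auto simp: conc_simps ksign_simps distrib_left[symmetric] deg_take_drop add.commute[of "deg (drop _ _)"])

lemma convol_cong:
  "(\<And>i. 0 < i \<Longrightarrow> i < length w \<Longrightarrow> G (take i w) = G' (take i w)) \<Longrightarrow>
   (\<And>i. 0 < i \<Longrightarrow> i < length w \<Longrightarrow> H (drop i w) = H' (drop i w)) \<Longrightarrow> convol G H w = convol G' H' w"
  unfolding convol_def by (rule sum.cong) auto

lemma cuts_cong:
  "(\<And>i. 0 < i \<Longrightarrow> i < length w \<Longrightarrow> G (take i w) = G' (take i w)) \<Longrightarrow>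
   (\<And>i. 0 < i \<Longrightarrow> i < length w \<Longrightarrow> H (drop i w) = H' (drop i w)) \<Longrightarrow> cuts G H w = cuts G' H' w"
  unfolding cuts_def by (rule sum.cong) auto

lemmas sum_conc_left_cuts' = sum_conc_left_cuts sum_conc_left_cuts[simplified]

section \<open>Morphisms and coderivations with given corestriction\<close>

text \<open>
  The coalgebra morphism with corestriction \<open>c\<close>: sum over all ways to split
  \<open>w\<close> into nonempty blocks, recursively on the first block. Values of \<open>c\<close>
  are sums of letters rather than letters so that the identity is literally of this form.
\<close>

function mor_of :: "('a word \<Rightarrow> ('b word \<Rightarrow>\<^sub>0 'r::comm_ring_1)) \<Rightarrow> 'a word \<Rightarrow> ('b word \<Rightarrow>\<^sub>0 'r)" where
  "mor_of c w = c w + (\<Sum>i\<in>{1..<length w}. conc (c (take i w)) (mor_of c (drop i w)))"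
  by pat_completeness auto
termination by (relation "measure (\<lambda>(c, w). length w)") auto

declare mor_of.simps [simp del]

text \<open>
  The map \<open>\<eta>\<close> of degree \<open>e\<close> with corestriction \<open>d\<close> and
  \<open>\<Delta>\<eta> = (\<phi> \<otimes> \<eta> + \<eta> \<otimes> P)\<Delta>\<close>, where
  \<open>\<phi>\<close> is the morphism with corestriction \<open>c\<close>. In the recursion the
  first block is either the one to which \<open>d\<close> is applied, or one to which
  \<open>c\<close> is applied. Coderivations are the case \<open>\<phi> = P = id\<close>, homotopies
  the case of two morphisms.
\<close>

function der_of :: "int \<Rightarrow> ('a word \<Rightarrow> ('b word \<Rightarrow>\<^sub>0 'r::comm_ring_1)) \<Rightarrow> ('a word \<Rightarrow> ('b word \<Rightarrow>\<^sub>0 'r)) \<Rightarrow>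
    ('a word \<Rightarrow> ('b word \<Rightarrow>\<^sub>0 'r)) \<Rightarrow> 'a word \<Rightarrow> ('b word \<Rightarrow>\<^sub>0 'r)" where
  "der_of e c P d w = d w + convol d P w +
     (\<Sum>i\<in>{1..<length w}. conc (twist e c (take i w)) (der_of e c P d (drop i w)))"
  by pat_completeness auto
termination by (relation "measure (\<lambda>(e, c, P, d, w). length w)") auto

declare der_of.simps [simp del]

lemma mor_of_rec: "mor_of c w = c w + convol c (mor_of c) w"
  by (subst mor_of.simps) (simp add: convol_def)

lemma der_of_rec: "der_of e c P d w = d w + convol d P w + convol (twist e c) (der_of e c P d) w"
  by (subst der_of.simps) (simp add: convol_def[of "twist e c"])

definition letters :: "('b word \<Rightarrow>\<^sub>0 'r::comm_ring_1) set" where "letters = supp {w. length w = 1}"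

lemma letters_nonempty: "x \<in> letters \<Longrightarrow> x \<in> supp {w. w \<noteq> []}"
  unfolding letters_def by (erule supp_mono[rotated]) auto

lemma coprod_letters: "x \<in> letters \<Longrightarrow> coprod x = 0"
  unfolding letters_def
  by (rule hom_eq_supp[OF lin_coprod hom_0[OF free.module_axioms free.module_axioms]]) (auto simp: coprod_sng)

lemma twist_letters: "G w \<in> letters \<Longrightarrow> twist e G w \<in> letters"
  unfolding twist_def letters_def by (rule ksign_subspace[OF free.module_axioms subspace_supp])

lemma convol_nonempty:
  assumes "\<And>w. G w \<in> letters"
  shows "convol G H w \<in> supp {w. w \<noteq> []}"
  unfolding convol_def
  by (rule free.subspace_sum[OF subspace_supp], rule conc_supp[OF letters_nonempty[OF assms] in_supp_UNIV]) auto

lemma mor_of_nonempty: "(\<And>w. c w \<in> letters) \<Longrightarrow> mor_of c w \<in> supp {w. w \<noteq> []}"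
  by (subst mor_of_rec) (intro free.subspace_add[OF subspace_supp] convol_nonempty letters_nonempty)

lemma der_of_nonempty: "(\<And>w. c w \<in> letters) \<Longrightarrow> (\<And>w. d w \<in> letters) \<Longrightarrow> der_of e c P d w \<in> supp {w. w \<noteq> []}"
  by (subst der_of_rec) (intro free.subspace_add[OF subspace_supp] convol_nonempty letters_nonempty twist_letters)

lemma coprod_convol:
  assumes c: "\<And>w. c w \<in> letters" and H: "\<And>v. length v < length w \<Longrightarrow> v \<noteq> [] \<Longrightarrow> H v \<in> supp {w. w \<noteq> []}"
    and cop: "\<And>v. length v < length w \<Longrightarrow> coprod (H v) = cop v"
  shows "coprod (convol c H w) = cuts c H w + (\<Sum>i\<in>{1..<length w}. conc_left (c (take i w)) (cop (drop i w)))"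
proof -
  have "coprod (convol c H w) = (\<Sum>i\<in>{1..<length w}. coprod (conc (c (take i w)) (H (drop i w))))"
    by (simp add: convol_def module_hom.sum[OF lin_coprod])
  also have "\<dots> = (\<Sum>i\<in>{1..<length w}. tens (c (take i w)) (H (drop i w)) + conc_left (c (take i w)) (cop (drop i w)))"
    by (rule sum.cong[OF refl], subst coprod_conc) (use c H cop in \<open>auto simp: letters_def\<close>)
  finally show ?thesis by (simp add: sum.distrib cuts_def)
qed

text \<open>
  The morphism property holds exactly, not only modulo the multilinearity relations, because both
  sides are sums over the same block decompositions.
\<close>

lemma coprod_mor_of:
  assumes c: "\<And>w. c w \<in> letters"
  shows "coprod (mor_of c w) = cuts (mor_of c) (mor_of c) w"
proof (induction w rule: length_induct)
  case (1 w)
  have "coprod (convol c (mor_of c) w) =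
      cuts c (mor_of c) w + (\<Sum>i\<in>{1..<length w}. conc_left (c (take i w)) (cuts (mor_of c) (mor_of c) (drop i w)))"
    by (rule coprod_convol) (use c 1 mor_of_nonempty in auto)
  then have "coprod (mor_of c w) = cuts c (mor_of c) w + cuts (convol c (mor_of c)) (mor_of c) w"
    by (subst mor_of_rec) (simp add: module_hom.add[OF lin_coprod] coprod_letters c sum_conc_left_cuts')
  also have "\<dots> = cuts (mor_of c) (mor_of c) w"
    by (simp add: cuts_add(1)[symmetric] mor_of_rec[symmetric])
  finally show ?case .
qed

text \<open>
  A cut of a block decomposition in which one block carries \<open>d\<close> leaves that block on
  one of the two sides.
\<close>

lemma coprod_der_of:
  assumes c: "\<And>w. c w \<in> letters" and d: "\<And>w. d w \<in> letters"
    and P: "\<And>w. w \<noteq> [] \<Longrightarrow> P w \<in> supp {w. w \<noteq> []}" and cop: "\<And>w. coprod (P w) = cuts P P w"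
  shows "coprod (der_of e c P d w) = cuts (twist e (mor_of c)) (der_of e c P d) w + cuts (der_of e c P d) P w"
proof (induction w rule: length_induct)
  case (1 w)
  let ?h = "der_of e c P d" and ?t = "twist e (mor_of c)"
  have 2: "coprod (convol d P w) = cuts d P w + cuts (convol d P) P w"
    by (subst coprod_convol[OF d P cop]) (auto simp: sum_conc_left_cuts')
  have "coprod (convol (twist e c) ?h w) = cuts (twist e c) ?h w +
     (\<Sum>i\<in>{1..<length w}. conc_left (twist e c (take i w)) (cuts ?t ?h (drop i w) + cuts ?h P (drop i w)))"
    by (rule coprod_convol) (use 1 in \<open>auto intro!: der_of_nonempty twist_letters c d\<close>)
  also have "\<dots> = cuts (twist e c) ?h w + cuts (convol (twist e c) ?t) ?h w + cuts (convol (twist e c) ?h) P w"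
    by (simp add: module_hom.add[OF lin_conc_left] sum.distrib sum_conc_left_cuts')
  also have "cuts (twist e c) ?h w + cuts (convol (twist e c) ?t) ?h w = cuts ?t ?h w"
  proof -
    have "(\<lambda>w. twist e c w + convol (twist e c) ?t w) = ?t"
      by (rule ext, subst twist_convol[symmetric]) (simp add: twist_def ksign_simps(3)[symmetric] mor_of_rec[symmetric])
    then show ?thesis by (simp add: cuts_add(1)[symmetric])
  qed
  finally have 3: "coprod (convol (twist e c) ?h w) = cuts ?t ?h w + cuts (convol (twist e c) ?h) P w" .
  have "coprod (?h w) = cuts ?t ?h w + (cuts d P w + cuts (convol d P) P w + cuts (convol (twist e c) ?h) P w)"
    by (subst der_of_rec) (simp add: module_hom.add[OF lin_coprod] coprod_letters d 2 3)
  also have "cuts d P w + cuts (convol d P) P w + cuts (convol (twist e c) ?h) P w = cuts ?h P w"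
    by (simp add: cuts_add(1)[symmetric] der_of_rec[symmetric])
  finally show ?case .
qed

section \<open>Tensor products of maps\<close>

lemma lin_tens_map: "lin (tens_map e \<Phi> \<Psi>)"
  by (simp add: tens_map_def)

lemma tens_map_tens:
  assumes "lin \<Phi>" "lin \<Psi>" "x \<in> supp {w. deg w = d}"
  shows "tens_map e \<Phi> \<Psi> (tens x y) = ksign (e * d) (tens (\<Phi> x) (\<Psi> y))"
proof (rule bilin_eq[where F="\<lambda>x y. tens_map e \<Phi> \<Psi> (tens x y)" and G="\<lambda>x y. ksign (e * d) (tens (\<Phi> x) (\<Psi> y))",
      OF _ _ _ _ _ assms(3) in_supp_UNIV])
qed (auto simp: tens_map_def intro!: hom_ksign intro: hom_comp lin_tens1 lin_tens2 assms hom_comp[OF lin_tens1] hom_comp[OF lin_tens2] hom_comp[OF assms(1) lin_tens1] hom_comp[OF assms(2) lin_tens2])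

lemma tens_map_coprod:
  "tens_map e \<Phi> \<Psi> (coprod (sng w)) = cuts (\<lambda>u. ksign (e * deg u) (\<Phi> (sng u))) (\<lambda>v. \<Psi> (sng v)) w"
  unfolding coprod_sng module_hom.sum[OF lin_tens_map] cuts_def
  by (rule sum.cong) (auto simp: tens_map_def tens_simps)

section \<open>Primitive elements of the tensor coalgebra\<close>

lemma subspace_rel2: "free.subspace (tensor_rel2 V)"
  by (simp add: tensor_rel2_def)

lemma tens_rel2: "x \<in> tensor_rel V \<Longrightarrow> y \<in> tensor_elts V \<Longrightarrow> tens x y \<in> tensor_rel2 V"
  "x \<in> tensor_elts V \<Longrightarrow> y \<in> tensor_rel V \<Longrightarrow> tens x y \<in> tensor_rel2 V"
  unfolding tensor_rel2_def by (rule free.span_base; blast)+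

text \<open>The projection onto words of length one.\<close>

definition first_letters :: "('b word \<Rightarrow>\<^sub>0 'r::comm_ring_1) \<Rightarrow> ('b word \<Rightarrow>\<^sub>0 'r)" where
  "first_letters = lin_ext (\<lambda>w. if length w = 1 then sng w else 0)"

lemma lin_first: "lin first_letters" by (simp add: first_letters_def)

lemma first_rel:
  assumes V: "graded_module V" and x: "x \<in> tensor_rel V"
  shows "first_letters x \<in> tensor_rel V"
proof (rule rel_induct[OF V lin_first subspace_rel _ x])
  fix u n a c b v assume w: "u @ (n, a) # v \<in> words V" "b \<in> part V n"
  have "first_letters (relator V u n a c b v) = (if u = [] \<and> v = [] then relator V u n a c b v else 0)"
    by (simp add: relator_def module_hom.diff[OF lin_first] module_hom.scale[OF lin_first])
      (simp add: first_letters_def)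
  then show "first_letters (relator V u n a c b v) \<in> tensor_rel V"
    using relator_rel[OF V w] free.subspace_0[OF subspace_rel[of V]] by auto
qed

lemma first_supp: "x \<in> supp S \<Longrightarrow> first_letters x \<in> supp S"
  by (rule hom_supp[OF lin_first subspace_supp])
    (auto simp: first_letters_def sng_supp free.subspace_0[OF subspace_supp])

text \<open>
  Cutting off the first letter and gluing it back is a left inverse of the coproduct on words of
  length at least two. It respects the relations.
\<close>

lemma coprod_injective:
  fixes V :: "('r::comm_ring_1, 'a::ab_group_add) dgmod"
  assumes V: "graded_module V" and x: "x \<in> tensor_elts V" and cop: "coprod x \<in> tensor_rel2 V"
  shows "x - first_letters x \<in> tensor_rel V"
proof -
  \<comment> \<open>\<open>q\<close> cuts off the first letter and glues it back\<close>
  define q :: "('a word \<times> 'a word \<Rightarrow>\<^sub>0 'r) \<Rightarrow> ('a word \<Rightarrow>\<^sub>0 'r)" where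
    "q = lin_ext (\<lambda>(u, v). conc (first_letters (sng u)) (sng v))"
  have q: "lin q" by (simp add: q_def)
  have q_tens: "q (tens y z) = conc (first_letters y) z" for y z
    by (rule bilin_eq[where F="\<lambda>y z. q (tens y z)" and G="\<lambda>y z. conc (first_letters y) z" and S=UNIV and T=UNIV])
      (auto intro: hom_comp lin_tens1 lin_tens2 lin_conc1 lin_conc2 lin_first q in_supp_UNIV simp: q_def)
  have "q ` tensor_rel2 V \<subseteq> tensor_rel V"
  proof -
    have "tensor_rel2 V \<subseteq> q -` tensor_rel V" unfolding tensor_rel2_def
    proof (rule free.span_minimal[OF _ module_hom.subspace_vimage[OF q subspace_rel]], intro Un_least subsetI vimageI2; clarify)
      fix y z :: "'a word \<Rightarrow>\<^sub>0 'r"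
      show "q (tens y z) \<in> tensor_rel V" if "y \<in> tensor_rel V" "z \<in> tensor_elts V"
        unfolding q_tens by (rule rel_conc1[OF V first_rel[OF V that(1)] that(2)])
      show "q (tens y z) \<in> tensor_rel V" if "y \<in> tensor_elts V" "z \<in> tensor_rel V"
        unfolding q_tens by (rule rel_conc2[OF V that(2)]) (use that(1) in \<open>simp add: elts_supp first_supp\<close>)
    qed
    then show ?thesis by auto
  qed
  moreover have "q (coprod x) = x - first_letters x"
  proof (rule hom_eq_supp[where S="words V", OF hom_comp[OF lin_coprod q] hom_diff[OF lin_id(1) lin_first]])
    fix w assume "w \<in> words V"
    then have w: "w \<noteq> []" by (rule words_nonempty)
    have "q (coprod (sng w)) = (\<Sum>i\<in>{1..<length w}. if i = 1 then sng w else 0)"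
      unfolding coprod_sng module_hom.sum[OF q]
      by (rule sum.cong) (auto simp: q_def first_letters_def conc_simps)
    also have "\<dots> = sng w - first_letters (sng w)"
      using w by (cases "length w = 1") (auto simp: first_letters_def Suc_lessI neq_Nil_conv)
    finally show "q (coprod (sng w)) = sng w - first_letters (sng w)" .
  qed (use x in \<open>simp add: elts_supp\<close>)
  ultimately show ?thesis using cop by auto
qed

text \<open>
  The components of the identity morphism. Its linear extension is the corestriction, i.e. the
  projection of a sum of words to its one-letter part.
\<close>

definition id_fam :: "'a word \<Rightarrow> 'a::zero" where
  "id_fam w = (case w of [(n, a)] \<Rightarrow> a | _ \<Rightarrow> 0)"

lemma id_fam_simps [simp]: "id_fam [(n, a)] = a" "length w \<noteq> 1 \<Longrightarrow> id_fam w = 0"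
  by (auto simp: id_fam_def split: list.split)

text \<open>
  A letter \<open>0\<close> is not the zero element of the free module, only of the quotient.
\<close>

lemma letter0_rel:
  assumes V: "graded_module V"
  shows "sng [(d, 0)] \<in> tensor_rel V"
  using free.subspace_neg[OF subspace_rel relator_rel[OF V, of "[]" d 0 "[]" 0 1]]
    module.subspace_0[OF gm_module[OF V] gm_part[OF V]]
  by (simp add: relator_def words_Cons module.scale_zero_right[OF gm_module[OF V]])

text \<open>
  Homogeneity is needed: only then do the letters of \<open>x\<close> lie in a common part and can
  be added.
\<close>

lemma first_letters_rel:
  assumes V: "graded_module V" and x: "x \<in> tensor_elts_deg V d"
  shows "first_letters x - sng [(d, ev (scl V) id_fam x)] \<in> tensor_rel V \<and> ev (scl V) id_fam x \<in> part V d"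
proof -
  interpret V: module "scl V" by (rule gm_module[OF V])
  note ph = ev_hom[OF V.module_axioms, of id_fam]
  note z = V.subspace_0[OF gm_part[OF V]]
  note zero = letter0_rel[OF V, of d]
  let ?S = "{x. first_letters x - sng [(d, ev (scl V) id_fam x)] \<in> tensor_rel V \<and> ev (scl V) id_fam x \<in> part V d}"
  have lin1: "sng [(d, a + scl V c b)] - sng [(d, a)] - fscale c (sng [(d, b)]) \<in> tensor_rel V"
    if "a \<in> part V d" "b \<in> part V d" for a b c
    using relator_rel[OF V, of "[]" d a "[]" b c] that by (simp add: relator_def words_Cons)
  have "free.subspace ?S"
    unfolding free.subspace_def
  proof (intro conjI ballI allI; (elim CollectE conjE)?)
    show "0 \<in> ?S"
      using free.subspace_neg[OF subspace_rel zero] z by (simp add: module_hom.zero[OF ph] module_hom.zero[OF lin_first])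
  next
    fix x y
    assume a: "first_letters x - sng [(d, ev (scl V) id_fam x)] \<in> tensor_rel V" "ev (scl V) id_fam x \<in> part V d"
      "first_letters y - sng [(d, ev (scl V) id_fam y)] \<in> tensor_rel V" "ev (scl V) id_fam y \<in> part V d"
    show "x + y \<in> ?S"
      using free.subspace_diff[OF subspace_rel free.subspace_add[OF subspace_rel a(1,3)] lin1[OF a(2,4), of 1]]
       V.subspace_add[OF gm_part[OF V] a(2,4)]
      by (simp add: module_hom.add[OF ph] module_hom.add[OF lin_first] algebra_simps)
  next
    fix c x
    assume a: "first_letters x - sng [(d, ev (scl V) id_fam x)] \<in> tensor_rel V" "ev (scl V) id_fam x \<in> part V d"
    have "fscale c (first_letters x - sng [(d, ev (scl V) id_fam x)]) - (sng [(d, 0 + scl V c (ev (scl V) id_fam x))] - sng [(d, 0)] - fscale c (sng [(d, ev (scl V) id_fam x)])) - sng [(d, 0)] \<in> tensor_rel V"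
      by (intro free.subspace_diff[OF subspace_rel] lin1 z a zero free.subspace_scale[OF subspace_rel])
    then show "fscale c x \<in> ?S"
       using V.subspace_scale[OF gm_part[OF V] a(2)]
      by (simp add: module_hom.scale[OF ph] module_hom.scale[OF lin_first] algebra_simps free.scale_right_diff_distrib)
  qed
  moreover have "sng w \<in> ?S" if "w \<in> words V" "deg w = d" for w
  proof (cases "length w = 1")
    case True
    then obtain n a where "w = [(n, a)]" by (metis One_nat_def length_0_conv length_Suc_conv surj_pair)
    with that show ?thesis
      by (simp add: ev_sng[OF V.module_axioms] words_Cons free.subspace_0[OF subspace_rel])
        (simp add: first_letters_def free.subspace_0[OF subspace_rel])
  next
    case False
    with that z zero show ?thesis
      by (simp add: ev_sng[OF V.module_axioms] words_Cons free.subspace_0[OF subspace_rel])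
        (simp add: first_letters_def free.subspace_neg[OF subspace_rel])
  qed
  ultimately have "tensor_elts_deg V d \<subseteq> ?S"
    unfolding elts_supp supp_span by (intro free.span_minimal) auto
  with x show ?thesis by auto
qed

text \<open>
  The elements with vanishing coproduct are the letters. All uniqueness and obstruction statements
  rest on this.
\<close>

lemma primitive_rel:
  assumes "graded_module V" "x \<in> tensor_elts_deg V d" "coprod x \<in> tensor_rel2 V"
  shows "x - sng [(d, ev (scl V) id_fam x)] \<in> tensor_rel V"
proof -
  have "x \<in> tensor_elts V" using assms(2) by (auto simp: elts_supp supp_def)
  from free.subspace_add[OF subspace_rel coprod_injective[OF assms(1) this assms(3)] conjunct1[OF first_letters_rel[OF assms(1,2)]]]
  show ?thesis by simp
qed


section \<open>Multilinear families of constant degree\<close>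

lemma multilinear_family_iff:
  assumes V: "graded_module V" and W: "graded_module W"
  shows "multilinear_family V W m e f \<longleftrightarrow>
    (\<forall>w\<in>words V. length w \<ge> m \<longrightarrow> f w \<in> part W (deg w + e (length w))) \<and>
    (\<forall>u n a c b v. u @ (n, a) # v \<in> words V \<longrightarrow> b \<in> part V n \<longrightarrow> length (u @ (n, a) # v) \<ge> m \<longrightarrow>
       f (u @ (n, a + scl V c b) # v) = f (u @ (n, a) # v) + scl W c (f (u @ (n, b) # v)))"
    (is "_ \<longleftrightarrow> ?D \<and> ?C")
proof
  interpret V: module "scl V" by (rule gm_module[OF V])
  interpret W: module "scl W" by (rule gm_module[OF W])
  {
    assume f: "multilinear_family V W m e f"
    have ?C
    proof (intro allI impI)
      fix u n a c b v assume w: "u @ (n, a) # v \<in> words V" "b \<in> part V n" "m \<le> length (u @ (n, a) # v)"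
      have "scl V c b \<in> part V n" using w V.subspace_scale[OF gm_part[OF V]] by simp
      with f w have 1: "f (u @ (n, a + scl V c b) # v) = f (u @ (n, a) # v) + f (u @ (n, scl V c b) # v)"
        unfolding multilinear_family_def by blast
      have "m \<le> length (u @ (n, b) # v)" using w by simp
      with f w words_comb(1)[OF V w(1,2)] have "f (u @ (n, scl V c b) # v) = scl W c (f (u @ (n, b) # v))"
        unfolding multilinear_family_def by blast
      with 1 show "f (u @ (n, a + scl V c b) # v) = f (u @ (n, a) # v) + scl W c (f (u @ (n, b) # v))"
        by simp
    qed
    then show "?D \<and> ?C" using f by (simp add: multilinear_family_def)
  }
  assume f: "?D \<and> ?C"
  show "multilinear_family V W m e f" unfolding multilinear_family_def
  proof (intro conjI allI impI ballI; (elim conjE)?)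
    fix w assume "w \<in> words V" "m \<le> length w" with f show "f w \<in> part W (deg w + e (length w))" by blast
  next
    fix u n a v b assume w: "u @ (n, a) # v \<in> words V" "m \<le> length (u @ (n, a) # v)" "b \<in> part V n"
    with f have "f (u @ (n, a + scl V 1 b) # v) = f (u @ (n, a) # v) + scl W 1 (f (u @ (n, b) # v))" by blast
    then show "f (u @ (n, a + b) # v) = f (u @ (n, a) # v) + f (u @ (n, b) # v)" by simp
  next
    fix u n a v c assume w: "u @ (n, a) # v \<in> words V" "m \<le> length (u @ (n, a) # v)"
    have z: "0 \<in> part V n" by (rule V.subspace_0[OF gm_part[OF V]])
    have a: "a \<in> part V n" using w by (simp add: words_append words_Cons)
    have w0: "u @ (n, 0) # v \<in> words V" using words_comb(1)[OF V w(1) z] .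
    have l: "m \<le> length (u @ (n, 0) # v)" using w by simp
    have "f (u @ (n, 0 + scl V 1 0) # v) = f (u @ (n, 0) # v) + scl W 1 (f (u @ (n, 0) # v))"
      using f w0 z l by blast
    then have "f (u @ (n, 0) # v) = 0" by simp
    moreover have "f (u @ (n, 0 + scl V c a) # v) = f (u @ (n, 0) # v) + scl W c (f (u @ (n, a) # v))"
      using f w0 a l by blast
    ultimately show "f (u @ (n, scl V c a) # v) = scl W c (f (u @ (n, a) # v))" by simp
  qed
qed

text \<open>On suspended modules all components of a map have the same degree.\<close>

definition mlin :: "('r::comm_ring_1, 'a::ab_group_add) dgmod \<Rightarrow> ('r, 'b::ab_group_add) dgmod \<Rightarrow> int \<Rightarrow> ('a word \<Rightarrow> 'b) \<Rightarrow> bool" where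
  "mlin V W e f \<longleftrightarrow> multilinear_family V W 1 (\<lambda>_. e) f"

lemma words_len: "w \<in> words V \<Longrightarrow> 1 \<le> length w"
  by (cases w) (auto simp: words_def)

lemma mlin_iff:
  assumes "graded_module V" "graded_module W"
  shows "mlin V W e f \<longleftrightarrow> (\<forall>w\<in>words V. f w \<in> part W (deg w + e)) \<and>
    (\<forall>u n a c b v. u @ (n, a) # v \<in> words V \<longrightarrow> b \<in> part V n \<longrightarrow>
       f (u @ (n, a + scl V c b) # v) = f (u @ (n, a) # v) + scl W c (f (u @ (n, b) # v)))"
  unfolding mlin_def multilinear_family_iff[OF assms] using words_len[of _ V] by simp

lemma mlin_in: "mlin V W e f \<Longrightarrow> w \<in> words V \<Longrightarrow> f w \<in> part W (deg w + e)"
  unfolding mlin_def multilinear_family_def using words_len[of w V] by blast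

lemma ev_relator:
  assumes "module s"
  shows "ev s f (relator V u n a c b v) = f (u @ (n, a + scl V c b) # v) - f (u @ (n, a) # v) - s c (f (u @ (n, b) # v))"
  by (simp add: relator_def module_hom.diff[OF ev_hom[OF assms]] module_hom.scale[OF ev_hom[OF assms]] ev_sng[OF assms])

lemma ev_mlin_rel:
  assumes V: "graded_module V" and W: "graded_module W" and f: "mlin V W e f" and x: "x \<in> tensor_rel V"
  shows "ev (scl W) f x = 0"
proof -
  interpret W: module "scl W" by (rule gm_module[OF W])
  have "ev (scl W) f x \<in> {0}"
    by (rule rel_induct[OF V ev_hom[OF W.module_axioms] W.subspace_single_0 _ x])
      (use f in \<open>simp add: ev_relator[OF W.module_axioms] mlin_iff[OF V W]\<close>)
  then show ?thesis by simp
qed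

lemma ev_mlin_in:
  assumes W: "graded_module W" and f: "mlin V W e f" and x: "x \<in> tensor_elts_deg V d"
  shows "ev (scl W) f x \<in> part W (d + e)"
  by (rule hom_supp[OF ev_hom[OF gm_module[OF W]] gm_part[OF W] _ x[unfolded elts_supp]])
    (auto simp: ev_sng[OF gm_module[OF W]] mlin_in[OF f])

section \<open>Canonical lifts of multilinear families\<close>

lemma tensor_homD:
  assumes "tensor_hom V W e \<Phi>"
  shows "lin \<Phi>" "x \<in> tensor_elts_deg V d \<Longrightarrow> \<Phi> x \<in> tensor_elts_deg W (d + e)"
    "x \<in> tensor_rel V \<Longrightarrow> \<Phi> x \<in> tensor_rel W"
  using assms by (auto simp: tensor_hom_def)

lemma elts_degD: "x \<in> tensor_elts_deg V d \<Longrightarrow> x \<in> tensor_elts V"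
  by (auto simp: tensor_elts_def tensor_elts_deg_def)

lemma sng_elts: "w \<in> words V \<Longrightarrow> sng w \<in> tensor_elts_deg V (deg w)" "w \<in> words V \<Longrightarrow> sng w \<in> tensor_elts V"
  by (simp_all add: elts_supp sng_supp)

lemma tensor_hom_elts:
  assumes "tensor_hom V W e \<Phi>" "x \<in> tensor_elts V"
  shows "\<Phi> x \<in> tensor_elts W"
  unfolding elts_supp
  by (rule hom_supp[OF tensor_homD(1)[OF assms(1)] subspace_supp _ assms(2)[unfolded elts_supp]])
    (metis tensor_homD(2)[OF assms(1) sng_elts(1)] elts_degD elts_supp(1))

text \<open>
  \<open>G\<close> respects degrees and relations on words of length at most \<open>N\<close>. The
  bound is what makes the recursive definitions of lifts accessible to induction.
\<close>

definition hom_upto :: "('r::comm_ring_1, 'a::ab_group_add) dgmod \<Rightarrow> ('r, 'b::ab_group_add) dgmod \<Rightarrow> int \<Rightarrow> nat \<Rightarrow>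
    ('a word \<Rightarrow> ('b word \<Rightarrow>\<^sub>0 'r)) \<Rightarrow> bool" where
  "hom_upto V W e N G \<longleftrightarrow> (\<forall>w\<in>words V. length w \<le> N \<longrightarrow> G w \<in> tensor_elts_deg W (deg w + e)) \<and>
     (\<forall>u n a c b v. u @ (n, a) # v \<in> words V \<longrightarrow> b \<in> part V n \<longrightarrow> length (u @ (n, a) # v) \<le> N \<longrightarrow>
        lin_ext G (relator V u n a c b v) \<in> tensor_rel W)"

lemma hom_upto_relator_le:
  "hom_upto V W e N G \<Longrightarrow> u @ (n, a) # v \<in> words V \<Longrightarrow> b \<in> part V n \<Longrightarrow> length (u @ (n, a) # v) \<le> N \<Longrightarrow>
    lin_ext G (relator V u n a c b v) \<in> tensor_rel W"
  unfolding hom_upto_def by blast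

lemma hom_upto_relator:
  "(\<And>N. hom_upto V W e N G) \<Longrightarrow> u @ (n, a) # v \<in> words V \<Longrightarrow> b \<in> part V n \<Longrightarrow>
    lin_ext G (relator V u n a c b v) \<in> tensor_rel W"
  unfolding hom_upto_def by blast

lemma lin_ext_relator: "lin_ext G (relator V u n a c b v) =
  G (u @ (n, a + scl V c b) # v) - G (u @ (n, a) # v) - fscale c (G (u @ (n, b) # v))"
  unfolding lin_ext_ev by (rule ev_relator) (rule free.module_axioms)

lemma tensor_hom_lin_ext:
  assumes V: "graded_module V" and G: "\<And>N. hom_upto V W e N G"
  shows "tensor_hom V W e (lin_ext G)"
  unfolding tensor_hom_def
proof (intro conjI allI)
  show "lin_ext G ` tensor_elts_deg V d \<subseteq> tensor_elts_deg W (d + e)" for d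
    unfolding elts_supp
    by (rule image_subsetI, rule hom_supp[OF lin_lin_ext subspace_supp])
      (use G in \<open>auto simp: hom_upto_def elts_supp\<close>)
  show "lin_ext G ` tensor_rel V \<subseteq> tensor_rel W"
    by (rule image_subsetI, rule rel_induct[OF V lin_lin_ext subspace_rel])
      (use hom_upto_relator[OF G] in auto)
qed simp

lemma hom_upto_add: "hom_upto V W e N G \<Longrightarrow> hom_upto V W e N H \<Longrightarrow> hom_upto V W e N (\<lambda>w. G w + H w)"
proof -
  assume a: "hom_upto V W e N G" "hom_upto V W e N H"
  have 1: "lin_ext (\<lambda>w. G w + H w) x = lin_ext G x + lin_ext H x" for x
    by (simp add: lin_ext_def free.scale_right_distrib sum.distrib)
  show ?thesis using a unfolding hom_upto_def 1
    by (auto simp: elts_supp intro!: free.subspace_add[OF subspace_supp] free.subspace_add[OF subspace_rel])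
qed

lemma hom_upto_twist: "hom_upto V W e N G \<Longrightarrow> hom_upto V W e N (twist s G)"
proof -
  assume a: "hom_upto V W e N G"
  have 1: "lin_ext (twist s G) (relator V u n a c b v) = ksign (s * (deg u + n + deg v)) (lin_ext G (relator V u n a c b v))" for u n a c b v
    by (simp add: lin_ext_relator twist_def ksign_simps ksign_scale[OF free.module_axioms] add.assoc)
  show ?thesis using a unfolding hom_upto_def 1
    by (auto simp: elts_supp twist_def intro!: ksign_subspace[OF free.module_axioms subspace_rel] ksign_subspace[OF free.module_axioms subspace_supp])
qed

lemma conc_deg:
  assumes "x \<in> tensor_elts_deg V d" "y \<in> tensor_elts_deg V d'" "e = d + d'"
  shows "conc x y \<in> tensor_elts_deg V e"
  using assms unfolding elts_supp by (elim conc_supp) (auto simp: words_append dest: words_nonempty)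

text \<open>
  The letter in which linearity is tested lies either before or after the cut, so it concerns only
  one of the two factors.
\<close>

lemma hom_upto_convol:
  assumes V: "graded_module V" and W: "graded_module W" and G: "hom_upto V W e1 N G" and H: "hom_upto V W e2 N H"
  shows "hom_upto V W (e1 + e2) (Suc N) (convol G H)"
  unfolding hom_upto_def
proof (intro conjI ballI allI impI)
  fix w assume w: "w \<in> words V" and l: "length w \<le> Suc N"
  show "convol G H w \<in> tensor_elts_deg W (deg w + (e1 + e2))"
    unfolding convol_def elts_supp
  proof (rule free.subspace_sum[OF subspace_supp], fold elts_supp)
    fix i assume i: "i \<in> {1..<length w}"
    have "take i w \<in> words V" "drop i w \<in> words V"
      using i w by (auto intro!: words_take words_drop)
    then have "G (take i w) \<in> tensor_elts_deg W (deg (take i w) + e1)" "H (drop i w) \<in> tensor_elts_deg W (deg (drop i w) + e2)"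
      using G H l i by (auto simp: hom_upto_def)
    then show "conc (G (take i w)) (H (drop i w)) \<in> tensor_elts_deg W (deg w + (e1 + e2))"
      by (rule conc_deg) (simp add: deg_take_drop[of i w, symmetric])
  qed
next
  fix u n a c b v
  assume w: "u @ (n, a) # v \<in> words V" and b: "b \<in> part V n" and l: "length (u @ (n, a) # v) \<le> Suc N"
  let ?n = "Suc (length u + length v)"
  have GE: "G x \<in> tensor_elts W" if "x \<in> words V" "length x \<le> N" for x
    using G that by (auto simp: hom_upto_def intro: elts_degD)
  have HE: "H x \<in> tensor_elts W" if "x \<in> words V" "length x \<le> N" for x
    using H that by (auto simp: hom_upto_def intro: elts_degD)
  have "lin_ext (convol G H) (relator V u n a c b v) = (\<Sum>i\<in>{1..<?n}.
      (conc (G (take i (u @ (n, a + scl V c b) # v))) (H (drop i (u @ (n, a + scl V c b) # v)))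
      - conc (G (take i (u @ (n, a) # v))) (H (drop i (u @ (n, a) # v)))
      - fscale c (conc (G (take i (u @ (n, b) # v))) (H (drop i (u @ (n, b) # v))))))"
    by (simp add: lin_ext_relator convol_def sum_subtractf free.scale_sum_right free.scale_right_distrib)
  also have "\<dots> \<in> tensor_rel W"
  proof (rule free.subspace_sum[OF subspace_rel])
    fix i assume i: "i \<in> {1..<?n}"
    show "conc (G (take i (u @ (n, a + scl V c b) # v))) (H (drop i (u @ (n, a + scl V c b) # v)))
      - conc (G (take i (u @ (n, a) # v))) (H (drop i (u @ (n, a) # v)))
      - fscale c (conc (G (take i (u @ (n, b) # v))) (H (drop i (u @ (n, b) # v)))) \<in> tensor_rel W" (is "?X \<in> _")
    proof (cases "i \<le> length u")
      case True
      have "?X = conc (G (take i u)) (lin_ext H (relator V (drop i u) n a c b v))"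
        using True by (simp add: lin_ext_relator conc_simps)
      moreover have "G (take i u) \<in> tensor_elts W"
        by (rule GE) (use i True l w in \<open>auto simp: words_append intro!: words_take\<close>)
      moreover have "lin_ext H (relator V (drop i u) n a c b v) \<in> tensor_rel W"
        by (rule hom_upto_relator_le[OF H _ b]) (use i True l w in \<open>auto simp: words_append words_Cons intro!: words_drop\<close>)
      ultimately show ?thesis using rel_conc2[OF W] by simp
    next
      case False
      define k where "k = i - Suc (length u)"
      have ik: "i = Suc (length u) + k" using False by (simp add: k_def)
      have "?X = conc (lin_ext G (relator V u n a c b (take k v))) (H (drop k v))"
        by (simp add: lin_ext_relator conc_simps ik)
      moreover have "H (drop k v) \<in> tensor_elts W"
        by (rule HE) (use i l w in \<open>auto simp: ik words_append words_Cons intro!: words_drop\<close>)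
      moreover have "lin_ext G (relator V u n a c b (take k v)) \<in> tensor_rel W"
        by (rule hom_upto_relator_le[OF G _ b]) (use i l w in \<open>auto simp: ik words_append words_Cons intro!: words_take\<close>)
      ultimately show ?thesis using rel_conc1[OF W] by simp
    qed
  qed
  finally show "lin_ext (convol G H) (relator V u n a c b v) \<in> tensor_rel W" .
qed

lemma hom_upto_0: "hom_upto V W e 0 G"
  by (auto simp: hom_upto_def words_def)

lemma hom_upto_mor_of:
  assumes V: "graded_module V" and W: "graded_module W" and c: "\<And>N. hom_upto V W 0 N c"
  shows "hom_upto V W 0 N (mor_of c)"
proof (induction N)
  case (Suc N)
  have "hom_upto V W 0 (Suc N) (\<lambda>w. c w + convol c (mor_of c) w)"
    using hom_upto_convol[OF V W c Suc] by (intro hom_upto_add c) simp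
  then show ?case by (simp add: mor_of_rec[symmetric])
qed (rule hom_upto_0)

lemma hom_upto_der_of:
  assumes V: "graded_module V" and W: "graded_module W" and c: "\<And>N. hom_upto V W 0 N c"
    and d: "\<And>N. hom_upto V W e N d" and P: "\<And>N. hom_upto V W 0 N P"
  shows "hom_upto V W e N (der_of s c P d)"
proof (induction N)
  case (Suc N)
  have "hom_upto V W e (Suc N) (\<lambda>w. d w + convol d P w + convol (twist s c) (der_of s c P d) w)"
    using hom_upto_convol[OF V W d P] hom_upto_convol[OF V W hom_upto_twist[OF c] Suc] by (intro hom_upto_add d) simp_all
  then show ?case by (simp add: der_of_rec[symmetric])
qed (rule hom_upto_0)

text \<open>
  The value \<open>0\<close> gives the zero element rather than the letter \<open>0\<close>, so that
  lifts of families concentrated in arity one preserve word length exactly.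
\<close>

definition letter_of :: "int \<Rightarrow> ('a word \<Rightarrow> 'b::ab_group_add) \<Rightarrow> 'a word \<Rightarrow> ('b word \<Rightarrow>\<^sub>0 'r::comm_ring_1)" where
  "letter_of e f w = (if w = [] \<or> f w = 0 then 0 else sng [(deg w + e, f w)])"

text \<open>
  The corestriction of the identity. It differs from \<open>letter_of 0 id_fam\<close> on letters
  \<open>0\<close>, for which the latter vanishes.
\<close>

definition id_letter :: "'a word \<Rightarrow> ('a word \<Rightarrow>\<^sub>0 'r::comm_ring_1)" where
  "id_letter w = (if length w = 1 then sng w else 0)"

lemma letter_of_in: "letter_of e f w \<in> letters" and id_letter_in: "id_letter w \<in> letters"
  by (auto simp: letter_of_def id_letter_def letters_def sng_supp free.subspace_0[OF subspace_supp])

lemma letter_of_nil [simp]: "letter_of e f [] = 0" by (simp add: letter_of_def)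

lemma letter_of_rel:
  assumes "graded_module W" "w \<noteq> []"
  shows "sng [(deg w + e, f w)] - letter_of e f w \<in> tensor_rel W"
  using letter0_rel[OF assms(1), of "deg w + e"] assms(2) free.subspace_0[OF subspace_rel[of W]] by (auto simp: letter_of_def)

lemma hom_upto_letter_of:
  fixes V :: "('c::comm_ring_1, 'a::ab_group_add) dgmod" and W :: "('c, 'd::ab_group_add) dgmod"
  assumes V: "graded_module V" and W: "graded_module W" and f: "mlin V W e f"
  shows "hom_upto V W e N (letter_of e f)"
  unfolding hom_upto_def
proof (intro conjI ballI allI impI)
  fix w assume "w \<in> words V"
  then show "letter_of e f w \<in> tensor_elts_deg W (deg w + e)"
    using mlin_in[OF f]
    by (auto simp: letter_of_def elts_supp free.subspace_0[OF subspace_supp] words_Cons intro!: sng_supp)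
next
  fix u n a c b v assume w: "u @ (n, a) # v \<in> words V" and b: "b \<in> part V n"
  let ?d = "deg u + (n + deg v) + e"
  let ?w = "\<lambda>a. u @ (n, a) # v" and ?s = "\<lambda>a. sng [(?d, f (u @ (n, a) # v))]"
  have fin: "f (?w a) \<in> part W ?d" "f (?w b) \<in> part W ?d"
    using mlin_in[OF f w] mlin_in[OF f words_comb(1)[OF V w b]] by (simp_all add: add.assoc)
  have "relator W [] ?d (f (?w a)) c (f (?w b)) [] \<in> tensor_rel W"
    using fin by (intro relator_rel[OF W]) (auto simp: words_Cons)
  then have 1: "?s (a + scl V c b) - ?s a - fscale c (?s b) \<in> tensor_rel W"
    using f w b by (simp add: relator_def mlin_iff[OF V W])
  have cancel: "(s1 - s2 - s3) - (s1 - f1) + (s2 - f2) + (s3 - f3) = f1 - f2 - f3"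
    for s1 s2 s3 f1 f2 f3 :: "'d word \<Rightarrow>\<^sub>0 'c" by simp
  have 2: "?s x - letter_of e f (?w x) \<in> tensor_rel W" for x
    using letter_of_rel[OF W, of "?w x" e f] by (simp add: add.assoc)
  have "(?s (a + scl V c b) - ?s a - fscale c (?s b)) - (?s (a + scl V c b) - letter_of e f (?w (a + scl V c b)))
     + (?s a - letter_of e f (?w a)) + fscale c (?s b - letter_of e f (?w b)) \<in> tensor_rel W"
    by (intro free.subspace_add[OF subspace_rel] free.subspace_diff[OF subspace_rel] free.subspace_scale[OF subspace_rel] 1 2)
  then show "lin_ext (letter_of e f) (relator V u n a c b v) \<in> tensor_rel W"
    unfolding lin_ext_relator free.scale_right_diff_distrib by (simp only: cancel)
qed

lemma hom_upto_sng: assumes "graded_module V" shows "hom_upto V V 0 N sng"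
proof -
  have "lin_ext sng (relator V u n a c b v) = relator V u n a c b v" for u n a c b v
    unfolding lin_ext_relator by (simp add: relator_def)
  then show ?thesis using relator_rel[OF assms]
    by (auto simp: hom_upto_def elts_supp sng_supp)
qed

lemma hom_upto_id_letter: assumes "graded_module V" shows "hom_upto V V 0 N id_letter"
proof -
  have "lin_ext id_letter (relator V u n a c b v) = (if u = [] \<and> v = [] then relator V u n a c b v else 0)" for u n a c b v
    unfolding lin_ext_relator by (simp add: relator_def id_letter_def)
  then show ?thesis using relator_rel[OF assms]
    by (auto simp: hom_upto_def id_letter_def elts_supp sng_supp free.subspace_0[OF subspace_rel] free.subspace_0[OF subspace_supp])
qed

lemma mor_of_id_letter: "w \<noteq> [] \<Longrightarrow> mor_of id_letter w = (sng w :: 'a word \<Rightarrow>\<^sub>0 'r::comm_ring_1)"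
proof (induction w rule: length_induct)
  case (1 w)
  have "convol id_letter (mor_of id_letter) w = (\<Sum>i\<in>{1..<length w}. if i = 1 then sng w else (0 :: _ \<Rightarrow>\<^sub>0 'r))"
    unfolding convol_def
  proof (rule sum.cong[OF refl])
    fix i assume i: "i \<in> {1..<length w}"
    then have "length (drop i w) < length w" "drop i w \<noteq> []" by auto
    then have "mor_of id_letter (drop i w) = (sng (drop i w) :: _ \<Rightarrow>\<^sub>0 'r)" using 1(1)[rule_format, of "drop i w"] by simp
    with i show "conc (id_letter (take i w)) (mor_of id_letter (drop i w)) = (if i = 1 then sng w else (0 :: _ \<Rightarrow>\<^sub>0 'r))"
      by (auto simp: id_letter_def conc_simps min_def)
  qed
  with 1(2) show ?case
    by (subst mor_of_rec) (cases "length w = 1"; auto simp: id_letter_def Suc_lessI neq_Nil_conv)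
qed

text \<open>The explicit lifts of the families of a morphism, a homotopy and an algebra structure.\<close>

definition mor_lift :: "('a word \<Rightarrow> 'b::ab_group_add) \<Rightarrow> ('a word \<Rightarrow>\<^sub>0 'r::comm_ring_1) \<Rightarrow> ('b word \<Rightarrow>\<^sub>0 'r)" where
  "mor_lift f = lin_ext (mor_of (letter_of 0 f))"

definition htp_lift :: "('a word \<Rightarrow> 'b::ab_group_add) \<Rightarrow> ('a word \<Rightarrow> 'b) \<Rightarrow> ('a word \<Rightarrow> 'b) \<Rightarrow> ('a word \<Rightarrow>\<^sub>0 'r::comm_ring_1) \<Rightarrow> ('b word \<Rightarrow>\<^sub>0 'r)" where
  "htp_lift f g h = lin_ext (der_of 1 (letter_of 0 f) (mor_of (letter_of 0 g)) (letter_of 1 h))"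

definition der_lift :: "('a word \<Rightarrow> 'a::ab_group_add) \<Rightarrow> ('a word \<Rightarrow>\<^sub>0 'r::comm_ring_1) \<Rightarrow> ('a word \<Rightarrow>\<^sub>0 'r)" where
  "der_lift m = lin_ext (der_of (-1) id_letter sng (letter_of (-1) m))"

lemma lin_lifts: "lin (mor_lift f)" "lin (htp_lift f g h)" "lin (der_lift m)"
  by (simp_all add: mor_lift_def htp_lift_def der_lift_def)

lemma tensor_hom_mor_lift:
  "graded_module V \<Longrightarrow> graded_module W \<Longrightarrow> mlin V W 0 f \<Longrightarrow> tensor_hom V W 0 (mor_lift f)"
  unfolding mor_lift_def by (intro tensor_hom_lin_ext hom_upto_mor_of hom_upto_letter_of)

lemma tensor_hom_htp_lift:
  "graded_module V \<Longrightarrow> graded_module W \<Longrightarrow> mlin V W 0 f \<Longrightarrow> mlin V W 0 g \<Longrightarrow> mlin V W 1 h \<Longrightarrow>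
   tensor_hom V W 1 (htp_lift f g h)"
  unfolding htp_lift_def by (intro tensor_hom_lin_ext hom_upto_der_of hom_upto_mor_of hom_upto_letter_of)

lemma tensor_hom_der_lift:
  "graded_module V \<Longrightarrow> mlin V V (-1) m \<Longrightarrow> tensor_hom V V (-1) (der_lift m)"
  unfolding der_lift_def by (intro tensor_hom_lin_ext hom_upto_der_of hom_upto_id_letter hom_upto_sng hom_upto_letter_of)

lemma coprod_mor_lift: "coprod (mor_lift f (sng w)) = cuts (\<lambda>u. mor_lift f (sng u)) (\<lambda>u. mor_lift f (sng u)) w"
  by (simp add: mor_lift_def coprod_mor_of letter_of_in)

lemma coprod_htp_lift: "coprod (htp_lift f g h (sng w)) =
    cuts (twist 1 (\<lambda>u. mor_lift f (sng u))) (\<lambda>u. htp_lift f g h (sng u)) w + cuts (\<lambda>u. htp_lift f g h (sng u)) (\<lambda>u. mor_lift g (sng u)) w"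
  by (simp add: htp_lift_def mor_lift_def coprod_der_of coprod_mor_of mor_of_nonempty letter_of_in)

lemma coprod_der_lift:
  fixes m :: "'a word \<Rightarrow> 'a::ab_group_add"
  shows "coprod (der_lift m (sng w :: 'a word \<Rightarrow>\<^sub>0 'r::comm_ring_1)) =
    cuts (twist (-1) sng) (\<lambda>u. der_lift m (sng u)) w + cuts (\<lambda>u. der_lift m (sng u)) sng w"
proof -
  have "coprod (sng u) = (cuts sng sng u :: _ \<Rightarrow>\<^sub>0 'r)" for u :: "'a word" by (simp add: coprod_sng cuts_def)
  then have "coprod (der_lift m (sng w :: 'a word \<Rightarrow>\<^sub>0 'r)) = cuts (twist (-1) (mor_of id_letter)) (\<lambda>u. der_lift m (sng u)) w + cuts (\<lambda>u. der_lift m (sng u)) sng w"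
    by (simp add: der_lift_def coprod_der_of letter_of_in id_letter_in sng_supp)
  also have "cuts (twist (-1) (mor_of id_letter)) (\<lambda>u. der_lift m (sng u)) w = (cuts (twist (-1) sng) (\<lambda>u. der_lift m (sng u)) w :: _ \<Rightarrow>\<^sub>0 'r)"
    by (rule cuts_cong) (auto simp: twist_def intro!: arg_cong[where f="ksign _"] mor_of_id_letter)
  finally show ?thesis .
qed

lemma corestr_convol:
  assumes s: "module s" and G: "\<And>w. G w \<in> letters" and H: "\<And>w. w \<noteq> [] \<Longrightarrow> H w \<in> supp {w. w \<noteq> []}"
  shows "ev s id_fam (convol G H w) = 0"
proof -
  have "convol G H w \<in> supp {w. length w \<noteq> 1}" unfolding convol_def
    by (rule free.subspace_sum[OF subspace_supp], rule conc_supp[OF letters_nonempty[OF G] H])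
      (auto simp: length_Suc_conv neq_Nil_conv)
  from hom_eq_supp[OF ev_hom[OF s] hom_0[OF free.module_axioms s] _ this] show ?thesis
    by (simp add: ev_sng[OF s])
qed

lemma corestr_letter_of: "module s \<Longrightarrow> w \<noteq> [] \<Longrightarrow> ev s id_fam (letter_of e f w) = f w"
  by (auto simp: letter_of_def ev_sng module_hom.zero[OF ev_hom])

lemma corestr_mor_lift:
  assumes W: "graded_module W" and x: "x \<in> tensor_elts V"
  shows "ev (scl W) id_fam (mor_lift f x) = ev (scl W) f x"
proof (rule hom_eq_supp[OF hom_comp[OF lin_lifts(1) ev_hom] ev_hom _ x[unfolded elts_supp]])
  show s: "module (scl W)" by (rule gm_module[OF W])
  fix w assume "w \<in> words V"
  then have w: "w \<noteq> []" by (rule words_nonempty)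
  then show "ev (scl W) id_fam (mor_lift f (sng w)) = ev (scl W) f (sng w)"
    by (simp add: mor_lift_def mor_of_rec[of _ w] module_hom.add[OF ev_hom[OF s]] corestr_letter_of[OF s] ev_sng[OF s] corestr_convol[OF s letter_of_in mor_of_nonempty[OF letter_of_in]])
qed (rule gm_module[OF W])

lemma corestr_htp_lift:
  assumes W: "graded_module W" and x: "x \<in> tensor_elts V"
  shows "ev (scl W) id_fam (htp_lift f g h x) = ev (scl W) h x"
proof (rule hom_eq_supp[OF hom_comp[OF lin_lifts(2) ev_hom] ev_hom _ x[unfolded elts_supp]])
  show s: "module (scl W)" by (rule gm_module[OF W])
  fix w assume "w \<in> words V"
  then have w: "w \<noteq> []" by (rule words_nonempty)
  then show "ev (scl W) id_fam (htp_lift f g h (sng w)) = ev (scl W) h (sng w)"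
    by (simp add: htp_lift_def der_of_rec[of _ _ _ _ w] module_hom.add[OF ev_hom[OF s]] corestr_letter_of[OF s] ev_sng[OF s]
       corestr_convol[OF s letter_of_in mor_of_nonempty[OF letter_of_in]] corestr_convol[OF s twist_letters[OF letter_of_in] der_of_nonempty[OF letter_of_in letter_of_in]])
qed (rule gm_module[OF W])

lemma corestr_der_lift:
  assumes W: "graded_module W" and x: "x \<in> tensor_elts W"
  shows "ev (scl W) id_fam (der_lift m x) = ev (scl W) m x"
proof (rule hom_eq_supp[OF hom_comp[OF lin_lifts(3) ev_hom] ev_hom _ x[unfolded elts_supp]])
  show s: "module (scl W)" by (rule gm_module[OF W])
  fix w assume "w \<in> words W"
  then have w: "w \<noteq> []" by (rule words_nonempty)
  then show "ev (scl W) id_fam (der_lift m (sng w)) = ev (scl W) m (sng w)"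
    by (simp add: der_lift_def der_of_rec[of _ _ _ _ w] module_hom.add[OF ev_hom[OF s]] corestr_letter_of[OF s] ev_sng[OF s]
       corestr_convol[OF s letter_of_in sng_supp] corestr_convol[OF s twist_letters[OF id_letter_in] der_of_nonempty[OF id_letter_in letter_of_in]])
qed (rule gm_module[OF W])


section \<open>Uniqueness of lifts\<close>

abbreviation on_word :: "(('a word \<Rightarrow>\<^sub>0 'r::comm_ring_1) \<Rightarrow> 'x) \<Rightarrow> 'a word \<Rightarrow> 'x" where
  "on_word \<Phi> \<equiv> \<lambda>w. \<Phi> (sng w)"

text \<open>
  As long as \<open>\<Phi>\<close> vanishes on shorter words, its values are primitive, hence
  letters. So \<open>\<Phi>\<close> keeps vanishing while its corestriction does, and at the first
  length where the corestriction is nonzero it equals its corestriction.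
\<close>

lemma leading_letter:
  assumes W: "graded_module W" and \<Phi>: "tensor_hom V W e \<Phi>"
    and step: "\<And>w. w \<in> words V \<Longrightarrow> length w \<le> N \<Longrightarrow>
      (\<And>u. u \<in> words V \<Longrightarrow> length u < length w \<Longrightarrow> \<Phi> (sng u) \<in> tensor_rel W) \<Longrightarrow>
      coprod (\<Phi> (sng w)) \<in> tensor_rel2 W"
    and van: "\<And>w. w \<in> words V \<Longrightarrow> length w < N \<Longrightarrow> ev (scl W) id_fam (\<Phi> (sng w)) = 0"
    and w: "w \<in> words V" "length w \<le> N"
  shows "\<Phi> (sng w) - sng [(deg w + e, ev (scl W) id_fam (\<Phi> (sng w)))] \<in> tensor_rel W"
  using w
proof (induction w rule: length_induct)
  case (1 w)
  have "\<Phi> (sng u) \<in> tensor_rel W" if u: "u \<in> words V" "length u < length w" for u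
  proof -
    have l: "length u < N" using u 1 by simp
    then have "length u \<le> N" by simp
    then have "\<Phi> (sng u) - sng [(deg u + e, ev (scl W) id_fam (\<Phi> (sng u)))] \<in> tensor_rel W"
      using 1(1) u by blast
    from free.subspace_add[OF subspace_rel this letter0_rel[OF W, of "deg u + e"]] van[OF u(1) l] show ?thesis by simp
  qed
  with 1 step have "coprod (\<Phi> (sng w)) \<in> tensor_rel2 W" by blast
  then show ?case
    by (rule primitive_rel[OF W tensor_homD(2)[OF \<Phi> sng_elts(1)[OF 1(2)]]])
qed

lemma vanishing:
  assumes W: "graded_module W" and \<Phi>: "tensor_hom V W e \<Phi>"
    and step: "\<And>w. w \<in> words V \<Longrightarrow> length w < N \<Longrightarrow>
      (\<And>u. u \<in> words V \<Longrightarrow> length u < length w \<Longrightarrow> \<Phi> (sng u) \<in> tensor_rel W) \<Longrightarrow>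
      coprod (\<Phi> (sng w)) \<in> tensor_rel2 W"
    and van: "\<And>w. w \<in> words V \<Longrightarrow> length w < N \<Longrightarrow> ev (scl W) id_fam (\<Phi> (sng w)) = 0"
    and w: "w \<in> words V" "length w < N"
  shows "\<Phi> (sng w) \<in> tensor_rel W"
proof -
  have "\<Phi> (sng w) - sng [(deg w + e, ev (scl W) id_fam (\<Phi> (sng w)))] \<in> tensor_rel W"
  proof (rule leading_letter[OF W \<Phi>, where N = "N - 1"])
    show "length w \<le> N - 1" using w by simp
  qed (use w step van in auto)
  from free.subspace_add[OF subspace_rel this letter0_rel[OF W, of "deg w + e"]] van[OF w] show ?thesis by simp
qed

lemma hom_elts_rel:
  assumes "lin \<Phi>" "\<And>w. w \<in> words V \<Longrightarrow> \<Phi> (sng w) \<in> tensor_rel W" "x \<in> tensor_elts V"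
  shows "\<Phi> x \<in> tensor_rel W"
  by (rule hom_supp[OF assms(1) subspace_rel assms(2) assms(3)[unfolded elts_supp]])

lemma twist_rel: "G w \<in> tensor_rel V \<Longrightarrow> twist e G w \<in> tensor_rel V"
  unfolding twist_def by (rule ksign_subspace[OF free.module_axioms subspace_rel])

lemma twist_elts: "G w \<in> tensor_elts V \<Longrightarrow> twist e G w \<in> tensor_elts V"
  unfolding twist_def elts_supp by (rule ksign_subspace[OF free.module_axioms subspace_supp])

lemma cuts_rel2:
  assumes w: "w \<in> words V"
  shows "(\<And>u. u \<in> words V \<Longrightarrow> length u < length w \<Longrightarrow> G u \<in> tensor_rel W) \<Longrightarrow>
      (\<And>u. u \<in> words V \<Longrightarrow> H u \<in> tensor_elts W) \<Longrightarrow> cuts G H w \<in> tensor_rel2 W"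
    "(\<And>u. u \<in> words V \<Longrightarrow> G u \<in> tensor_elts W) \<Longrightarrow>
      (\<And>u. u \<in> words V \<Longrightarrow> length u < length w \<Longrightarrow> H u \<in> tensor_rel W) \<Longrightarrow> cuts G H w \<in> tensor_rel2 W"
  unfolding cuts_def
  by (rule free.subspace_sum[OF subspace_rel2], rule tens_rel2(1); use w in \<open>auto simp: words_take words_drop\<close>)
    (rule free.subspace_sum[OF subspace_rel2], rule tens_rel2(2); use w in \<open>auto simp: words_take words_drop\<close>)

lemma tensor_hom_diff:
  assumes "tensor_hom V W e \<Phi>" "tensor_hom V W e \<Psi>"
  shows "tensor_hom V W e (\<lambda>x. \<Phi> x - \<Psi> x)"
  unfolding tensor_hom_def
  using hom_diff[OF tensor_homD(1)[OF assms(1)] tensor_homD(1)[OF assms(2)]]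
    free.subspace_diff[OF subspace_rel[of W] tensor_homD(3)[OF assms(1)] tensor_homD(3)[OF assms(2)]]
    free.subspace_diff[OF subspace_supp tensor_homD(2)[OF assms(1), unfolded elts_supp] tensor_homD(2)[OF assms(2), unfolded elts_supp]]
  by (auto simp: elts_supp)

lemma tensor_hom_comp:
  assumes \<Phi>: "tensor_hom U V d \<Phi>" and \<Psi>: "tensor_hom V W e \<Psi>" and c: "c = d + e"
  shows "tensor_hom U W c (\<lambda>x. \<Psi> (\<Phi> x))"
  unfolding tensor_hom_def
proof (intro conjI allI image_subsetI)
  show "lin (\<lambda>x. \<Psi> (\<Phi> x))" by (rule hom_comp[OF tensor_homD(1)[OF \<Phi>] tensor_homD(1)[OF \<Psi>]])
  show "\<Psi> (\<Phi> x) \<in> tensor_elts_deg W (k + c)" if "x \<in> tensor_elts_deg U k" for k x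
    using tensor_homD(2)[OF \<Psi> tensor_homD(2)[OF \<Phi> that]] c by (simp add: add.assoc)
  show "\<Psi> (\<Phi> x) \<in> tensor_rel W" if "x \<in> tensor_rel U" for x
    by (rule tensor_homD(3)[OF \<Psi> tensor_homD(3)[OF \<Phi> that]])
qed

lemma tensor_hom_id: "tensor_hom V V 0 (\<lambda>x. x)"
  by (auto simp: tensor_hom_def lin_id)

text \<open>
  The difference \<open>E\<close> of two morphisms satisfies \<open>\<Delta>E = (E \<otimes> \<Phi>
  + \<Psi> \<otimes> E)\<Delta>\<close>, so its coproduct vanishes on a word as soon as
  \<open>E\<close> vanishes on shorter words.
\<close>

lemma morphism_unique:
  assumes W: "graded_module W" and \<Phi>: "tensor_hom V W 0 \<Phi>" and \<Psi>: "tensor_hom V W 0 \<Psi>"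
    and cop\<Phi>: "\<And>w. w \<in> words V \<Longrightarrow> coprod (\<Phi> (sng w)) - cuts (on_word \<Phi>) (on_word \<Phi>) w \<in> tensor_rel2 W"
    and cop\<Psi>: "\<And>w. w \<in> words V \<Longrightarrow> coprod (\<Psi> (sng w)) - cuts (on_word \<Psi>) (on_word \<Psi>) w \<in> tensor_rel2 W"
    and eq: "\<And>w. w \<in> words V \<Longrightarrow> ev (scl W) id_fam (\<Phi> (sng w)) = ev (scl W) id_fam (\<Psi> (sng w))"
    and x: "x \<in> tensor_elts V"
  shows "\<Phi> x - \<Psi> x \<in> tensor_rel W"
proof (rule hom_elts_rel[OF _ _ x])
  note E = tensor_hom_diff[OF \<Phi> \<Psi>]
  show "lin (\<lambda>x. \<Phi> x - \<Psi> x)" by (rule tensor_homD(1)[OF E])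
  fix w assume w: "w \<in> words V"
  show "\<Phi> (sng w) - \<Psi> (sng w) \<in> tensor_rel W"
  proof (rule vanishing[OF W E, where N="Suc (length w)"])
    fix w assume w: "w \<in> words V" and
      IH: "\<And>u. u \<in> words V \<Longrightarrow> length u < length w \<Longrightarrow> \<Phi> (sng u) - \<Psi> (sng u) \<in> tensor_rel W"
    have "coprod (\<Phi> (sng w)) - cuts (on_word \<Phi>) (on_word \<Phi>) w - (coprod (\<Psi> (sng w)) - cuts (on_word \<Psi>) (on_word \<Psi>) w)
      + cuts (\<lambda>w. \<Phi> (sng w) - \<Psi> (sng w)) (on_word \<Phi>) w + cuts (on_word \<Psi>) (\<lambda>w. \<Phi> (sng w) - \<Psi> (sng w)) w \<in> tensor_rel2 W"
      by (intro free.subspace_add[OF subspace_rel2] free.subspace_diff[OF subspace_rel2] cop\<Phi> cop\<Psi> w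
          cuts_rel2(1)[OF w IH] cuts_rel2(2)[OF w _ IH] tensor_hom_elts[OF \<Phi>] tensor_hom_elts[OF \<Psi>] sng_elts)
    then show "coprod (\<Phi> (sng w) - \<Psi> (sng w)) \<in> tensor_rel2 W"
      by (simp add: cuts_diff module_hom.diff[OF lin_coprod])
  qed (use w in \<open>auto simp: module_hom.diff[OF ev_hom[OF gm_module[OF W]]] eq\<close>)
qed

text \<open>
  Coderivations and homotopies in one notion: \<open>\<Delta>\<eta> = (\<phi> \<otimes> \<eta> +
  \<eta> \<otimes> \<psi>)\<Delta>\<close> modulo relations, checked on words.
\<close>

definition coder_along :: "int \<Rightarrow> ('r::comm_ring_1, 'a::ab_group_add) dgmod \<Rightarrow> ('r, 'b::ab_group_add) dgmod \<Rightarrow>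
   (('a word \<Rightarrow>\<^sub>0 'r) \<Rightarrow> ('b word \<Rightarrow>\<^sub>0 'r)) \<Rightarrow> (('a word \<Rightarrow>\<^sub>0 'r) \<Rightarrow> ('b word \<Rightarrow>\<^sub>0 'r)) \<Rightarrow>
   (('a word \<Rightarrow>\<^sub>0 'r) \<Rightarrow> ('b word \<Rightarrow>\<^sub>0 'r)) \<Rightarrow> bool" where
  "coder_along e V W \<phi> \<psi> \<eta> \<longleftrightarrow> tensor_hom V W e \<eta> \<and>
     (\<forall>w\<in>words V. coprod (\<eta> (sng w)) - (cuts (twist e (on_word \<phi>)) (on_word \<eta>) w + cuts (on_word \<eta>) (on_word \<psi>) w) \<in> tensor_rel2 W)"

text \<open>
  The morphisms \<open>\<phi>\<close>, \<open>\<psi>\<close> are allowed to differ by relations on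
  the two sides, because homotopies are taken along chosen lifts in one case and along explicit
  lifts in the other.
\<close>

lemma coder_along_unique:
  assumes W: "graded_module W" and \<Phi>: "coder_along e V W \<phi> \<psi> \<Phi>" and \<Psi>: "coder_along e V W \<phi>' \<psi>' \<Psi>"
    and phi: "tensor_hom V W 0 \<phi>'" "\<And>w. w \<in> words V \<Longrightarrow> \<phi> (sng w) - \<phi>' (sng w) \<in> tensor_rel W"
    and psi: "tensor_hom V W 0 \<psi>" "\<And>w. w \<in> words V \<Longrightarrow> \<psi> (sng w) - \<psi>' (sng w) \<in> tensor_rel W"
    and eq: "\<And>w. w \<in> words V \<Longrightarrow> ev (scl W) id_fam (\<Phi> (sng w)) = ev (scl W) id_fam (\<Psi> (sng w))"
    and x: "x \<in> tensor_elts V"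
  shows "\<Phi> x - \<Psi> x \<in> tensor_rel W"
proof (rule hom_elts_rel[OF _ _ x])
  note h\<Phi> = conjunct1[OF \<Phi>[unfolded coder_along_def]] and h\<Psi> = conjunct1[OF \<Psi>[unfolded coder_along_def]]
  note cop\<Phi> = bspec[OF conjunct2[OF \<Phi>[unfolded coder_along_def]]] and cop\<Psi> = bspec[OF conjunct2[OF \<Psi>[unfolded coder_along_def]]]
  note E = tensor_hom_diff[OF h\<Phi> h\<Psi>]
  show "lin (\<lambda>x. \<Phi> x - \<Psi> x)" by (rule tensor_homD(1)[OF E])
  fix w assume w: "w \<in> words V"
  show "\<Phi> (sng w) - \<Psi> (sng w) \<in> tensor_rel W"
  proof (rule vanishing[OF W E, where N="Suc (length w)"])
    fix w assume w: "w \<in> words V" and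
      IH: "\<And>u. u \<in> words V \<Longrightarrow> length u < length w \<Longrightarrow> \<Phi> (sng u) - \<Psi> (sng u) \<in> tensor_rel W"
    let ?t = "twist e (on_word \<phi>)" and ?t' = "twist e (on_word \<phi>')"
    have t: "?t w - ?t' w = twist e (\<lambda>w. \<phi> (sng w) - \<phi>' (sng w)) w" for w
      by (simp add: twist_def ksign_simps)
    have "coprod (\<Phi> (sng w)) - (cuts ?t (on_word \<Phi>) w + cuts (on_word \<Phi>) (on_word \<psi>) w) -
      (coprod (\<Psi> (sng w)) - (cuts ?t' (on_word \<Psi>) w + cuts (on_word \<Psi>) (on_word \<psi>') w))
      + (cuts (\<lambda>w. ?t w - ?t' w) (on_word \<Phi>) w + cuts ?t' (\<lambda>w. \<Phi> (sng w) - \<Psi> (sng w)) w)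
      + (cuts (\<lambda>w. \<Phi> (sng w) - \<Psi> (sng w)) (on_word \<psi>) w + cuts (on_word \<Psi>) (\<lambda>w. \<psi> (sng w) - \<psi>' (sng w)) w) \<in> tensor_rel2 W"
      unfolding t
      by (intro free.subspace_add[OF subspace_rel2] free.subspace_diff[OF subspace_rel2] cop\<Phi> cop\<Psi> w
          cuts_rel2(1)[OF w twist_rel[OF phi(2)]] cuts_rel2(2)[OF w _ psi(2)] twist_elts
          cuts_rel2(1)[OF w IH] cuts_rel2(2)[OF w _ IH] tensor_hom_elts[OF phi(1)] tensor_hom_elts[OF psi(1)]
          tensor_hom_elts[OF h\<Phi>] tensor_hom_elts[OF h\<Psi>] sng_elts)
    then show "coprod (\<Phi> (sng w) - \<Psi> (sng w)) \<in> tensor_rel2 W"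
      by (simp add: cuts_diff module_hom.diff[OF lin_coprod])
  qed (use w in \<open>auto simp: module_hom.diff[OF ev_hom[OF gm_module[OF W]]] eq\<close>)
qed

section \<open>Coproducts of the defect maps\<close>

lemma tens_map_cuts:
  assumes "lin \<Phi>" "lin \<Psi>" and w: "w \<in> words V" and G: "\<And>u. u \<in> words V \<Longrightarrow> G u \<in> tensor_elts_deg W (deg u + d)"
  shows "tens_map e \<Phi> \<Psi> (cuts G H w) = cuts (\<lambda>u. ksign (e * (deg u + d)) (\<Phi> (G u))) (\<lambda>v. \<Psi> (H v)) w"
  unfolding cuts_def module_hom.sum[OF lin_tens_map]
proof (rule sum.cong[OF refl])
  fix i assume "i \<in> {1..<length w}"
  then have "G (take i w) \<in> tensor_elts_deg W (deg (take i w) + d)" using w by (auto intro!: G words_take)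
  then have "G (take i w) \<in> supp {v. deg v = deg (take i w) + d}" unfolding elts_supp by (rule supp_mono[rotated]) auto
  from tens_map_tens[OF assms(1,2) this]
  show "tens_map e \<Phi> \<Psi> (tens (G (take i w)) (H (drop i w))) =
    tens (ksign (e * (deg (take i w) + d)) (\<Phi> (G (take i w)))) (\<Psi> (H (drop i w)))"
    by (simp add: tens_simps)
qed

lemma coprod_mor_lift_elt: "coprod (mor_lift f x) = tens_map 0 (mor_lift f) (mor_lift f) (coprod x)"
  by (rule fun_cong[OF hom_eqI[OF hom_comp[OF lin_lifts(1) lin_coprod] hom_comp[OF lin_coprod lin_tens_map]]])
    (simp add: coprod_mor_lift tens_map_coprod ksign_simps)

lemma coprod_htp_lift_elt: "coprod (htp_lift f g h x) =
    tens_map 1 (mor_lift f) (htp_lift f g h) (coprod x) + tens_map 0 (htp_lift f g h) (mor_lift g) (coprod x)"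
  by (rule fun_cong[OF hom_eqI[OF hom_comp[OF lin_lifts(2) lin_coprod] hom_add[OF hom_comp[OF lin_coprod lin_tens_map] hom_comp[OF lin_coprod lin_tens_map]]]])
    (simp add: coprod_htp_lift tens_map_coprod ksign_simps twist_def[abs_def])

lemma coprod_der_lift_elt: "coprod (der_lift m x) =
    tens_map 0 (der_lift m) id (coprod x) + tens_map (-1) id (der_lift m) (coprod x)"
  by (rule fun_cong[OF hom_eqI[OF hom_comp[OF lin_lifts(3) lin_coprod] hom_add[OF hom_comp[OF lin_coprod lin_tens_map] hom_comp[OF lin_coprod lin_tens_map]]]])
    (simp add: coprod_der_lift tens_map_coprod ksign_simps twist_def[abs_def])

lemma cuts_neg: "cuts (\<lambda>w. - G w) H w = - cuts G H w" "cuts G (\<lambda>w. - H w) w = - cuts G H w"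
  by (simp_all add: cuts_def tens_simps sum_negf)

text \<open>The failure of a morphism of coalgebras to commute with the differentials.\<close>

definition mor_defect_map where
  "mor_defect_map m m' f x = der_lift m' (mor_lift f x) - mor_lift f (der_lift m x)"

text \<open>The commutator of a morphism with coderivations is a coderivation along the morphism.\<close>

lemma coprod_mor_defect_map:
  fixes V :: "('r::comm_ring_1, 'a::ab_group_add) dgmod" and W :: "('r, 'b::ab_group_add) dgmod"
  assumes V: "graded_module V" and W: "graded_module W" and m: "mlin V V (-1) m" and m': "mlin W W (-1) m'"
    and f: "mlin V W 0 f" and w: "w \<in> words V"
  shows "coprod (mor_defect_map m m' f (sng w :: 'a word \<Rightarrow>\<^sub>0 'r)) =
    cuts (on_word (mor_defect_map m m' f)) (on_word (mor_lift f)) w + cuts (twist (-1) (on_word (mor_lift f))) (on_word (mor_defect_map m m' f)) w"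
proof -
  let ?F = "mor_lift f :: ('a word \<Rightarrow>\<^sub>0 'r) \<Rightarrow> ('b word \<Rightarrow>\<^sub>0 'r)"
  note hF = tensor_hom_mor_lift[OF V W f] and hm = tensor_hom_der_lift[OF V m]
  note F = tensor_homD(2)[OF hF sng_elts(1)] and D = tensor_homD(2)[OF hm sng_elts(1)]
  have S: "ksign (- deg u) (sng u) \<in> tensor_elts_deg V (deg u + 0)" if "u \<in> words V" for u
    using sng_elts(1)[OF that] unfolding elts_supp by (auto intro!: ksign_subspace[OF free.module_axioms subspace_supp])
  have "coprod (der_lift m' (?F (sng w))) = cuts (\<lambda>u. der_lift m' (?F (sng u))) (on_word ?F) w
      + cuts (twist (-1) (on_word ?F)) (\<lambda>u. der_lift m' (?F (sng u))) w"
    by (simp add: coprod_der_lift_elt coprod_mor_lift tens_map_cuts[OF lin_lifts(3) lin_id(2) w F]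
        tens_map_cuts[OF lin_id(2) lin_lifts(3) w F] ksign_simps twist_def[abs_def])
  moreover have "coprod (?F (der_lift m (sng w))) = cuts (twist (-1) (on_word ?F)) (\<lambda>u. ?F (der_lift m (sng u))) w
     + cuts (\<lambda>u. ?F (der_lift m (sng u))) (on_word ?F) w"
    by (simp add: coprod_mor_lift_elt coprod_der_lift module_hom.add[OF lin_tens_map] tens_map_cuts[OF lin_lifts(1) lin_lifts(1) w D]
       tens_map_cuts[OF lin_lifts(1) lin_lifts(1) w S] ksign_simps twist_def[abs_def] ksign_hom[OF lin_lifts(1)])
  ultimately show ?thesis
    by (simp add: mor_defect_map_def module_hom.diff[OF lin_coprod] cuts_diff)
qed

text \<open>
  The failure of the homotopy equation \<open>\<psi> - \<phi> = \<delta>\<eta> +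
  \<eta>\<delta>\<close>.
\<close>

definition htp_defect_map where
  "htp_defect_map m m' f g h x = mor_lift g x - mor_lift f x - der_lift m' (htp_lift f g h x) - htp_lift f g h (der_lift m x)"

text \<open>
  If \<open>\<phi>\<close> and \<open>\<psi>\<close> commute with the differentials, the failure of
  the homotopy equation is a coderivation along \<open>\<phi>\<close>, \<open>\<psi>\<close>. In
  general two correction terms with their defects appear; on a word they only involve the defects on
  shorter words.
\<close>

lemma coprod_htp_defect_map:
  fixes V :: "('r::comm_ring_1, 'a::ab_group_add) dgmod" and W :: "('r, 'b::ab_group_add) dgmod"
  assumes V: "graded_module V" and W: "graded_module W" and m: "mlin V V (-1) m" and m': "mlin W W (-1) m'"
    and f: "mlin V W 0 f" and g: "mlin V W 0 g" and h: "mlin V W 1 h" and w: "w \<in> words V"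
  shows "coprod (htp_defect_map m m' f g h (sng w :: 'a word \<Rightarrow>\<^sub>0 'r)) =
    cuts (on_word (mor_lift f)) (on_word (htp_defect_map m m' f g h)) w + cuts (on_word (htp_defect_map m m' f g h)) (on_word (mor_lift g)) w
    - cuts (twist 1 (on_word (mor_defect_map m m' f))) (on_word (htp_lift f g h)) w + cuts (twist 1 (on_word (htp_lift f g h))) (on_word (mor_defect_map m m' g)) w"
proof -
  let ?F = "mor_lift f :: ('a word \<Rightarrow>\<^sub>0 'r) \<Rightarrow> ('b word \<Rightarrow>\<^sub>0 'r)" and ?G = "mor_lift g :: ('a word \<Rightarrow>\<^sub>0 'r) \<Rightarrow> ('b word \<Rightarrow>\<^sub>0 'r)" and ?H = "htp_lift f g h :: ('a word \<Rightarrow>\<^sub>0 'r) \<Rightarrow> ('b word \<Rightarrow>\<^sub>0 'r)"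
  note hF = tensor_hom_mor_lift[OF V W f] and hm = tensor_hom_der_lift[OF V m] and hG = tensor_hom_mor_lift[OF V W g]
  note hH = tensor_hom_htp_lift[OF V W f g h]
  note F = tensor_homD(2)[OF hF sng_elts(1)] and D = tensor_homD(2)[OF hm sng_elts(1)]
   and H = tensor_homD(2)[OF hH sng_elts(1)]
  have S: "ksign (- deg u) (sng u) \<in> tensor_elts_deg V (deg u + 0)" if "u \<in> words V" for u
    using sng_elts(1)[OF that] unfolding elts_supp by (auto intro!: ksign_subspace[OF free.module_axioms subspace_supp])
  have TF: "ksign (deg u) (?F (sng u)) \<in> tensor_elts_deg W (deg u + 0)" if "u \<in> words V" for u
    using F[OF that] unfolding elts_supp by (auto intro!: ksign_subspace[OF free.module_axioms subspace_supp])
  have k1: "ksign (- n) (ksign n x) = x" "ksign n (ksign (- n) x) = x" "ksign n (ksign n x) = x" for n and x :: "'x::ab_group_add"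
    by (auto simp: ksign_def)
  have k2: "ksign (- n - 1) x = - ksign n x" "ksign (n - 1) x = - ksign n x" "ksign (- n) x = ksign n x" for n and x :: "'x::ab_group_add"
    by (auto simp: ksign_def)
  note S2 = S[unfolded k2(3)]
  have "coprod (der_lift m' (?H (sng w))) = cuts (twist 1 (\<lambda>u. der_lift m' (?F (sng u)))) (on_word ?H) w + cuts (\<lambda>u. der_lift m' (?H (sng u))) (on_word ?G) w
      + cuts (on_word ?F) (\<lambda>u. der_lift m' (?H (sng u))) w - cuts (twist 1 (on_word ?H)) (\<lambda>u. der_lift m' (?G (sng u))) w"
    by (simp add: coprod_der_lift_elt coprod_htp_lift module_hom.add[OF lin_tens_map]
        tens_map_cuts[OF lin_lifts(3) lin_id(2) w TF] tens_map_cuts[OF lin_lifts(3) lin_id(2) w H]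
        tens_map_cuts[OF lin_id(2) lin_lifts(3) w TF] tens_map_cuts[OF lin_id(2) lin_lifts(3) w H]
        ksign_hom[OF lin_lifts(3)] twist_def[abs_def] k1 k2 cuts_neg ksign_simps(1))
  moreover have "coprod (?H (der_lift m (sng w))) = cuts (on_word ?F) (\<lambda>u. ?H (der_lift m (sng u))) w
     - cuts (twist 1 (\<lambda>u. ?F (der_lift m (sng u)))) (on_word ?H) w + cuts (twist 1 (on_word ?H)) (\<lambda>u. ?G (der_lift m (sng u))) w
     + cuts (\<lambda>u. ?H (der_lift m (sng u))) (on_word ?G) w"
    by (simp add: coprod_htp_lift_elt coprod_der_lift module_hom.add[OF lin_tens_map]
       tens_map_cuts[OF lin_lifts(1) lin_lifts(2) w D] tens_map_cuts[OF lin_lifts(1) lin_lifts(2) w S2]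
       tens_map_cuts[OF lin_lifts(2) lin_lifts(1) w D] tens_map_cuts[OF lin_lifts(2) lin_lifts(1) w S2]
       ksign_hom[OF lin_lifts(1)] ksign_hom[OF lin_lifts(2)] twist_def[abs_def] k1 k2 cuts_neg ksign_simps(1))
  moreover have "twist 1 (\<lambda>u. mor_defect_map m m' f (sng u :: 'a word \<Rightarrow>\<^sub>0 'r)) = (\<lambda>u. twist 1 (\<lambda>u. der_lift m' (?F (sng u))) u - twist 1 (\<lambda>u. ?F (der_lift m (sng u))) u)"
    by (simp add: twist_def[abs_def] mor_defect_map_def ksign_simps)
  ultimately show ?thesis
    by (simp add: htp_defect_map_def mor_defect_map_def module_hom.diff[OF lin_coprod] cuts_diff coprod_mor_lift)
qed


section \<open>Families composed with tensor maps\<close>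

lemma mlin_cong:
  assumes V: "graded_module V" and W: "graded_module W" and "mlin V W e f" "\<And>w. w \<in> words V \<Longrightarrow> f w = g w"
  shows "mlin V W e g"
  using assms(3) words_comb[OF V] unfolding mlin_iff[OF V W] by (simp add: assms(4)[symmetric])

lemma hom_relator:
  "module_hom fscale s H \<Longrightarrow> H (relator V u n a c b v) =
    H (sng (u @ (n, a + scl V c b) # v)) - H (sng (u @ (n, a) # v)) - s c (H (sng (u @ (n, b) # v)))"
  by (simp only: relator_def module_hom.diff module_hom.scale)

text \<open>
  For \<open>\<Phi>\<close> a morphism this is the family of components of the composite of
  \<open>f\<close> with \<open>\<Phi>\<close>; for other \<open>\<Phi>\<close> it describes the
  action of \<open>\<Phi>\<close> on families.
\<close>

definition precomp :: "('r::comm_ring_1, 'c::ab_group_add) dgmod \<Rightarrow> ('b word \<Rightarrow> 'c) \<Rightarrow> (('a word \<Rightarrow>\<^sub>0 'r) \<Rightarrow> ('b word \<Rightarrow>\<^sub>0 'r)) \<Rightarrow> 'a word \<Rightarrow> 'c" where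
  "precomp W f \<Phi> w = ev (scl W) f (\<Phi> (sng w))"

lemma mlin_precomp:
  assumes U: "graded_module U" and V: "graded_module V" and W: "graded_module W"
    and f: "mlin V W e f" and \<Phi>: "tensor_hom U V d \<Phi>" and k: "k = d + e"
  shows "mlin U W k (precomp W f \<Phi>)"
  unfolding mlin_iff[OF U W]
proof (intro conjI ballI allI impI)
  fix w assume "w \<in> words U"
  from ev_mlin_in[OF W f tensor_homD(2)[OF \<Phi> sng_elts(1)[OF this]]]
  show "precomp W f \<Phi> w \<in> part W (deg w + k)" by (simp add: precomp_def k add.assoc)
next
  fix u n a c b v assume "u @ (n, a) # v \<in> words U" "b \<in> part U n"
  from ev_mlin_rel[OF V W f tensor_homD(3)[OF \<Phi> relator_rel[OF U this]]]
  show "precomp W f \<Phi> (u @ (n, a + scl U c b) # v) = precomp W f \<Phi> (u @ (n, a) # v) + scl W c (precomp W f \<Phi> (u @ (n, b) # v))"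
    unfolding hom_relator[OF hom_comp[OF tensor_homD(1)[OF \<Phi>] ev_hom[OF gm_module[OF W]]]] precomp_def
    by (simp only: diff_diff_add right_minus_eq)
qed

lemma ev_precomp:
  assumes "graded_module W" "lin \<Phi>"
  shows "ev (scl W) (precomp W f \<Phi>) x = ev (scl W) f (\<Phi> x)"
  by (rule fun_cong[OF hom_eqI[OF ev_hom hom_comp[OF assms(2) ev_hom]]])
    (simp_all add: gm_module[OF assms(1)] ev_sng[OF gm_module[OF assms(1)]] precomp_def)

lemma mlin_id_fam:
  assumes V: "graded_module V"
  shows "mlin V V 0 id_fam"
  unfolding mlin_iff[OF V V]
proof (intro conjI ballI allI impI)
  fix w assume "w \<in> words V"
  then show "id_fam w \<in> part V (deg w + 0)"
    using module.subspace_0[OF gm_module[OF V] gm_part[OF V]]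
    by (cases "length w = 1") (auto simp: length_Suc_conv words_Cons)
next
  fix u n a c b v
  show "id_fam (u @ (n, a + scl V c b) # v) = id_fam (u @ (n, a) # v) + scl V c (id_fam (u @ (n, b) # v))"
    by (cases "u = [] \<and> v = []") (auto simp: module.scale_zero_right[OF gm_module[OF V]])
qed

lemma ev_diff_fam: "module s \<Longrightarrow> ev s (\<lambda>w. f w - g w) x = ev s f x - ev s g x"
  by (simp add: ev_def module.scale_right_diff_distrib sum_subtractf)

lemma ev_add_fam: "module s \<Longrightarrow> ev s (\<lambda>w. f w + g w) x = ev s f x + ev s g x"
  by (simp add: ev_def module.scale_right_distrib sum.distrib)

lemma ev_neg_fam: "module s \<Longrightarrow> ev s (\<lambda>w. - f w) x = - ev s f x"
  by (simp add: ev_def module.scale_minus_right sum_negf)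

lemma ev_cong: "x \<in> supp S \<Longrightarrow> (\<And>w. w \<in> S \<Longrightarrow> f w = g w) \<Longrightarrow> ev s f x = ev s g x"
  unfolding ev_def by (rule sum.cong) (auto simp: supp_def)

lemma ev_zero: "module s \<Longrightarrow> x \<in> supp S \<Longrightarrow> (\<And>w. w \<in> S \<Longrightarrow> f w = 0) \<Longrightarrow> ev s f x = 0"
  unfolding ev_def by (rule sum.neutral) (auto simp: supp_def module.scale_zero_right)

lemma mlin_add: "graded_module V \<Longrightarrow> graded_module W \<Longrightarrow> mlin V W e f \<Longrightarrow> mlin V W e g \<Longrightarrow> mlin V W e (\<lambda>w. f w + g w)"
  unfolding mlin_iff
  by (auto simp: module.scale_right_distrib[OF gm_module] intro!: module.subspace_add[OF gm_module gm_part])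

lemma mlin_neg: "graded_module V \<Longrightarrow> graded_module W \<Longrightarrow> mlin V W e f \<Longrightarrow> mlin V W e (\<lambda>w. - f w)"
  unfolding mlin_iff
  by (auto simp: module.scale_minus_right[OF gm_module] intro!: module.subspace_neg[OF gm_module gm_part])

lemma mlin_diff: "graded_module V \<Longrightarrow> graded_module W \<Longrightarrow> mlin V W e f \<Longrightarrow> mlin V W e g \<Longrightarrow> mlin V W e (\<lambda>w. f w - g w)"
  unfolding mlin_iff
  by (auto simp: module.scale_right_diff_distrib[OF gm_module] intro!: module.subspace_diff[OF gm_module gm_part])

lemma mlin_if: "graded_module V \<Longrightarrow> graded_module W \<Longrightarrow> mlin V W e f \<Longrightarrow> mlin V W e g \<Longrightarrow>
   mlin V W e (\<lambda>w. if P (length w) then f w else g w)"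
  unfolding mlin_iff by auto

lemma mlin_zero: "graded_module V \<Longrightarrow> graded_module W \<Longrightarrow> mlin V W e (\<lambda>_. 0)"
  unfolding mlin_iff by (auto simp: module.scale_zero_right[OF gm_module] module.subspace_0[OF gm_module gm_part])

section \<open>Dependence on word length\<close>

lemma mor_of_local:
  assumes "\<And>u. length u \<le> length w \<Longrightarrow> c u = c' u"
  shows "mor_of c w = mor_of c' w"
  using assms
proof (induction w rule: length_induct)
  case (1 w)
  have "convol c (mor_of c) w = convol c' (mor_of c') w"
    by (rule convol_cong) (use 1 in auto)
  then show ?case using 1(2)[of w] by (simp add: mor_of_rec[of _ w])
qed

text \<open>
  Only the decomposition of \<open>w\<close> into a single block involves the value of the
  corestriction on \<open>w\<close>.
\<close>

lemma mor_of_diff: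
  assumes "\<And>u. length u < length w \<Longrightarrow> c u = c' u"
  shows "mor_of c w - mor_of c' w = c w - c' w"
proof -
  have "convol c (mor_of c) w = convol c' (mor_of c') w"
    by (rule convol_cong) (use assms in \<open>auto intro!: mor_of_local\<close>)
  then show ?thesis by (simp add: mor_of_rec[of _ w])
qed

lemma der_of_local:
  assumes "\<And>u. length u < length w \<Longrightarrow> c u = c' u" "\<And>u. length u < length w \<Longrightarrow> P u = P' u"
    "\<And>u. length u \<le> length w \<Longrightarrow> d u = d' u"
  shows "der_of e c P d w = der_of e c' P' d' w"
  using assms
proof (induction w rule: length_induct)
  case (1 w)
  have "convol (twist e c) (der_of e c P d) w = convol (twist e c') (der_of e c' P' d') w"
    by (rule convol_cong) (use 1 in \<open>auto simp: twist_def\<close>)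
  moreover have "convol d P w = convol d' P' w"
    by (rule convol_cong) (use 1 in auto)
  ultimately show ?case using 1(4)[of w] by (simp add: der_of_rec[of _ _ _ _ w])
qed

lemma der_of_diff:
  assumes "\<And>u. length u < length w \<Longrightarrow> c u = c' u" "\<And>u. length u < length w \<Longrightarrow> P u = P' u"
    "\<And>u. length u < length w \<Longrightarrow> d u = d' u"
  shows "der_of e c P d w - der_of e c' P' d' w = d w - d' w"
proof -
  have "convol (twist e c) (der_of e c P d) w = convol (twist e c') (der_of e c' P' d') w"
    by (rule convol_cong) (use assms in \<open>auto simp: twist_def intro!: der_of_local\<close>)
  moreover have "convol d P w = convol d' P' w"
    by (rule convol_cong) (use assms in auto)
  ultimately show ?thesis by (simp add: der_of_rec[of _ _ _ _ w])
qed

abbreviation maxlen :: "nat \<Rightarrow> 'a list set" where "maxlen n \<equiv> {w. length w \<le> n}"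

lemma convol_upto:
  assumes "\<And>u. G u \<in> letters" "\<And>u. length u < length w \<Longrightarrow> H u \<in> supp (maxlen (length u))"
  shows "convol G H w \<in> supp (maxlen (length w))"
  unfolding convol_def
proof (rule free.subspace_sum[OF subspace_supp])
  fix i assume "i \<in> {1..<length w}"
  then show "conc (G (take i w)) (H (drop i w)) \<in> supp (maxlen (length w))"
    by (intro conc_supp[OF assms(1)[unfolded letters_def] assms(2)]) auto
qed

lemma letters_upto: "x \<in> letters \<Longrightarrow> 1 \<le> n \<Longrightarrow> x \<in> supp (maxlen n)"
  unfolding letters_def by (erule supp_mono[rotated]) auto

lemma mor_of_upto:
  assumes "\<And>u. c u \<in> letters" "c [] = 0"
  shows "mor_of c w \<in> supp (maxlen (length w))"
proof (induction w rule: length_induct)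
  case (1 w)
  have "c w \<in> supp (maxlen (length w))"
    using assms letters_upto[OF assms(1)[of w]] by (cases w) (auto simp: free.subspace_0[OF subspace_supp])
  moreover have "convol c (mor_of c) w \<in> supp (maxlen (length w))"
    by (rule convol_upto) (use 1 assms in auto)
  ultimately show ?case by (subst mor_of_rec) (rule free.subspace_add[OF subspace_supp])
qed

lemma der_of_upto:
  assumes "\<And>u. c u \<in> letters" "\<And>u. d u \<in> letters" "d [] = 0" "\<And>u. P u \<in> supp (maxlen (length u))"
  shows "der_of e c P d w \<in> supp (maxlen (length w))"
proof (induction w rule: length_induct)
  case (1 w)
  have "d w \<in> supp (maxlen (length w))"
    using assms letters_upto[OF assms(2)[of w]] by (cases w) (auto simp: free.subspace_0[OF subspace_supp])
  moreover have "convol d P w \<in> supp (maxlen (length w))"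
    by (rule convol_upto) (use assms in auto)
  moreover have "convol (twist e c) (der_of e c P d) w \<in> supp (maxlen (length w))"
    by (rule convol_upto) (use 1 in \<open>auto intro!: twist_letters assms\<close>)
  ultimately show ?case by (subst der_of_rec) (intro free.subspace_add[OF subspace_supp])
qed

text \<open>The part of a family in arity one.\<close>

definition linpart :: "('a word \<Rightarrow> 'x::zero) \<Rightarrow> 'a word \<Rightarrow> 'x" where
  "linpart f w = (if length w = 1 then f w else 0)"

text \<open>A block decomposition that preserves the length has only blocks of length one.\<close>

lemma convol_trunc:
  assumes G: "\<And>u. G u \<in> letters" and H: "\<And>u. length u < length w \<Longrightarrow> H u \<in> supp (maxlen (length u))"
    and H': "\<And>u. length u < length w \<Longrightarrow> H u - H' u \<in> supp {v. length v < length u}"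
  shows "convol G H w - convol (linpart G) H' w \<in> supp {v. length v < length w}"
  unfolding convol_def sum_subtractf[symmetric]
proof (rule free.subspace_sum[OF subspace_supp])
  fix i assume i: "i \<in> {1..<length w}"
  show "conc (G (take i w)) (H (drop i w)) - conc (linpart G (take i w)) (H' (drop i w)) \<in> supp {v. length v < length w}"
  proof (cases "i = 1")
    case True
    then have "conc (G (take i w)) (H (drop i w)) - conc (linpart G (take i w)) (H' (drop i w)) =
       conc (G (take i w)) (H (drop i w) - H' (drop i w))"
      using i by (simp add: linpart_def conc_simps min_def)
    also have "\<dots> \<in> supp {v. length v < length w}"
      by (rule conc_supp[OF G[unfolded letters_def] H']) (use i in auto)
    finally show ?thesis .
  next
    case False
    then have "conc (G (take i w)) (H (drop i w)) - conc (linpart G (take i w)) (H' (drop i w)) =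
       conc (G (take i w)) (H (drop i w))"
      using i by (simp add: linpart_def conc_simps min_def)
    also have "\<dots> \<in> supp {v. length v < length w}"
      by (rule conc_supp[OF G[unfolded letters_def] H]) (use i False in auto)
    finally show ?thesis .
  qed
qed

lemma letters_trunc: "G w \<in> letters \<Longrightarrow> G [] = 0 \<Longrightarrow> G w - linpart G w \<in> supp {v. length v < length w}"
proof (cases "length w \<le> 1")
  case True
  assume "G [] = 0"
  with True show ?thesis by (cases w) (auto simp: linpart_def free.subspace_0[OF subspace_supp])
next
  case False
  assume "G w \<in> letters"
  with False show ?thesis unfolding letters_def linpart_def by (auto elim: supp_mono[rotated])
qed

lemma mor_of_trunc:
  assumes "\<And>u. c u \<in> letters" "c [] = 0"
  shows "mor_of c w - mor_of (linpart c) w \<in> supp {v. length v < length w}"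
proof (induction w rule: length_induct)
  case (1 w)
  have "convol c (mor_of c) w - convol (linpart c) (mor_of (linpart c)) w \<in> supp {v. length v < length w}"
    by (rule convol_trunc) (use 1 assms mor_of_upto in auto)
  from free.subspace_add[OF subspace_supp letters_trunc[where G=c and w=w, OF assms] this]
  show ?case by (simp add: mor_of_rec[of _ w] algebra_simps)
qed

lemma twist_linpart: "twist e (linpart c) = linpart (twist e c)"
  by (auto simp: twist_def linpart_def ksign_simps)

lemma der_of_trunc:
  assumes c: "\<And>u. c u \<in> letters" and d: "\<And>u. d u \<in> letters" "d [] = 0" and P: "\<And>u. P u \<in> supp (maxlen (length u))"
    and P': "\<And>u. P u - P' u \<in> supp {v. length v < length u}"
  shows "der_of e c P d w - der_of e (linpart c) P' (linpart d) w \<in> supp {v. length v < length w}"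
proof (induction w rule: length_induct)
  case (1 w)
  have a: "convol (twist e c) (der_of e c P d) w - convol (linpart (twist e c)) (der_of e (linpart c) P' (linpart d)) w \<in> supp {v. length v < length w}"
    by (rule convol_trunc) (use 1 in \<open>auto intro!: twist_letters der_of_upto c d P\<close>)
  have b: "convol d P w - convol (linpart d) P' w \<in> supp {v. length v < length w}"
    by (rule convol_trunc) (auto intro!: d P P')
  from free.subspace_add[OF subspace_supp free.subspace_add[OF subspace_supp letters_trunc[where G=d and w=w, OF d] a] b]
  show ?case by (simp add: der_of_rec[of _ _ _ _ w] twist_linpart algebra_simps)
qed

abbreviation oflen :: "nat \<Rightarrow> 'a list set" where "oflen n \<equiv> {w. length w = n}"

lemma convol_linpart:
  assumes "\<And>u. G u \<in> letters" "\<And>u. length u < length w \<Longrightarrow> H u \<in> supp (oflen (length u))"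
  shows "convol (linpart G) H w \<in> supp (oflen (length w))"
  unfolding convol_def
proof (rule free.subspace_sum[OF subspace_supp])
  fix i assume i: "i \<in> {1..<length w}"
  show "conc (linpart G (take i w)) (H (drop i w)) \<in> supp (oflen (length w))"
  proof (cases "i = 1")
    case True
    with i have "linpart G (take i w) = G (take i w)" by (simp add: linpart_def min_def)
    with True i show ?thesis by (simp, intro conc_supp[OF assms(1)[unfolded letters_def] assms(2)]) auto
  next
    case False
    with i have "linpart G (take i w) = 0" by (simp add: linpart_def min_def)
    then show ?thesis by (simp add: conc_simps free.subspace_0[OF subspace_supp])
  qed
qed

lemma letters_oflen: "G w \<in> letters \<Longrightarrow> linpart G w \<in> supp (oflen (length w))"
  unfolding letters_def linpart_def by (auto simp: free.subspace_0[OF subspace_supp])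

lemma mor_of_linpart:
  assumes "\<And>u. c u \<in> letters"
  shows "mor_of (linpart c) w \<in> supp (oflen (length w))"
proof (induction w rule: length_induct)
  case (1 w)
  show ?case by (subst mor_of_rec)
    (intro free.subspace_add[OF subspace_supp] letters_oflen convol_linpart assms; use 1 in simp)
qed

lemma der_of_linpart:
  assumes "\<And>u. c u \<in> letters" "\<And>u. d u \<in> letters" "\<And>u. P u \<in> supp (oflen (length u))"
  shows "der_of e (linpart c) P (linpart d) w \<in> supp (oflen (length w))"
proof (induction w rule: length_induct)
  case (1 w)
  show ?case by (subst der_of_rec, subst twist_linpart)
    (intro free.subspace_add[OF subspace_supp] letters_oflen convol_linpart twist_letters assms; use 1 in simp)
qed

lemma letter_of_linpart: "letter_of e (linpart f) = linpart (letter_of e f)"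
  by (rule ext) (auto simp: letter_of_def linpart_def)

lemma id_letter_linpart: "id_letter = linpart id_letter" by (rule ext) (auto simp: id_letter_def linpart_def)

lemma letter_of_cong: "f u = g u \<Longrightarrow> letter_of e f u = letter_of e g u" by (simp add: letter_of_def)

lemma der_lift_upto: "der_lift m (sng w) \<in> supp (maxlen (length w))"
  by (auto simp: der_lift_def intro!: der_of_upto letter_of_in id_letter_in sng_supp)

lemma mor_lift_upto: "mor_lift f (sng w) \<in> supp (maxlen (length w))"
  by (auto simp: mor_lift_def intro!: mor_of_upto letter_of_in)

lemma der_lift_trunc: "der_lift m (sng w) - der_lift (linpart m) (sng w) \<in> supp {v. length v < length w}"
  unfolding der_lift_def lin_ext_sng letter_of_linpart
  using der_of_trunc[of id_letter "letter_of (-1) m" sng sng "-1" w, folded id_letter_linpart]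
  by (simp add: letter_of_in id_letter_in sng_supp free.subspace_0[OF subspace_supp])

lemma mor_lift_trunc: "mor_lift f (sng w) - mor_lift (linpart f) (sng w) \<in> supp {v. length v < length w}"
  by (auto simp: mor_lift_def letter_of_linpart intro!: mor_of_trunc letter_of_in)

lemma der_lift_linpart: "der_lift (linpart m) (sng w) \<in> supp (oflen (length w))"
  unfolding der_lift_def lin_ext_sng letter_of_linpart
  by (subst id_letter_linpart, rule der_of_linpart) (auto intro!: letter_of_in id_letter_in sng_supp)

lemma mor_lift_linpart: "mor_lift (linpart f) (sng w) \<in> supp (oflen (length w))"
  by (auto simp: mor_lift_def letter_of_linpart intro!: mor_of_linpart letter_of_in)

lemma htp_lift_linpart: "htp_lift (linpart f) (linpart g) (linpart h) (sng w) \<in> supp (oflen (length w))"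
  by (auto simp: htp_lift_def letter_of_linpart intro!: der_of_linpart mor_of_linpart letter_of_in)


section \<open>Values on one-letter words\<close>

lemma ev_eqv:
  assumes "graded_module V" "graded_module W" "mlin V W e f" "x - y \<in> tensor_rel V"
  shows "ev (scl W) f x = ev (scl W) f y"
  using ev_mlin_rel[OF assms] by (simp add: module_hom.diff[OF ev_hom[OF gm_module[OF assms(2)]]])

lemma letter_comb:
  assumes V: "graded_module V" and W: "graded_module W" and f: "mlin V W e f" and a: "a \<in> part V d" "b \<in> part V d"
  shows "f [(d, a + scl V c b)] = f [(d, a)] + scl W c (f [(d, b)])"
proof -
  have "f ([] @ (d, a + scl V c b) # []) = f ([] @ (d, a) # []) + scl W c (f ([] @ (d, b) # []))"
    using f a unfolding mlin_iff[OF V W] by (metis append_Nil words_Cons)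
  then show ?thesis by simp
qed

lemma letter_add:
  assumes V: "graded_module V" and W: "graded_module W" and f: "mlin V W e f" and a: "a \<in> part V d" "b \<in> part V d"
  shows "f [(d, a + b)] = f [(d, a)] + f [(d, b)]"
  using letter_comb[OF assms, of 1] by (simp add: module.scale_one[OF gm_module[OF V]] module.scale_one[OF gm_module[OF W]])

lemma letter_minus:
  assumes V: "graded_module V" and W: "graded_module W" and f: "mlin V W e f" and a: "a \<in> part V d" "b \<in> part V d"
  shows "f [(d, a - b)] = f [(d, a)] - f [(d, b)]"
  using letter_comb[OF assms, of "-1"]
  by (simp add: module.scale_one[OF gm_module[OF V]] module.scale_one[OF gm_module[OF W]] module.scale_minus_left[OF gm_module[OF V]] module.scale_minus_left[OF gm_module[OF W]])

lemma letter_zero: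
  assumes V: "graded_module V" and W: "graded_module W" and f: "mlin V W e f"
  shows "f [(d, 0)] = 0"
  using letter_add[OF assms, of 0 d 0] module.subspace_0[OF gm_module[OF V] gm_part[OF V]] by simp

lemma letter_neg:
  assumes V: "graded_module V" and W: "graded_module W" and f: "mlin V W e f" and a: "a \<in> part V d"
  shows "f [(d, - a)] = - f [(d, a)]"
  using letter_minus[OF assms(1-3) _ a, of 0] letter_zero[OF assms(1-3)] module.subspace_0[OF gm_module[OF V] gm_part[OF V]] by simp

lemma letter_scale:
  assumes V: "graded_module V" and W: "graded_module W" and f: "mlin V W e f" and a: "a \<in> part V d"
  shows "f [(d, scl V c a)] = scl W c (f [(d, a)])"
  using letter_comb[OF assms(1-3) _ a, of 0] letter_zero[OF assms(1-3)] module.subspace_0[OF gm_module[OF V] gm_part[OF V]] by simp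

lemma ev_letter_of:
  assumes V: "graded_module V" and W: "graded_module W" and x: "mlin V W e' x" and w: "w \<noteq> []"
  shows "ev (scl W) x (letter_of e f w) = x [(deg w + e, f w)]"
  using ev_eqv[OF V W x letter_of_rel[OF V w, of e f]] by (simp add: ev_sng[OF gm_module[OF W]])

text \<open>Composition of a family of degree \<open>e\<close> with a map on letters.\<close>

definition post :: "int \<Rightarrow> ('b word \<Rightarrow> 'c) \<Rightarrow> ('a word \<Rightarrow> 'b) \<Rightarrow> 'a word \<Rightarrow> 'c" where
  "post e f G w = f [(deg w + e, G w)]"

lemma mlin_post:
  assumes U: "graded_module U" and V: "graded_module V" and W: "graded_module W"
    and f: "mlin V W k f" and G: "mlin U V e G" and ek: "ek = e + k"
  shows "mlin U W ek (post e f G)"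
  unfolding mlin_iff[OF U W]
proof (intro conjI ballI allI impI)
  fix w assume "w \<in> words U"
  then show "post e f G w \<in> part W (deg w + ek)"
    using mlin_in[OF f, of "[(deg w + e, G w)]"] mlin_in[OF G] by (simp add: post_def words_Cons ek add.assoc)
next
  fix u n a c b v assume w: "u @ (n, a) # v \<in> words U" "b \<in> part U n"
  have "G (u @ (n, a) # v) \<in> part V (deg u + n + deg v + e)" "G (u @ (n, b) # v) \<in> part V (deg u + n + deg v + e)"
    using mlin_in[OF G w(1)] mlin_in[OF G words_comb(1)[OF U w]] by (simp_all add: add.assoc)
  from letter_comb[OF V W f this]
  show "post e f G (u @ (n, a + scl U c b) # v) = post e f G (u @ (n, a) # v) + scl W c (post e f G (u @ (n, b) # v))"
    using G w unfolding mlin_iff[OF U V] post_def by (simp add: add.assoc)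
qed

lemma ev_post:
  assumes U: "graded_module U" and V: "graded_module V" and W: "graded_module W"
    and f: "mlin V W k f" and G: "mlin U V e G" and x: "x \<in> tensor_elts_deg U d"
  shows "ev (scl W) (post e f G) x = f [(d + e, ev (scl V) G x)]"
proof -
  interpret V: module "scl V" by (rule gm_module[OF V])
  note hV = ev_hom[OF gm_module[OF V], of G] and hW = ev_hom[OF gm_module[OF W], of "post e f G"]
  let ?S = "{x. ev (scl V) G x \<in> part V (d + e) \<and> ev (scl W) (post e f G) x = f [(d + e, ev (scl V) G x)]}"
  have "free.subspace ?S" unfolding free.subspace_def
    by (auto simp: module_hom.zero[OF hV] module_hom.zero[OF hW] module_hom.add[OF hV] module_hom.add[OF hW]
      module_hom.scale[OF hV] module_hom.scale[OF hW] letter_zero[OF V W f] letter_add[OF V W f] letter_scale[OF V W f]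
      intro: V.subspace_0[OF gm_part[OF V]] V.subspace_add[OF gm_part[OF V]] V.subspace_scale[OF gm_part[OF V]])
  moreover have "sng w \<in> ?S" if "w \<in> words U" "deg w = d" for w
    using that mlin_in[OF G] by (auto simp: ev_sng[OF gm_module[OF V]] ev_sng[OF gm_module[OF W]] post_def)
  ultimately have "tensor_elts_deg U d \<subseteq> ?S"
    unfolding elts_supp supp_span by (intro free.span_minimal) auto
  with x show ?thesis by auto
qed

lemma lifts_letter:
  "mor_lift f (sng [l]) = letter_of 0 f [l]" "der_lift m (sng [l]) = letter_of (-1) m [l]" "htp_lift f g h (sng [l]) = letter_of 1 h [l]"
  by (simp_all add: mor_lift_def der_lift_def htp_lift_def mor_of_rec[of _ "[l]"] der_of_rec[of _ _ _ _ "[l]"] convol_def)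

section \<open>Obstructions\<close>

text \<open>
  An \<open>A\<^sub>\<infinity>\<close>-structure on a suspended module, through the corestriction
  of the equation \<open>\<delta>\<^sup>2 = 0\<close>.
\<close>

definition ainf_str :: "('r::comm_ring_1, 'a::ab_group_add) dgmod \<Rightarrow> ('a word \<Rightarrow> 'a) \<Rightarrow> bool" where
  "ainf_str V m \<longleftrightarrow> graded_module V \<and> mlin V V (-1) m \<and> (\<forall>w\<in>words V. ev (scl V) m (der_lift m (sng w)) = 0)"

lemma ev_str:
  assumes "ainf_str V m" "x \<in> tensor_elts V"
  shows "ev (scl V) m (der_lift m x) = 0"
  using assms
  by (intro hom_eq_supp[OF hom_comp[OF lin_lifts(3) ev_hom] hom_0 _ assms(2)[unfolded elts_supp]])
    (auto simp: ainf_str_def gm_module free.module_axioms)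

text \<open>
  The square of a coderivation of odd degree is a coderivation, since the mixed terms cancel. So it
  vanishes with its corestriction.
\<close>

lemma der_lift_square:
  fixes V :: "('r::comm_ring_1, 'a::ab_group_add) dgmod"
  assumes m: "ainf_str V m" and x: "x \<in> tensor_elts V"
  shows "der_lift m (der_lift m x) \<in> tensor_rel V"
proof (rule hom_elts_rel[OF hom_comp[OF lin_lifts(3) lin_lifts(3)] _ x])
  have V: "graded_module V" and mm: "mlin V V (-1) m" using m by (auto simp: ainf_str_def)
  note hm = tensor_hom_der_lift[OF V mm]
  note D = tensor_homD(2)[OF hm sng_elts(1)]
  fix w assume w: "w \<in> words V"
  show "der_lift m (der_lift m (sng w)) \<in> tensor_rel V"
  proof (rule vanishing[OF V tensor_hom_comp[OF hm hm refl], where N="Suc (length w)"])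
    fix w assume w: "w \<in> words V" and IH: "\<And>u. u \<in> words V \<Longrightarrow> length u < length w \<Longrightarrow> der_lift m (der_lift m (sng u)) \<in> tensor_rel V"
    let ?D = "der_lift m :: ('a word \<Rightarrow>\<^sub>0 'r) \<Rightarrow> _"
    have S: "ksign (- deg u) (sng u) \<in> tensor_elts_deg V (deg u + 0)" if "u \<in> words V" for u
      using sng_elts(1)[OF that] unfolding elts_supp by (auto intro!: ksign_subspace[OF free.module_axioms subspace_supp])
    have k: "ksign (- n) (ksign (- n) x) = x" "ksign (1 - n) x = - ksign (- n) x" for n and x :: "'x::ab_group_add"
      by (auto simp: ksign_def)
    have "coprod (?D (?D (sng w))) = cuts (\<lambda>u. ?D (?D (sng u))) sng w + cuts sng (\<lambda>u. ?D (?D (sng u))) w"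
      by (simp add: coprod_der_lift_elt[of m "?D (sng w)"] coprod_der_lift module_hom.add[OF lin_tens_map]
        tens_map_cuts[OF lin_lifts(3) lin_id(2) w S] tens_map_cuts[OF lin_lifts(3) lin_id(2) w D]
        tens_map_cuts[OF lin_id(2) lin_lifts(3) w S] tens_map_cuts[OF lin_id(2) lin_lifts(3) w D]
        ksign_hom[OF lin_lifts(3)] twist_def[abs_def] k cuts_neg ksign_simps(1))
    also have "\<dots> \<in> tensor_rel2 V"
      by (intro free.subspace_add[OF subspace_rel2] cuts_rel2(1)[OF w IH] cuts_rel2(2)[OF w _ IH] sng_elts)
    finally show "coprod (?D (?D (sng w))) \<in> tensor_rel2 V" .
  qed (use w in \<open>auto simp: corestr_der_lift[OF V tensor_hom_elts[OF hm sng_elts(2)]] ev_str[OF m sng_elts(2)]\<close>)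
qed

text \<open>
  The corestrictions of \<open>mor_defect_map\<close> and \<open>htp_defect_map\<close>: the left
  hand sides of the equations for the components of a morphism and of a homotopy.
\<close>

definition mor_defect :: "('r::comm_ring_1, 'b::ab_group_add) dgmod \<Rightarrow> ('a::ab_group_add word \<Rightarrow> 'a) \<Rightarrow> ('b word \<Rightarrow> 'b) \<Rightarrow>
   ('a word \<Rightarrow> 'b) \<Rightarrow> 'a word \<Rightarrow> 'b" where
  "mor_defect W m m' f w = ev (scl W) m' (mor_lift f (sng w)) - ev (scl W) f (der_lift m (sng w))"

definition htp_defect :: "('r::comm_ring_1, 'b::ab_group_add) dgmod \<Rightarrow> ('a::ab_group_add word \<Rightarrow> 'a) \<Rightarrow> ('b word \<Rightarrow> 'b) \<Rightarrow>
   ('a word \<Rightarrow> 'b) \<Rightarrow> ('a word \<Rightarrow> 'b) \<Rightarrow> ('a word \<Rightarrow> 'b) \<Rightarrow> 'a word \<Rightarrow> 'b" where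
  "htp_defect W m m' f g h w = g w - f w - ev (scl W) m' (htp_lift f g h (sng w)) - ev (scl W) h (der_lift m (sng w))"

definition fam_morphism :: "('r::comm_ring_1, 'a::ab_group_add) dgmod \<Rightarrow> ('a word \<Rightarrow> 'a) \<Rightarrow>
   ('r, 'b::ab_group_add) dgmod \<Rightarrow> ('b word \<Rightarrow> 'b) \<Rightarrow> ('a word \<Rightarrow> 'b) \<Rightarrow> bool" where
  "fam_morphism V m W m' f \<longleftrightarrow> mlin V W 0 f \<and> (\<forall>w\<in>words V. mor_defect W m m' f w = 0)"

lemma fam_morphismD:
  assumes "fam_morphism V m W m' f"
  shows "mlin V W 0 f" "w \<in> words V \<Longrightarrow> mor_defect W m m' f w = 0"
  using assms by (simp_all add: fam_morphism_def)

locale ainf_pair =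
  fixes V :: "('r::comm_ring_1, 'a::ab_group_add) dgmod" and m :: "'a word \<Rightarrow> 'a"
    and W :: "('r, 'b::ab_group_add) dgmod" and m' :: "'b word \<Rightarrow> 'b"
  assumes src: "ainf_str V m" and tgt: "ainf_str W m'"
begin

lemma V: "graded_module V" and W: "graded_module W" and m: "mlin V V (-1) m" and m': "mlin W W (-1) m'"
  using src tgt by (auto simp: ainf_str_def)

lemma W_mod: "module (scl W)" by (rule gm_module[OF W])

abbreviation "evW \<equiv> ev (scl W)"
abbreviation "mor_liftW \<equiv> (mor_lift :: ('a word \<Rightarrow> 'b) \<Rightarrow> ('a word \<Rightarrow>\<^sub>0 'r) \<Rightarrow> ('b word \<Rightarrow>\<^sub>0 'r))"
abbreviation "D \<equiv> mor_defect W m m'"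
abbreviation "E \<equiv> htp_defect W m m'"

lemmas ev_simps = module_hom.add[OF ev_hom[OF W_mod]] module_hom.diff[OF ev_hom[OF W_mod]] ev_sng[OF W_mod]

lemma hom_mor_defect_map: "mlin V W 0 f \<Longrightarrow> tensor_hom V W (-1) (mor_defect_map m m' f)"
  unfolding mor_defect_map_def[abs_def]
  by (intro tensor_hom_diff tensor_hom_comp[OF tensor_hom_mor_lift[OF V W] tensor_hom_der_lift[OF W m']]
     tensor_hom_comp[OF tensor_hom_der_lift[OF V m] tensor_hom_mor_lift[OF V W]]) simp_all

lemma hom_htp_defect_map: "mlin V W 0 f \<Longrightarrow> mlin V W 0 g \<Longrightarrow> mlin V W 1 h \<Longrightarrow> tensor_hom V W 0 (htp_defect_map m m' f g h)"
  unfolding htp_defect_map_def[abs_def]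
  by (intro tensor_hom_diff tensor_hom_mor_lift[OF V W] tensor_hom_comp[OF tensor_hom_htp_lift[OF V W] tensor_hom_der_lift[OF W m']]
     tensor_hom_comp[OF tensor_hom_der_lift[OF V m] tensor_hom_htp_lift[OF V W]]) simp_all

lemma ev_D: "evW (D f) x = evW m' (mor_lift f x) - evW f (der_lift m x)"
  by (rule fun_cong[OF hom_eqI[OF ev_hom[OF W_mod] hom_diff[OF hom_comp[OF lin_lifts(1) ev_hom[OF W_mod]] hom_comp[OF lin_lifts(3) ev_hom[OF W_mod]]]]])
    (simp add: ev_simps mor_defect_def)

lemma ev_E: "evW (E f g h) x = evW g x - evW f x - evW m' (htp_lift f g h x) - evW h (der_lift m x)"
  by (rule fun_cong[OF hom_eqI[OF ev_hom[OF W_mod] hom_diff[OF hom_diff[OF hom_diff[OF ev_hom[OF W_mod] ev_hom[OF W_mod]] hom_comp[OF lin_lifts(2) ev_hom[OF W_mod]]] hom_comp[OF lin_lifts(3) ev_hom[OF W_mod]]]]])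
    (simp add: ev_simps htp_defect_def)

lemma corestr_mor_defect_map: "mlin V W 0 f \<Longrightarrow> x \<in> tensor_elts V \<Longrightarrow> evW id_fam (mor_defect_map m m' f x) = evW (D f) x"
  unfolding mor_defect_map_def ev_D
  by (simp add: ev_simps corestr_der_lift[OF W tensor_hom_elts[OF tensor_hom_mor_lift[OF V W]]] corestr_mor_lift[OF W tensor_hom_elts[OF tensor_hom_der_lift[OF V m]]])

lemma corestr_htp_defect_map: "mlin V W 0 f \<Longrightarrow> mlin V W 0 g \<Longrightarrow> mlin V W 1 h \<Longrightarrow> x \<in> tensor_elts V \<Longrightarrow>
   evW id_fam (htp_defect_map m m' f g h x) = evW (E f g h) x"
  unfolding htp_defect_map_def ev_E
  by (simp add: ev_simps corestr_der_lift[OF W tensor_hom_elts[OF tensor_hom_htp_lift[OF V W]]] corestr_htp_lift[OF W tensor_hom_elts[OF tensor_hom_der_lift[OF V m]]]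
     corestr_mor_lift[OF W])

lemma mlin_D: "mlin V W 0 f \<Longrightarrow> mlin V W (-1) (D f)"
  using mlin_precomp[OF V W W mlin_id_fam[OF W] hom_mor_defect_map[of f], of "-1"]
  by (rule mlin_cong[OF V W]) (simp_all add: precomp_def corestr_mor_defect_map sng_elts ev_simps)

lemma mlin_E: "mlin V W 0 f \<Longrightarrow> mlin V W 0 g \<Longrightarrow> mlin V W 1 h \<Longrightarrow> mlin V W 0 (E f g h)"
  using mlin_precomp[OF V W W mlin_id_fam[OF W] hom_htp_defect_map[of f g h], of 0]
  by (rule mlin_cong[OF V W]) (simp_all add: precomp_def corestr_htp_defect_map sng_elts ev_simps)

text \<open>
  Below, \<open>N\<close> is the arity under construction: the equations hold for words shorter than
  \<open>N\<close> and the statements are about words of length at most \<open>N\<close>.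
\<close>

lemma mor_defect_map_leading:
  assumes f: "mlin V W 0 f" and van: "\<And>u. u \<in> words V \<Longrightarrow> length u < N \<Longrightarrow> D f u = 0"
    and w: "w \<in> words V" "length w \<le> N"
  shows "mor_defect_map m m' f (sng w) - sng [(deg w - 1, D f w)] \<in> tensor_rel W"
proof -
  have "mor_defect_map m m' f (sng w) - sng [(deg w + - 1, evW id_fam (mor_defect_map m m' f (sng w)))] \<in> tensor_rel W"
  proof (rule leading_letter[OF W hom_mor_defect_map[OF f] _ _ w])
    fix w assume w: "w \<in> words V" and IH: "\<And>u. u \<in> words V \<Longrightarrow> length u < length w \<Longrightarrow> mor_defect_map m m' f (sng u) \<in> tensor_rel W"
    show "coprod (mor_defect_map m m' f (sng w)) \<in> tensor_rel2 W"
      unfolding coprod_mor_defect_map[OF V W m m' f w]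
      by (intro free.subspace_add[OF subspace_rel2] cuts_rel2(1)[OF w IH] cuts_rel2(2)[OF w _ IH] twist_elts
          tensor_hom_elts[OF tensor_hom_mor_lift[OF V W f]] sng_elts)
  qed (simp add: corestr_mor_defect_map[OF f] sng_elts ev_simps van)
  then show ?thesis using w by (simp add: corestr_mor_defect_map[OF f] sng_elts ev_simps)
qed

lemma mor_defect_map_vanishes:
  assumes f: "mlin V W 0 f" and van: "\<And>u. u \<in> words V \<Longrightarrow> length u < N \<Longrightarrow> D f u = 0"
    and w: "w \<in> words V" "length w < N"
  shows "mor_defect_map m m' f (sng w) \<in> tensor_rel W"
  using free.subspace_add[OF subspace_rel mor_defect_map_leading[OF f van w(1), of N] letter0_rel[OF W, of "deg w - 1"]] van[OF w] w by simp

lemma htp_defect_map_leading: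
  assumes f: "mlin V W 0 f" and g: "mlin V W 0 g" and h: "mlin V W 1 h"
    and vf: "\<And>u. u \<in> words V \<Longrightarrow> length u < N \<Longrightarrow> D f u = 0" and vg: "\<And>u. u \<in> words V \<Longrightarrow> length u < N \<Longrightarrow> D g u = 0"
    and van: "\<And>u. u \<in> words V \<Longrightarrow> length u < N \<Longrightarrow> E f g h u = 0"
    and w: "w \<in> words V" "length w \<le> N"
  shows "htp_defect_map m m' f g h (sng w) - sng [(deg w, E f g h w)] \<in> tensor_rel W"
proof -
  have "htp_defect_map m m' f g h (sng w) - sng [(deg w + 0, evW id_fam (htp_defect_map m m' f g h (sng w)))] \<in> tensor_rel W"
  proof (rule leading_letter[OF W hom_htp_defect_map[OF f g h] _ _ w])
    fix w assume w: "w \<in> words V" "length w \<le> N" and IH: "\<And>u. u \<in> words V \<Longrightarrow> length u < length w \<Longrightarrow> htp_defect_map m m' f g h (sng u) \<in> tensor_rel W"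
    have Df: "mor_defect_map m m' f (sng u) \<in> tensor_rel W" and Dg: "mor_defect_map m m' g (sng u) \<in> tensor_rel W" if "u \<in> words V" "length u < length w" for u
      using mor_defect_map_vanishes[OF f vf] mor_defect_map_vanishes[OF g vg] that w by auto
    show "coprod (htp_defect_map m m' f g h (sng w)) \<in> tensor_rel2 W"
      unfolding coprod_htp_defect_map[OF V W m m' f g h w(1)]
      by (intro free.subspace_add[OF subspace_rel2] free.subspace_diff[OF subspace_rel2] cuts_rel2(1)[OF w(1) IH] cuts_rel2(2)[OF w(1) _ IH]
          cuts_rel2(1)[OF w(1) twist_rel[OF Df]] cuts_rel2(2)[OF w(1) _ Dg] twist_elts
          tensor_hom_elts[OF tensor_hom_mor_lift[OF V W f]] tensor_hom_elts[OF tensor_hom_mor_lift[OF V W g]]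
          tensor_hom_elts[OF tensor_hom_htp_lift[OF V W f g h]] sng_elts)
  qed (simp add: corestr_htp_defect_map[OF f g h] sng_elts ev_simps van)
  then show ?thesis using w by (simp add: corestr_htp_defect_map[OF f g h] sng_elts ev_simps)
qed

lemma htp_defect_map_vanishes:
  assumes f: "mlin V W 0 f" and g: "mlin V W 0 g" and h: "mlin V W 1 h"
    and vf: "\<And>u. u \<in> words V \<Longrightarrow> length u < N \<Longrightarrow> D f u = 0" and vg: "\<And>u. u \<in> words V \<Longrightarrow> length u < N \<Longrightarrow> D g u = 0"
    and van: "\<And>u. u \<in> words V \<Longrightarrow> length u < N \<Longrightarrow> E f g h u = 0"
    and w: "w \<in> words V" "length w < N"
  shows "htp_defect_map m m' f g h (sng w) \<in> tensor_rel W"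
  using free.subspace_add[OF subspace_rel htp_defect_map_leading[OF f g h vf vg van w(1), of N] letter0_rel[OF W, of "deg w"]] van[OF w] w by simp

text \<open>
  Apply the corestriction \<open>m'\<close> of the differential to the defect map and use
  \<open>\<delta>\<^sup>2 = 0\<close> in source and target.
\<close>

lemma D_cycle:
  assumes f: "mlin V W 0 f" and van: "\<And>u. u \<in> words V \<Longrightarrow> length u < N \<Longrightarrow> D f u = 0"
    and w: "w \<in> words V" "length w \<le> N"
  shows "m' [(deg w - 1, D f w)] = - evW (D f) (der_lift m (sng w))"
proof -
  note s = sng_elts(2)[OF w(1)]
  note c = tensor_hom_elts[OF tensor_hom_der_lift[OF V m]] and F = tensor_hom_elts[OF tensor_hom_mor_lift[OF V W f]]
  have "m' [(deg w - 1, D f w)] = evW m' (mor_defect_map m m' f (sng w))"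
    using ev_eqv[OF W W m' mor_defect_map_leading[OF f van w]] by (simp add: ev_simps)
  also have "\<dots> = - evW m' (mor_lift f (der_lift m (sng w)))"
    by (simp add: mor_defect_map_def ev_simps ev_str[OF tgt F[OF s]])
  also have "\<dots> = - evW (D f) (der_lift m (sng w))"
    using ev_mlin_rel[OF V W f der_lift_square[OF src s]] by (simp add: ev_D)
  finally show ?thesis .
qed

text \<open>
  As for \<open>D_cycle\<close>; the terms \<open>\<delta>\<eta>\<delta>\<close> cancel and
  \<open>\<delta>\<psi> - \<psi>\<delta>\<close>, \<open>\<delta>\<phi> - \<phi>\<delta>\<close>
  remain.
\<close>

lemma E_cycle:
  assumes f: "mlin V W 0 f" and g: "mlin V W 0 g" and h: "mlin V W 1 h"
    and vf: "\<And>u. u \<in> words V \<Longrightarrow> length u < N \<Longrightarrow> D f u = 0" and vg: "\<And>u. u \<in> words V \<Longrightarrow> length u < N \<Longrightarrow> D g u = 0"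
    and van: "\<And>u. u \<in> words V \<Longrightarrow> length u < N \<Longrightarrow> E f g h u = 0"
    and w: "w \<in> words V" "length w \<le> N"
  shows "m' [(deg w, E f g h w)] = evW (E f g h) (der_lift m (sng w)) + D g w - D f w"
proof -
  note s = sng_elts(2)[OF w(1)]
  note H = tensor_hom_elts[OF tensor_hom_htp_lift[OF V W f g h]]
  have "m' [(deg w, E f g h w)] = evW m' (htp_defect_map m m' f g h (sng w))"
    using ev_eqv[OF W W m' htp_defect_map_leading[OF f g h vf vg van w]] by (simp add: ev_simps)
  also have "\<dots> = evW m' (mor_lift g (sng w)) - evW m' (mor_lift f (sng w)) - evW m' (htp_lift f g h (der_lift m (sng w)))"
    by (simp add: htp_defect_map_def ev_simps ev_str[OF tgt H[OF s]])
  also have "\<dots> = evW (E f g h) (der_lift m (sng w)) + D g w - D f w"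
    using ev_mlin_rel[OF V W h der_lift_square[OF src s]] by (simp add: ev_E mor_defect_def)
  finally show ?thesis .
qed

lemma ev_der_lift_small:
  assumes "\<And>u. length u < length w \<Longrightarrow> x u = 0"
  shows "evW x (der_lift m (sng w)) = evW x (der_lift (linpart m) (sng w))"
  using ev_zero[OF W_mod der_lift_trunc, of w x m] assms by (simp add: ev_simps)

text \<open>
  In arity \<open>N\<close> a change of the components of arity \<open>N\<close> enters the defect
  only through its boundary in the Hom complex for the linear differentials; hence obstructions are
  removed by solving a linear equation.
\<close>

lemma D_change:
  assumes f: "mlin V W 0 f" and f': "mlin V W 0 f'" and agree: "\<And>u. length u < N \<Longrightarrow> f' u = f u" and w: "w \<in> words V"
  shows "length w < N \<Longrightarrow> D f' w = D f w"
    and "length w = N \<Longrightarrow> D f' w = D f w + m' [(deg w, f' w - f w)] - evW (\<lambda>u. f' u - f u) (der_lift (linpart m) (sng w))"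
proof -
  assume l: "length w < N"
  have "mor_liftW f' (sng w) = mor_lift f (sng w)"
    unfolding mor_lift_def lin_ext_sng by (rule mor_of_local) (use agree l in \<open>auto intro: letter_of_cong\<close>)
  moreover have "evW f' (der_lift m (sng w)) = evW f (der_lift m (sng w))"
    by (rule ev_cong[OF der_lift_upto]) (use agree l in auto)
  ultimately show "D f' w = D f w" by (simp add: mor_defect_def)
next
  assume l: "length w = N"
  have "mor_liftW f' (sng w) - mor_lift f (sng w) = letter_of 0 f' w - letter_of 0 f w"
    unfolding mor_lift_def lin_ext_sng by (rule mor_of_diff) (use agree l in \<open>auto intro: letter_of_cong\<close>)
  then have "evW m' (mor_lift f' (sng w)) - evW m' (mor_lift f (sng w)) = evW m' (letter_of 0 f' w) - evW m' (letter_of 0 f w)"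
    by (metis ev_simps(2))
  also have "\<dots> = m' [(deg w, f' w - f w)]"
    using mlin_in[OF f w] mlin_in[OF f' w] letter_minus[OF W W m', of "f' w" "deg w" "f w"] words_nonempty[OF w] by (simp add: ev_letter_of[OF W W m'])
  finally have 1: "evW m' (mor_lift f' (sng w)) = evW m' (mor_lift f (sng w)) + m' [(deg w, f' w - f w)]" by (simp add: algebra_simps)
  have "evW f' (der_lift m (sng w)) - evW f (der_lift m (sng w)) = evW (\<lambda>u. f' u - f u) (der_lift (linpart m) (sng w))"
    unfolding ev_diff_fam[OF W_mod, symmetric] by (rule ev_der_lift_small) (use agree l in auto)
  with 1 show "D f' w = D f w + m' [(deg w, f' w - f w)] - evW (\<lambda>u. f' u - f u) (der_lift (linpart m) (sng w))"
    by (simp add: mor_defect_def algebra_simps)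
qed

lemma E_change:
  assumes h: "mlin V W 1 h" and h': "mlin V W 1 h'"
    and agree: "\<And>u. length u < N \<Longrightarrow> f' u = f u" "\<And>u. length u < N \<Longrightarrow> g' u = g u" "\<And>u. length u < N \<Longrightarrow> h' u = h u"
    and w: "w \<in> words V"
  shows "length w < N \<Longrightarrow> E f' g' h' w = E f g h w"
    and "length w = N \<Longrightarrow> E f' g' h' w = E f g h w + (g' w - g w) - (f' w - f w)
      - m' [(deg w + 1, h' w - h w)] - evW (\<lambda>u. h' u - h u) (der_lift (linpart m) (sng w))"
proof -
  assume l: "length w < N"
  have "(htp_lift f' g' h' (sng w) :: _ \<Rightarrow>\<^sub>0 'r) = htp_lift f g h (sng w)"
    unfolding htp_lift_def lin_ext_sng by (rule der_of_local) (use agree l in \<open>auto intro!: letter_of_cong mor_of_local\<close>)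
  moreover have "evW h' (der_lift m (sng w)) = evW h (der_lift m (sng w))"
    by (rule ev_cong[OF der_lift_upto]) (use agree l in auto)
  ultimately show "E f' g' h' w = E f g h w" using agree l by (simp add: htp_defect_def)
next
  assume l: "length w = N"
  have "(htp_lift f' g' h' (sng w) :: _ \<Rightarrow>\<^sub>0 'r) - htp_lift f g h (sng w) = letter_of 1 h' w - letter_of 1 h w"
    unfolding htp_lift_def lin_ext_sng by (rule der_of_diff) (use agree l in \<open>auto intro!: letter_of_cong mor_of_local\<close>)
  then have "evW m' (htp_lift f' g' h' (sng w)) - evW m' (htp_lift f g h (sng w)) = evW m' (letter_of 1 h' w) - evW m' (letter_of 1 h w)"
    by (metis ev_simps(2))
  also have "\<dots> = m' [(deg w + 1, h' w - h w)]"
    using mlin_in[OF h w] mlin_in[OF h' w] letter_minus[OF W W m', of "h' w" "deg w + 1" "h w"] words_nonempty[OF w] by (simp add: ev_letter_of[OF W W m'])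
  finally have 1: "evW m' (htp_lift f' g' h' (sng w)) = evW m' (htp_lift f g h (sng w)) + m' [(deg w + 1, h' w - h w)]" by (simp add: algebra_simps)
  have "evW h' (der_lift m (sng w)) - evW h (der_lift m (sng w)) = evW (\<lambda>u. h' u - h u) (der_lift (linpart m) (sng w))"
    unfolding ev_diff_fam[OF W_mod, symmetric] by (rule ev_der_lift_small) (use agree l in auto)
  with 1 show "E f' g' h' w = E f g h w + (g' w - g w) - (f' w - f w)
      - m' [(deg w + 1, h' w - h w)] - evW (\<lambda>u. h' u - h u) (der_lift (linpart m) (sng w))"
    by (simp add: htp_defect_def algebra_simps)
qed

end


section \<open>Linear structures and tensor powers of homotopies\<close>

lemma mlin_linpart: "graded_module V \<Longrightarrow> graded_module W \<Longrightarrow> mlin V W e f \<Longrightarrow> mlin V W e (linpart f)"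
  unfolding linpart_def[abs_def] by (rule mlin_if[where P="\<lambda>n. n = 1"]) (auto intro: mlin_zero)

lemma linpart_letter [simp]: "linpart f [l] = f [l]" by (simp add: linpart_def)

lemma word_cases1: "w \<in> words V \<Longrightarrow> length w = 1 \<Longrightarrow> \<exists>n a. w = [(n, a)] \<and> a \<in> part V n"
  by (cases w) (auto simp: words_Cons)

lemma ev_linpart_zero:
  assumes "module s" "x \<in> supp (oflen n)" "n \<noteq> 1"
  shows "ev s (linpart f) x = 0"
  by (rule ev_zero[OF assms(1,2)]) (use assms(3) in \<open>auto simp: linpart_def\<close>)

lemma ev_letter_str:
  assumes m: "ainf_str V m" and a: "a \<in> part V n"
  shows "m [(n - 1, m [(n, a)])] = 0"
proof -
  have V: "graded_module V" and mm: "mlin V V (-1) m" using m by (auto simp: ainf_str_def)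
  have "[(n, a)] \<in> words V" using a by (simp add: words_Cons)
  then have "ev (scl V) m (der_lift m (sng [(n, a)])) = 0" using m by (simp add: ainf_str_def)
  then show ?thesis by (simp add: lifts_letter ev_letter_of[OF V V mm])
qed

lemma ainf_str_linpart:
  assumes m: "ainf_str V m"
  shows "ainf_str V (linpart m)"
proof -
  have V: "graded_module V" and mm: "mlin V V (-1) m" using m by (auto simp: ainf_str_def)
  have "ev (scl V) (linpart m) (der_lift (linpart m) (sng w)) = 0" if w: "w \<in> words V" for w
  proof (cases "length w = 1")
    case True
    then obtain n a where "w = [(n, a)]" "a \<in> part V n" using word_cases1[OF w] by blast
    then show ?thesis by (simp add: lifts_letter ev_letter_of[OF V V mlin_linpart[OF V V mm]] ev_letter_str[OF m])
  next
    case False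
    then show ?thesis by (rule ev_linpart_zero[OF gm_module[OF V] der_lift_linpart])
  qed
  with V mm show ?thesis by (simp add: ainf_str_def mlin_linpart)
qed

text \<open>
  A chain map, viewed as a family concentrated in arity one, is a morphism for the structures
  reduced to their differentials. Its lift is the direct sum of its tensor powers.
\<close>

lemma linear_morphism:
  assumes m: "ainf_str V m" and m': "ainf_str W m'" and f: "mlin V W 0 f"
    and chain: "\<And>n a. a \<in> part V n \<Longrightarrow> m' [(n, f [(n, a)])] = f [(n - 1, m [(n, a)])]" and w: "w \<in> words V"
  shows "mor_defect W (linpart m) (linpart m') (linpart f) w = 0"
proof (cases "length w = 1")
  case True
  have V: "graded_module V" and W: "graded_module W" and mm: "mlin W W (-1) m'" using m m' by (auto simp: ainf_str_def)
  obtain n a where "w = [(n, a)]" "a \<in> part V n" using word_cases1[OF w True] by blast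
  then show ?thesis
    by (simp add: mor_defect_def lifts_letter ev_letter_of[OF W W mlin_linpart[OF W W mm]] ev_letter_of[OF V W mlin_linpart[OF V W f]] chain)
next
  case False
  have s: "module (scl W)" using m' by (simp add: ainf_str_def gm_module)
  from False show ?thesis
    by (simp add: mor_defect_def ev_linpart_zero[OF s der_lift_linpart] ev_linpart_zero[OF s mor_lift_linpart])
qed

lemma linear_homotopy:
  assumes m: "ainf_str V m" and m': "ainf_str W m'" and f: "mlin V W 0 f" and g: "mlin V W 0 g" and h: "mlin V W 1 h"
    and chain: "\<And>n a. a \<in> part V n \<Longrightarrow> g [(n, a)] - f [(n, a)] = m' [(n + 1, h [(n, a)])] + h [(n - 1, m [(n, a)])]" and w: "w \<in> words V"
  shows "htp_defect W (linpart m) (linpart m') (linpart f) (linpart g) (linpart h) w = 0"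
proof (cases "length w = 1")
  case True
  have V: "graded_module V" and W: "graded_module W" and mm: "mlin W W (-1) m'" using m m' by (auto simp: ainf_str_def)
  obtain n a where "w = [(n, a)]" "a \<in> part V n" using word_cases1[OF w True] by blast
  then show ?thesis
    by (simp add: htp_defect_def lifts_letter ev_letter_of[OF W W mlin_linpart[OF W W mm]] ev_letter_of[OF V W mlin_linpart[OF V W h]] chain)
next
  case False
  have s: "module (scl W)" using m' by (simp add: ainf_str_def gm_module)
  from False show ?thesis
    by (simp add: htp_defect_def ev_linpart_zero[OF s der_lift_linpart] ev_linpart_zero[OF s htp_lift_linpart])
      (simp add: linpart_def)
qed

text \<open>Both sides are coalgebra morphisms with the same corestriction.\<close>

lemma mor_lift_comp:
  fixes U :: "('r::comm_ring_1, 'a::ab_group_add) dgmod" and V :: "('r, 'b::ab_group_add) dgmod" and W :: "('r, 'c::ab_group_add) dgmod"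
  assumes U: "graded_module U" and V: "graded_module V" and W: "graded_module W"
    and f: "mlin U V 0 f" and g: "mlin V W 0 g" and x: "x \<in> tensor_elts U"
  shows "mor_lift g (mor_lift f x) - mor_lift (precomp W g (mor_lift f)) x \<in> tensor_rel W"
proof -
  note hf = tensor_hom_mor_lift[OF U V f] and hg = tensor_hom_mor_lift[OF V W g]
  have gf: "mlin U W 0 (precomp W g (mor_lift f))" by (rule mlin_precomp[OF U V W g hf]) simp
  show ?thesis
  proof (rule morphism_unique[OF W tensor_hom_comp[OF hf hg] tensor_hom_mor_lift[OF U W gf] _ _ _ x])
    fix w assume w: "w \<in> words U"
    have c: "coprod (mor_lift g (mor_lift f (sng w))) = (cuts (\<lambda>w. mor_lift g (mor_lift f (sng w))) (\<lambda>w. mor_lift g (mor_lift f (sng w))) w :: _ \<Rightarrow>\<^sub>0 'r)"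
      by (simp add: coprod_mor_lift_elt[of g] coprod_mor_lift tens_map_cuts[OF lin_lifts(1) lin_lifts(1) w tensor_homD(2)[OF hf sng_elts(1)]] ksign_simps)
    show "coprod (mor_lift g (mor_lift f (sng w))) - (cuts (\<lambda>w. mor_lift g (mor_lift f (sng w))) (\<lambda>w. mor_lift g (mor_lift f (sng w))) w :: _ \<Rightarrow>\<^sub>0 'r) \<in> tensor_rel2 W"
      by (simp add: c free.subspace_0[OF subspace_rel2])
    show "coprod (mor_lift (precomp W g (mor_lift f)) (sng w)) - cuts (on_word (mor_lift (precomp W g (mor_lift f)))) (on_word (mor_lift (precomp W g (mor_lift f)))) w \<in> tensor_rel2 W"
      by (simp add: coprod_mor_lift free.subspace_0[OF subspace_rel2])
    show "ev (scl W) id_fam (mor_lift g (mor_lift f (sng w))) = ev (scl W) id_fam (mor_lift (precomp W g (mor_lift f)) (sng w))"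
      by (simp add: corestr_mor_lift[OF W tensor_hom_elts[OF hf sng_elts(2)[OF w]]] corestr_mor_lift[OF W sng_elts(2)[OF w]] ev_precomp[OF W lin_lifts(1)])
  qed simp
qed

lemma mor_lift_id_fam:
  fixes V :: "('r::comm_ring_1, 'a::ab_group_add) dgmod"
  assumes V: "graded_module V" and x: "x \<in> tensor_elts V"
  shows "mor_lift id_fam x - x \<in> tensor_rel V"
proof (rule morphism_unique[OF V tensor_hom_mor_lift[OF V V mlin_id_fam[OF V]] tensor_hom_id _ _ _ x])
  fix w assume w: "w \<in> words V"
  show "coprod (mor_lift id_fam (sng w)) - cuts (on_word (mor_lift id_fam)) (on_word (mor_lift id_fam)) w \<in> tensor_rel2 V"
    by (simp add: coprod_mor_lift free.subspace_0[OF subspace_rel2])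
  have "coprod (sng w) = (cuts sng sng w :: _ \<Rightarrow>\<^sub>0 'r)" by (simp add: coprod_sng cuts_def)
  then show "coprod (sng w) - (cuts sng sng w :: _ \<Rightarrow>\<^sub>0 'r) \<in> tensor_rel2 V"
    by (simp add: free.subspace_0[OF subspace_rel2])
  show "ev (scl V) id_fam (mor_lift id_fam (sng w)) = ev (scl V) id_fam (sng w)"
    by (rule corestr_mor_lift[OF V sng_elts(2)[OF w]])
qed

lemma id_fam_linpart: "linpart id_fam = id_fam"
  by (rule ext) (auto simp: linpart_def)

text \<open>
  For structures reduced to their differentials, \<open>htp_lift id_fam p k\<close> is the sum of
  the maps \<open>1\<^sup>\<otimes>\<^sup>i \<otimes> k \<otimes> p\<^sup>\<otimes>\<^sup>j\<close>,
  the usual homotopy between the tensor powers of \<open>id\<close> and \<open>p\<close>. That it is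
  one is again an instance of uniqueness of coderivations along morphisms.
\<close>

lemma tensor_homotopy:
  fixes V :: "('r::comm_ring_1, 'a::ab_group_add) dgmod"
  assumes str: "ainf_str V m" and p: "mlin V V 0 p" and k: "mlin V V 1 k"
    and pch: "\<And>n a. a \<in> part V n \<Longrightarrow> m [(n, p [(n, a)])] = p [(n - 1, m [(n, a)])]"
    and kch: "\<And>n a. a \<in> part V n \<Longrightarrow> p [(n, a)] - a = m [(n + 1, k [(n, a)])] + k [(n - 1, m [(n, a)])]"
    and x: "x \<in> tensor_elts V"
  shows "mor_lift (linpart p) x - x - der_lift (linpart m) (htp_lift id_fam (linpart p) (linpart k) x) - htp_lift id_fam (linpart p) (linpart k) (der_lift (linpart m) x) \<in> tensor_rel V"
proof -
  interpret ainf_pair V "linpart m" V "linpart m" by unfold_locales (rule ainf_str_linpart[OF str])+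
  note p' = mlin_linpart[OF V V p] and k' = mlin_linpart[OF V V k] and i = mlin_id_fam[OF V]
  have D1: "D id_fam w = 0" if "w \<in> words V" for w
    using linear_morphism[OF str str i _ that] by (simp add: id_fam_linpart)
  have D2: "D (linpart p) w = 0" if "w \<in> words V" for w
    using linear_morphism[OF str str p pch that] by simp
  have E1: "E id_fam (linpart p) (linpart k) w = 0" if "w \<in> words V" for w
    using linear_homotopy[OF str str i p k _ that] kch by (simp add: id_fam_linpart)
  have "htp_defect_map (linpart m) (linpart m) id_fam (linpart p) (linpart k) x \<in> tensor_rel V"
    by (rule hom_elts_rel[OF tensor_homD(1)[OF hom_htp_defect_map[OF i p' k']] _ x])
      (rule htp_defect_map_vanishes[OF i p' k' D1 D2 E1 _ lessI])
  from free.subspace_add[OF subspace_rel this mor_lift_id_fam[OF V x]] show ?thesis by (simp add: htp_defect_map_def algebra_simps)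
qed


text \<open>
  Chain maps, homotopies and homotopy equivalences for the differentials \<open>m [(n, a)]\<close>
  of suspended complexes. Only the values on one-letter words are constrained.
\<close>

definition letter_chain :: "('r, 'a) dgmod \<Rightarrow> ('a word \<Rightarrow> 'a) \<Rightarrow> ('b word \<Rightarrow> 'b) \<Rightarrow> ('a word \<Rightarrow> 'b) \<Rightarrow> bool" where
  "letter_chain V m m' f \<longleftrightarrow> (\<forall>n. \<forall>a\<in>part V n. m' [(n, f [(n, a)])] = f [(n - 1, m [(n, a)])])"

definition letter_homotopy :: "('r, 'a) dgmod \<Rightarrow> ('a word \<Rightarrow> 'a) \<Rightarrow> ('b::ab_group_add word \<Rightarrow> 'b) \<Rightarrow>
   (int \<Rightarrow> 'a \<Rightarrow> 'b) \<Rightarrow> (int \<Rightarrow> 'a \<Rightarrow> 'b) \<Rightarrow> ('a word \<Rightarrow> 'b) \<Rightarrow> bool" where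
  "letter_homotopy V m m' f g h \<longleftrightarrow>
    (\<forall>n. \<forall>a\<in>part V n. g n a - f n a = m' [(n + 1, h [(n, a)])] + h [(n - 1, m [(n, a)])])"

definition letter_equivalence ::
  "('r::comm_ring_1, 'a::ab_group_add) dgmod \<Rightarrow> ('a word \<Rightarrow> 'a) \<Rightarrow> ('r, 'b::ab_group_add) dgmod \<Rightarrow> ('b word \<Rightarrow> 'b) \<Rightarrow>
   ('a word \<Rightarrow> 'b) \<Rightarrow> ('b word \<Rightarrow> 'a) \<Rightarrow> ('a word \<Rightarrow> 'a) \<Rightarrow> ('b word \<Rightarrow> 'b) \<Rightarrow> bool" where
  "letter_equivalence V m W m' f g k l \<longleftrightarrow>
     mlin V W 0 f \<and> letter_chain V m m' f \<and> mlin W V 0 g \<and> letter_chain W m' m g \<and>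
     mlin V V 1 k \<and> letter_homotopy V m m (\<lambda>n a. a) (\<lambda>n a. g [(n, f [(n, a)])]) k \<and>
     mlin W W 1 l \<and> letter_homotopy W m' m' (\<lambda>n b. b) (\<lambda>n b. f [(n, g [(n, b)])]) l"

lemma mor_lift_linpart_commutes:
  fixes V :: "('r::comm_ring_1, 'a::ab_group_add) dgmod" and W :: "('r, 'b::ab_group_add) dgmod"
  assumes str: "ainf_str V m" "ainf_str W m'" and f: "mlin V W 0 f" and chain: "letter_chain V m m' f" and x: "x \<in> tensor_elts V"
  shows "der_lift (linpart m') (mor_lift (linpart f) x) - mor_lift (linpart f) (der_lift (linpart m) x) \<in> tensor_rel W"
proof -
  interpret ainf_pair V "linpart m" W "linpart m'" by unfold_locales (rule ainf_str_linpart[OF str(1)] ainf_str_linpart[OF str(2)])+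
  note f' = mlin_linpart[OF V W f]
  have D0: "D (linpart f) w = 0" if "w \<in> words V" for w
    using linear_morphism[OF str f _ that] chain by (simp add: letter_chain_def)
  have "mor_defect_map (linpart m) (linpart m') (linpart f) x \<in> tensor_rel W"
    by (rule hom_elts_rel[OF tensor_homD(1)[OF hom_mor_defect_map[OF f']] _ x]) (rule mor_defect_map_vanishes[OF f' D0 _ lessI])
  then show ?thesis by (simp add: mor_defect_map_def)
qed

text \<open>Tensor powers of a homotopy equivalence are homotopy equivalences.\<close>

lemma tensor_power_homotopy:
  fixes V :: "('r::comm_ring_1, 'a::ab_group_add) dgmod" and W :: "('r, 'b::ab_group_add) dgmod"
  assumes str: "ainf_str V m" "ainf_str W m'" and f: "mlin V W 0 f" "letter_chain V m m' f"
    and g: "mlin W V 0 g" "letter_chain W m' m g"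
    and k: "mlin V V 1 k" "letter_homotopy V m m (\<lambda>n a. a) (\<lambda>n a. g [(n, f [(n, a)])]) k"
  shows "\<exists>K. tensor_hom V V 1 K \<and> (\<forall>x\<in>tensor_elts V. mor_lift (linpart g) (mor_lift (linpart f) x) -
     (x + der_lift (linpart m) (K x) + K (der_lift (linpart m) x)) \<in> tensor_rel V)"
proof (intro exI conjI ballI)
  have V: "graded_module V" and W: "graded_module W" and m: "mlin V V (-1) m" using str by (auto simp: ainf_str_def)
  note f' = mlin_linpart[OF V W f(1)] and g' = mlin_linpart[OF W V g(1)]
  define p where "p = precomp V (linpart g) (mor_lift (linpart f))"
  have p: "mlin V V 0 p" unfolding p_def by (rule mlin_precomp[OF V W V g' tensor_hom_mor_lift[OF V W f']]) simp
  have pl: "linpart p = p"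
    by (rule ext) (simp add: linpart_def[of p], simp add: p_def precomp_def ev_linpart_zero[OF gm_module[OF V] mor_lift_linpart])
  have pa: "p [(n, a)] = g [(n, f [(n, a)])]" for n a
    by (simp add: p_def precomp_def lifts_letter ev_letter_of[OF W V g'])
  have part: "f [(n, a)] \<in> part W n" "m [(n, a)] \<in> part V (n - 1)" if "a \<in> part V n" for n a
    using mlin_in[OF f(1), of "[(n, a)]"] mlin_in[OF m, of "[(n, a)]"] that by (simp_all add: words_Cons)
  let ?K = "htp_lift id_fam (linpart p) (linpart k) :: ('a word \<Rightarrow>\<^sub>0 'r) \<Rightarrow> _"
  show "tensor_hom V V 1 ?K"
    using tensor_hom_htp_lift[OF V V mlin_id_fam[OF V] mlin_linpart[OF V V p] mlin_linpart[OF V V k(1)]] .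
  fix x assume x: "x \<in> tensor_elts V"
  have "mor_lift (linpart p) x - x - der_lift (linpart m) (?K x) - ?K (der_lift (linpart m) x) \<in> tensor_rel V"
  proof (rule tensor_homotopy[OF str(1) p k(1) _ _ x])
    fix n a assume a: "a \<in> part V n"
    show "m [(n, p [(n, a)])] = p [(n - 1, m [(n, a)])]"
      using f(2) g(2) part a by (simp add: pa letter_chain_def)
    show "p [(n, a)] - a = m [(n + 1, k [(n, a)])] + k [(n - 1, m [(n, a)])]"
      using k(2) a by (simp add: pa letter_homotopy_def)
  qed
  from free.subspace_add[OF subspace_rel mor_lift_comp[OF V W V f' g' x] this]
  show "mor_lift (linpart g) (mor_lift (linpart f) x) - (x + der_lift (linpart m) (?K x) + ?K (der_lift (linpart m) x)) \<in> tensor_rel V"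
    by (simp add: p_def[symmetric] pl algebra_simps)
qed

section \<open>Solutions of the obstruction equations\<close>

text \<open>
  A formula for the composite of \<open>f\<close> with a family on words extends linearly; this
  holds only on homogeneous elements, as \<open>f\<close> is additive only on letters of a common
  degree.
\<close>

lemma post_ext:
  assumes U: "graded_module U" and V: "graded_module V" and W: "graded_module W"
    and f: "mlin V W k f" and G: "mlin U V e G" and R: "module_hom fscale (scl W) R"
    and eq: "\<And>w. w \<in> words U \<Longrightarrow> f [(deg w + e, G w)] = R (sng w)" and x: "x \<in> tensor_elts_deg U d"
    and d: "c = d + e"
  shows "f [(c, ev (scl V) G x)] = R x"
proof -
  have "ev (scl W) (post e f G) x = R x"
    by (rule hom_eq_supp[OF ev_hom R _ elts_degD[OF x, unfolded elts_supp]])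
      (auto simp: gm_module[OF W] ev_sng[OF gm_module[OF W]] post_def eq)
  then show ?thesis using ev_post[OF U V W f G x] d by simp
qed

text \<open>
  The pair \<open>(D, E)\<close> is a cycle in the cone of precomposition with the tensor powers
  \<open>\<Phi>\<close> of \<open>f\<close>. Let \<open>\<Gamma>\<close>, \<open>K\<close>,
  \<open>L\<close> be the tensor powers of \<open>g\<close> and the homotopies for
  \<open>\<Phi>\<Gamma>\<close> and \<open>\<Gamma>\<Phi>\<close>. Then \<open>x\<^sub>0 = -
  E\<Gamma> - DK\<close> bounds \<open>- D\<close>, and \<open>z = E + x\<^sub>0\<Phi>\<close> is a
  cycle. Replacing \<open>x\<^sub>0\<close> by \<open>x = x\<^sub>0 - z\<Gamma>\<close> changes
  \<open>z\<close> to \<open>z - z\<Gamma>\<Phi>\<close>, which is the boundary of \<open>y = -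
  zL\<close>.
\<close>

lemma extension_solution:
  fixes U :: "('r::comm_ring_1, 'a::ab_group_add) dgmod" and V :: "('r, 'b::ab_group_add) dgmod" and W :: "('r, 'c::ab_group_add) dgmod"
  assumes str: "ainf_str U mU" "ainf_str V mV" "ainf_str W mW"
    and equiv: "letter_equivalence U mU V mV f g l k"
    and D: "mlin V W (-1) D" and E: "mlin U W 0 E"
    and cycD: "\<And>w. w \<in> words V \<Longrightarrow> mW [(deg w - 1, D w)] = - ev (scl W) D (der_lift (linpart mV) (sng w))"
    and cycE: "\<And>w. w \<in> words U \<Longrightarrow> mW [(deg w, E w)] =
      ev (scl W) E (der_lift (linpart mU) (sng w)) + ev (scl W) D (mor_lift (linpart f) (sng w))"
  shows "\<exists>x y. mlin V W 0 x \<and> mlin U W 1 y \<and>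
    (\<forall>w\<in>words V. D w + mW [(deg w, x w)] - ev (scl W) x (der_lift (linpart mV) (sng w)) = 0) \<and>
    (\<forall>w\<in>words U. E w + ev (scl W) x (mor_lift (linpart f) (sng w)) - mW [(deg w + 1, y w)]
        - ev (scl W) y (der_lift (linpart mU) (sng w)) = 0)"
proof -
  have U: "graded_module U" and V: "graded_module V" and W: "graded_module W"
    and mU: "mlin U U (-1) mU" and mV: "mlin V V (-1) mV" and mW: "mlin W W (-1) mW" using str by (auto simp: ainf_str_def)
  have f: "mlin U V 0 f" "letter_chain U mU mV f" and g: "mlin V U 0 g" "letter_chain V mV mU g"
    and l: "mlin U U 1 l" "letter_homotopy U mU mU (\<lambda>n a. a) (\<lambda>n a. g [(n, f [(n, a)])]) l"
    and k: "mlin V V 1 k" "letter_homotopy V mV mV (\<lambda>n a. a) (\<lambda>n a. f [(n, g [(n, a)])]) k"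
    using equiv by (auto simp: letter_equivalence_def)
  let ?ev = "ev (scl W)"
  let ?dU = "der_lift (linpart mU) :: ('a word \<Rightarrow>\<^sub>0 'r) \<Rightarrow> _" and ?dV = "der_lift (linpart mV) :: ('b word \<Rightarrow>\<^sub>0 'r) \<Rightarrow> _"
  let ?F = "mor_lift (linpart f) :: ('a word \<Rightarrow>\<^sub>0 'r) \<Rightarrow> ('b word \<Rightarrow>\<^sub>0 'r)"
  let ?G = "mor_lift (linpart g) :: ('b word \<Rightarrow>\<^sub>0 'r) \<Rightarrow> ('a word \<Rightarrow>\<^sub>0 'r)"
  obtain L where L: "tensor_hom U U 1 L" and LU: "\<And>x. x \<in> tensor_elts U \<Longrightarrow> ?G (?F x) - (x + ?dU (L x) + L (?dU x)) \<in> tensor_rel U"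
    using tensor_power_homotopy[OF str(1,2) f g l] by blast
  obtain K where K: "tensor_hom V V 1 K" and KV: "\<And>x. x \<in> tensor_elts V \<Longrightarrow> ?F (?G x) - (x + ?dV (K x) + K (?dV x)) \<in> tensor_rel V"
    using tensor_power_homotopy[OF str(2,1) g f k] by blast
  note hF = tensor_hom_mor_lift[OF U V mlin_linpart[OF U V f(1)]] and hG = tensor_hom_mor_lift[OF V U mlin_linpart[OF V U g(1)]]
   and hU = tensor_hom_der_lift[OF U mlin_linpart[OF U U mU]] and hV = tensor_hom_der_lift[OF V mlin_linpart[OF V V mV]]
  note Fc = mor_lift_linpart_commutes[OF str(1,2) f] and Gc = mor_lift_linpart_commutes[OF str(2,1) g]
  note ev_W = ev_hom[OF gm_module[OF W]]
  note evs = module_hom.add[OF ev_W] module_hom.diff[OF ev_W] module_hom.neg[OF ev_W] ev_sng[OF gm_module[OF W]]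
  have bdE: "mW [(d, ?ev E x)] = ?ev E (?dU x) + ?ev D (?F x)" if "x \<in> tensor_elts_deg U d" for x d
    by (rule post_ext[OF U W W mW E _ _ that, where R="\<lambda>x. ?ev E (?dU x) + ?ev D (?F x)"])
      (auto simp: cycE intro!: hom_add hom_comp[OF lin_lifts(3) ev_W] hom_comp[OF lin_lifts(1) ev_W])
  have bdD: "mW [(c, ?ev D x)] = - ?ev D (?dV x)" if "x \<in> tensor_elts_deg V d" "c = d + -1" for x d c
    by (rule post_ext[OF V W W mW D _ _ that, where R="\<lambda>x. - ?ev D (?dV x)"])
      (auto simp: cycD intro!: hom_neg hom_comp[OF lin_lifts(3) ev_W])
  \<comment> \<open>\<open>x0\<close> bounds \<open>- D\<close>\<close>
  define x0 where "x0 w = - ?ev E (?G (sng w)) - ?ev D (K (sng w))" for w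
  have x0_alt: "x0 = (\<lambda>w. - precomp W E ?G w - precomp W D K w)" by (simp add: x0_def precomp_def fun_eq_iff)
  have ev_x0: "?ev x0 x = - ?ev E (?G x) - ?ev D (K x)" for x
    unfolding x0_alt by (simp add: ev_diff_fam[OF gm_module[OF W]] ev_neg_fam[OF gm_module[OF W]] ev_precomp[OF W lin_lifts(1)] ev_precomp[OF W tensor_homD(1)[OF K]])
  have m_x0: "mlin V W 0 x0" unfolding x0_alt
    by (intro mlin_diff[OF V W] mlin_neg[OF V W] mlin_precomp[OF V U W E hG] mlin_precomp[OF V V W D K]) auto
  have bd_x0: "mW [(deg w, x0 w)] = ?ev x0 (?dV (sng w)) - D w" if w: "w \<in> words V" for w
  proof -
    note s = sng_elts[OF w]
    have 1: "?G (sng w) \<in> tensor_elts_deg U (deg w)" "K (sng w) \<in> tensor_elts_deg V (deg w + 1)"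
      using tensor_homD(2)[OF hG s(1)] tensor_homD(2)[OF K s(1)] by simp_all
    have 2: "?ev E (?G (sng w)) \<in> part W (deg w)" "?ev D (K (sng w)) \<in> part W (deg w)"
      using ev_mlin_in[OF W E 1(1)] ev_mlin_in[OF W D 1(2)] by simp_all
    have "mW [(deg w, x0 w)] = mW [(deg w, - (?ev E (?G (sng w)) + ?ev D (K (sng w))))]" by (simp add: x0_def)
    also have "\<dots> = - (mW [(deg w, ?ev E (?G (sng w)))] + mW [(deg w, ?ev D (K (sng w)))])"
      using letter_neg[OF W W mW module.subspace_add[OF gm_module[OF W] gm_part[OF W] 2]] letter_add[OF W W mW 2] by simp
    also have "\<dots> = - ?ev E (?dU (?G (sng w))) - ?ev D (?F (?G (sng w))) + ?ev D (?dV (K (sng w)))"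
      using bdE[OF 1(1)] bdD[OF 1(2), of "deg w"] by simp
    also have "?ev D (?F (?G (sng w))) = D w + ?ev D (?dV (K (sng w))) + ?ev D (K (?dV (sng w)))"
      using ev_eqv[OF V W D KV[OF s(2)]] by (simp add: evs)
    also have "?ev E (?dU (?G (sng w))) = ?ev E (?G (?dV (sng w)))"
      by (rule ev_eqv[OF U W E Gc[OF s(2)]])
    finally show ?thesis by (simp add: ev_x0)
  qed
  \<comment> \<open>the remaining failure of the second equation, a cycle\<close>
  define z where "z w = E w + ?ev x0 (?F (sng w))" for w
  have z_alt: "z = (\<lambda>w. E w + precomp W x0 ?F w)" by (simp add: z_def precomp_def fun_eq_iff)
  have ev_z: "?ev z x = ?ev E x + ?ev x0 (?F x)" for x
    unfolding z_alt by (simp add: ev_add_fam[OF gm_module[OF W]] ev_precomp[OF W lin_lifts(1)])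
  have m_z: "mlin U W 0 z" unfolding z_alt
    by (intro mlin_add[OF U W] E mlin_precomp[OF U V W m_x0 hF]) auto
  have bdx0: "mW [(d, ?ev x0 x)] = ?ev x0 (?dV x) - ?ev D x" if "x \<in> tensor_elts_deg V d" for x d
    by (rule post_ext[OF V W W mW m_x0 _ _ that, where R="\<lambda>x. ?ev x0 (?dV x) - ?ev D x"])
      (auto simp: bd_x0 evs intro!: hom_diff ev_W hom_comp[OF lin_lifts(3) ev_W])
  have bd_z: "mW [(deg w, z w)] = ?ev z (?dU (sng w))" if w: "w \<in> words U" for w
  proof -
    note s = sng_elts[OF w]
    have 1: "?F (sng w) \<in> tensor_elts_deg V (deg w)" using tensor_homD(2)[OF hF s(1)] by simp
    have "?ev x0 (?F (sng w)) \<in> part W (deg w)" "E w \<in> part W (deg w)"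
      using ev_mlin_in[OF W m_x0 1] mlin_in[OF E w] by simp_all
    then have "mW [(deg w, z w)] = mW [(deg w, E w)] + mW [(deg w, ?ev x0 (?F (sng w)))]"
      unfolding z_def by (intro letter_add[OF W W mW])
    also have "\<dots> = ?ev E (?dU (sng w)) + ?ev x0 (?dV (?F (sng w)))"
      by (simp add: cycE[OF w] bdx0[OF 1])
    also have "?ev x0 (?dV (?F (sng w))) = ?ev x0 (?F (?dU (sng w)))"
      by (rule ev_eqv[OF V W m_x0 Fc[OF s(2)]])
    finally show ?thesis by (simp add: ev_z)
  qed
  have bdz: "mW [(d, ?ev z x)] = ?ev z (?dU x)" if "x \<in> tensor_elts_deg U d" for x d
    by (rule post_ext[OF U W W mW m_z _ _ that, where R="\<lambda>x. ?ev z (?dU x)"])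
      (auto simp: bd_z evs intro!: hom_comp[OF lin_lifts(3) ev_W])
  \<comment> \<open>a correction by the cycle \<open>z\<Gamma>\<close> keeps the first equation and makes the second one solvable\<close>
  define x where "x w = x0 w - ?ev z (?G (sng w))" for w
  have x_alt: "x = (\<lambda>w. x0 w - precomp W z ?G w)" by (simp add: x_def precomp_def fun_eq_iff)
  have ev_x: "?ev x y = ?ev x0 y - ?ev z (?G y)" for y
    unfolding x_alt by (simp add: ev_diff_fam[OF gm_module[OF W]] ev_precomp[OF W lin_lifts(1)])
  have m_x: "mlin V W 0 x" unfolding x_alt
    by (intro mlin_diff[OF V W] m_x0 mlin_precomp[OF V U W m_z hG]) auto
  define y where "y w = - ?ev z (L (sng w))" for w
  have y_alt: "y = (\<lambda>w. - precomp W z L w)" by (simp add: y_def precomp_def fun_eq_iff)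
  have ev_y: "?ev y v = - ?ev z (L v)" for v
    unfolding y_alt by (simp add: ev_neg_fam[OF gm_module[OF W]] ev_precomp[OF W tensor_homD(1)[OF L]])
  have m_y: "mlin U W 1 y" unfolding y_alt
    by (intro mlin_neg[OF U W] mlin_precomp[OF U U W m_z L]) auto
  have "D w + mW [(deg w, x w)] - ?ev x (?dV (sng w)) = 0" if w: "w \<in> words V" for w
  proof -
    note s = sng_elts[OF w]
    have 1: "?G (sng w) \<in> tensor_elts_deg U (deg w)" using tensor_homD(2)[OF hG s(1)] by simp
    have "?ev z (?G (sng w)) \<in> part W (deg w)" "x0 w \<in> part W (deg w)"
      using ev_mlin_in[OF W m_z 1] mlin_in[OF m_x0 w] by simp_all
    then have "mW [(deg w, x w)] = mW [(deg w, x0 w)] - mW [(deg w, ?ev z (?G (sng w)))]"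
      unfolding x_def by (intro letter_minus[OF W W mW])
    also have "\<dots> = ?ev x0 (?dV (sng w)) - D w - ?ev z (?dU (?G (sng w)))" by (simp add: bd_x0[OF w] bdz[OF 1])
    also have "?ev z (?dU (?G (sng w))) = ?ev z (?G (?dV (sng w)))"
      by (rule ev_eqv[OF U W m_z Gc[OF s(2)]])
    finally show ?thesis by (simp add: ev_x)
  qed
  moreover have "E w + ?ev x (?F (sng w)) - mW [(deg w + 1, y w)] - ?ev y (?dU (sng w)) = 0" if w: "w \<in> words U" for w
  proof -
    note s = sng_elts[OF w]
    have 1: "L (sng w) \<in> tensor_elts_deg U (deg w + 1)" by (rule tensor_homD(2)[OF L s(1)])
    have "?ev z (L (sng w)) \<in> part W (deg w + 1)" using ev_mlin_in[OF W m_z 1] by simp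
    then have "mW [(deg w + 1, y w)] = - ?ev z (?dU (L (sng w)))"
      unfolding y_def by (simp add: letter_neg[OF W W mW] bdz[OF 1])
    moreover have "?ev z (?G (?F (sng w))) = z w + ?ev z (?dU (L (sng w))) + ?ev z (L (?dU (sng w)))"
      using ev_eqv[OF U W m_z LU[OF s(2)]] by (simp add: evs)
    ultimately show ?thesis by (simp add: ev_x ev_y z_def)
  qed
  ultimately show ?thesis using m_x m_y by blast
qed

text \<open>
  The mirror image of \<open>extension_solution\<close> for postcomposition with \<open>f\<close>:
  \<open>x\<^sub>0 = kD - gE\<close> bounds \<open>- D\<close>, \<open>z = E + f x\<^sub>0\<close>
  is a cycle, \<open>x = x\<^sub>0 - g z\<close>, and \<open>z - f g z\<close> is bounded by
  \<open>- y\<close> for \<open>y = l z\<close>. Here \<open>E\<close> is the negative of the defect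
  of the homotopy.
\<close>

lemma lifting_solution:
  fixes U :: "('r::comm_ring_1, 'a::ab_group_add) dgmod" and V :: "('r, 'b::ab_group_add) dgmod" and W :: "('r, 'c::ab_group_add) dgmod"
  assumes str: "ainf_str U mU" "ainf_str V mV" "ainf_str W mW"
    and equiv: "letter_equivalence V mV W mW f g k l"
    and D: "mlin U V (-1) D" and E: "mlin U W 0 E"
    and cycD: "\<And>w. w \<in> words U \<Longrightarrow> mV [(deg w - 1, D w)] = - ev (scl V) D (der_lift (linpart mU) (sng w))"
    and cycE: "\<And>w. w \<in> words U \<Longrightarrow> mW [(deg w, E w)] =
      ev (scl W) E (der_lift (linpart mU) (sng w)) + f [(deg w - 1, D w)]"
  shows "\<exists>x y. mlin U V 0 x \<and> mlin U W 1 y \<and>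
    (\<forall>w\<in>words U. D w + mV [(deg w, x w)] - ev (scl V) x (der_lift (linpart mU) (sng w)) = 0) \<and>
    (\<forall>w\<in>words U. E w + f [(deg w, x w)] + mW [(deg w + 1, y w)]
        + ev (scl W) y (der_lift (linpart mU) (sng w)) = 0)"
proof -
  have U: "graded_module U" and V: "graded_module V" and W: "graded_module W"
    and mU: "mlin U U (-1) mU" and mV: "mlin V V (-1) mV" and mW: "mlin W W (-1) mW" using str by (auto simp: ainf_str_def)
  have f: "mlin V W 0 f" "letter_chain V mV mW f" and g: "mlin W V 0 g" "letter_chain W mW mV g"
    and k: "mlin V V 1 k" "letter_homotopy V mV mV (\<lambda>n a. a) (\<lambda>n a. g [(n, f [(n, a)])]) k"
    and l: "mlin W W 1 l" "letter_homotopy W mW mW (\<lambda>n a. a) (\<lambda>n a. f [(n, g [(n, a)])]) l"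
    using equiv by (auto simp: letter_equivalence_def)
  let ?d = "\<lambda>w. der_lift (linpart mU) (sng w) :: 'a word \<Rightarrow>\<^sub>0 'r"
  have hd: "?d w \<in> tensor_elts_deg U (deg w - 1)" if "w \<in> words U" for w
    using tensor_homD(2)[OF tensor_hom_der_lift[OF U mlin_linpart[OF U U mU]] sng_elts(1)[OF that]] by simp
  have inV: "h [(n, a)] \<in> part V (n + e)" if "mlin V V e h" "a \<in> part V n" for h e n a
    using mlin_in[OF that(1), of "[(n, a)]"] that(2) by (simp add: words_Cons)
  have Din: "D w \<in> part V (deg w - 1)" and Ein: "E w \<in> part W (deg w)" if "w \<in> words U" for w
    using mlin_in[OF D that] mlin_in[OF E that] by simp_all
  have gin: "g [(n, b)] \<in> part V n" if "b \<in> part W n" for n b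
    using mlin_in[OF g(1), of "[(n, b)]"] that by (simp add: words_Cons)
  have fin: "f [(n, b)] \<in> part W n" if "b \<in> part V n" for n b
    using mlin_in[OF f(1), of "[(n, b)]"] that by (simp add: words_Cons)
  have kin: "k [(n, b)] \<in> part V (n + 1)" and mVin: "mV [(n, b)] \<in> part V (n - 1)" if "b \<in> part V n" for n b
    using mlin_in[OF k(1), of "[(n, b)]"] mlin_in[OF mV, of "[(n, b)]"] that by (simp_all add: words_Cons)
  have l_in: "l [(n, b)] \<in> part W (n + 1)" and mWin: "mW [(n, b)] \<in> part W (n - 1)" if "b \<in> part W n" for n b
    using mlin_in[OF l(1), of "[(n, b)]"] mlin_in[OF mW, of "[(n, b)]"] that by (simp_all add: words_Cons)
  \<comment> \<open>\<open>x0\<close> bounds \<open>- D\<close>\<close>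
  define x0 where "x0 w = k [(deg w - 1, D w)] - g [(deg w, E w)]" for w
  have x0_alt: "x0 = (\<lambda>w. post (-1) k D w - post 0 g E w)" by (simp add: x0_def post_def fun_eq_iff)
  have m_x0: "mlin U V 0 x0" unfolding x0_alt
    by (intro mlin_diff[OF U V] mlin_post[OF U V V k(1) D] mlin_post[OF U W V g(1) E]) auto
  have ev_x0: "ev (scl V) x0 (?d w) = k [(deg w - 2, ev (scl V) D (?d w))] - g [(deg w - 1, ev (scl W) E (?d w))]" if "w \<in> words U" for w
    unfolding x0_alt by (simp add: ev_diff_fam[OF gm_module[OF V]] ev_post[OF U V V k(1) D hd[OF that]] ev_post[OF U W V g(1) E hd[OF that]])
  have evD: "ev (scl V) D (?d w) \<in> part V (deg w - 2)" and evE: "ev (scl W) E (?d w) \<in> part W (deg w - 1)" if "w \<in> words U" for w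
    using ev_mlin_in[OF V D hd[OF that]] ev_mlin_in[OF W E hd[OF that]] by simp_all
  have bd_x0: "mV [(deg w, x0 w)] = ev (scl V) x0 (?d w) - D w" if w: "w \<in> words U" for w
  proof -
    have 1: "k [(deg w - 1, D w)] \<in> part V (deg w)" using kin[OF Din[OF w]] by simp
    have "mV [(deg w, x0 w)] = mV [(deg w, k [(deg w - 1, D w)])] - mV [(deg w, g [(deg w, E w)])]"
      unfolding x0_def by (rule letter_minus[OF V V mV 1 gin[OF Ein[OF w]]])
    also have "mV [(deg w, g [(deg w, E w)])] = g [(deg w - 1, mW [(deg w, E w)])]"
      using g(2) Ein[OF w] by (simp add: letter_chain_def)
    also have "\<dots> = g [(deg w - 1, ev (scl W) E (?d w))] + g [(deg w - 1, f [(deg w - 1, D w)])]"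
      unfolding cycE[OF w] by (rule letter_add[OF W V g(1) evE[OF w] fin[OF Din[OF w]]])
    also have "g [(deg w - 1, f [(deg w - 1, D w)])] = D w + mV [(deg w, k [(deg w - 1, D w)])] + k [(deg w - 2, mV [(deg w - 1, D w)])]"
    proof -
      have "g [(deg w - 1, f [(deg w - 1, D w)])] - D w =
          mV [(deg w - 1 + 1, k [(deg w - 1, D w)])] + k [(deg w - 1 - 1, mV [(deg w - 1, D w)])]"
        using k(2) Din[OF w] unfolding letter_homotopy_def by blast
      then show ?thesis by (simp add: algebra_simps)
    qed
    also have "k [(deg w - 2, mV [(deg w - 1, D w)])] = - k [(deg w - 2, ev (scl V) D (?d w))]"
      unfolding cycD[OF w] by (rule letter_neg[OF V V k(1) evD[OF w]])
    finally show ?thesis by (simp add: ev_x0[OF w])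
  qed
  \<comment> \<open>the remaining failure of the second equation, a cycle\<close>
  define z where "z w = E w + f [(deg w, x0 w)]" for w
  have z_alt: "z = (\<lambda>w. E w + post 0 f x0 w)" by (simp add: z_def post_def fun_eq_iff)
  have m_z: "mlin U W 0 z" unfolding z_alt
    by (intro mlin_add[OF U W] E mlin_post[OF U V W f(1) m_x0]) auto
  have x0in: "x0 w \<in> part V (deg w)" and zin: "z w \<in> part W (deg w)" if "w \<in> words U" for w
    using mlin_in[OF m_x0 that] mlin_in[OF m_z that] by simp_all
  have evx0: "ev (scl V) x0 (?d w) \<in> part V (deg w - 1)" and evz: "ev (scl W) z (?d w) \<in> part W (deg w - 1)" if "w \<in> words U" for w
    using ev_mlin_in[OF V m_x0 hd[OF that]] ev_mlin_in[OF W m_z hd[OF that]] by simp_all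
  have ev_z: "ev (scl W) z (?d w) = ev (scl W) E (?d w) + f [(deg w - 1, ev (scl V) x0 (?d w))]" if "w \<in> words U" for w
    unfolding z_alt by (simp add: ev_add_fam[OF gm_module[OF W]] ev_post[OF U V W f(1) m_x0 hd[OF that]])
  have bd_z: "mW [(deg w, z w)] = ev (scl W) z (?d w)" if w: "w \<in> words U" for w
  proof -
    have "mW [(deg w, z w)] = mW [(deg w, E w)] + mW [(deg w, f [(deg w, x0 w)])]"
      unfolding z_def by (rule letter_add[OF W W mW Ein[OF w] fin[OF x0in[OF w]]])
    also have "mW [(deg w, f [(deg w, x0 w)])] = f [(deg w - 1, mV [(deg w, x0 w)])]"
      using f(2) x0in[OF w] by (simp add: letter_chain_def)
    also have "\<dots> = f [(deg w - 1, ev (scl V) x0 (?d w))] - f [(deg w - 1, D w)]"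
      unfolding bd_x0[OF w] by (rule letter_minus[OF V W f(1) evx0[OF w] Din[OF w]])
    finally show ?thesis by (simp add: cycE[OF w] ev_z[OF w])
  qed
  \<comment> \<open>a correction by the cycle \<open>g z\<close>\<close>
  define x where "x w = x0 w - g [(deg w, z w)]" for w
  have x_alt: "x = (\<lambda>w. x0 w - post 0 g z w)" by (simp add: x_def post_def fun_eq_iff)
  have m_x: "mlin U V 0 x" unfolding x_alt
    by (intro mlin_diff[OF U V] m_x0 mlin_post[OF U W V g(1) m_z]) auto
  define y where "y w = l [(deg w, z w)]" for w
  have y_alt: "y = post 0 l z" by (simp add: y_def post_def fun_eq_iff)
  have m_y: "mlin U W 1 y" unfolding y_alt by (rule mlin_post[OF U W W l(1) m_z]) simp
  have "D w + mV [(deg w, x w)] - ev (scl V) x (?d w) = 0" if w: "w \<in> words U" for w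
  proof -
    have "mV [(deg w, x w)] = mV [(deg w, x0 w)] - mV [(deg w, g [(deg w, z w)])]"
      unfolding x_def by (rule letter_minus[OF V V mV x0in[OF w] gin[OF zin[OF w]]])
    also have "mV [(deg w, g [(deg w, z w)])] = g [(deg w - 1, ev (scl W) z (?d w))]"
      using g(2) zin[OF w] by (simp add: letter_chain_def bd_z[OF w])
    finally show ?thesis unfolding x_alt
      by (simp add: ev_diff_fam[OF gm_module[OF V]] ev_post[OF U W V g(1) m_z hd[OF w]] bd_x0[OF w])
  qed
  moreover have "E w + f [(deg w, x w)] + mW [(deg w + 1, y w)] + ev (scl W) y (?d w) = 0" if w: "w \<in> words U" for w
  proof -
    have "f [(deg w, x w)] = f [(deg w, x0 w)] - f [(deg w, g [(deg w, z w)])]"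
      unfolding x_def by (rule letter_minus[OF V W f(1) x0in[OF w] gin[OF zin[OF w]]])
    moreover have "f [(deg w, g [(deg w, z w)])] - z w = mW [(deg w + 1, y w)] + l [(deg w - 1, ev (scl W) z (?d w))]"
      using l(2) zin[OF w] by (simp add: letter_homotopy_def y_def bd_z[OF w, symmetric])
    moreover have "ev (scl W) y (?d w) = l [(deg w - 1, ev (scl W) z (?d w))]"
      by (simp add: y_alt ev_post[OF U W W l(1) m_z hd[OF w]])
    ultimately show ?thesis by (simp add: z_def algebra_simps)
  qed
  ultimately show ?thesis using m_x m_y by blast
qed


section \<open>Extension and lifting of morphisms\<close>

text \<open>Truncation to one arity. An obstruction is only known to be a cycle in its own arity.\<close>

definition at_len :: "nat \<Rightarrow> ('a word \<Rightarrow> 'x::zero) \<Rightarrow> 'a word \<Rightarrow> 'x" where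
  "at_len M f w = (if length w = M then f w else 0)"

lemma mlin_at_len: "graded_module V \<Longrightarrow> graded_module W \<Longrightarrow> mlin V W e f \<Longrightarrow> mlin V W e (at_len M f)"
  unfolding at_len_def[abs_def] by (rule mlin_if[where P="\<lambda>n. n = M"]) (auto intro: mlin_zero)

lemma supp_Int: "x \<in> supp S \<Longrightarrow> x \<in> supp T \<Longrightarrow> x \<in> supp (S \<inter> T)"
  by (auto simp: supp_def)

lemma ev_at_len_top:
  assumes s: "module s" and x: "x \<in> tensor_elts V" "x \<in> supp (maxlen M)" "x - x1 \<in> supp {v. length v < M}"
    and f: "\<And>u. u \<in> words V \<Longrightarrow> length u < M \<Longrightarrow> f u = 0"
  shows "ev s f x = ev s (at_len M f) x1"
proof -
  have "ev s f x = ev s (at_len M f) x"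
    by (rule ev_cong[OF supp_Int[OF x(1)[unfolded elts_supp] x(2)]]) (auto simp: at_len_def f)
  moreover have "ev s (at_len M f) (x - x1) = 0"
    by (rule ev_zero[OF s x(3)]) (auto simp: at_len_def)
  ultimately show ?thesis by (simp add: module_hom.diff[OF ev_hom[OF s]])
qed

lemma ev_at_len: "x \<in> supp (oflen M) \<Longrightarrow> ev s (at_len M f) x = ev s f x"
  by (erule ev_cong) (simp add: at_len_def)

lemma ev_at_len_other: "module s \<Longrightarrow> x \<in> supp (oflen n) \<Longrightarrow> n \<noteq> M \<Longrightarrow> ev s (at_len M f) x = 0"
  by (erule ev_zero, assumption) (simp add: at_len_def)

text \<open>
  A construction one arity at a time that never changes lower arities converges; the limit is read
  off on the diagonal.
\<close>

lemma length_induct_families: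
  fixes t1 :: "'a list \<Rightarrow> 'x" and h1 :: "'b list \<Rightarrow> 'y"
  assumes base: "P 1 t1 h1"
    and step: "\<And>N t h. 1 \<le> N \<Longrightarrow> P N t h \<Longrightarrow> \<exists>t' h'. P (Suc N) t' h' \<and>
      (\<forall>u. length u \<le> N \<longrightarrow> t' u = t u) \<and> (\<forall>u. length u \<le> N \<longrightarrow> h' u = h u)"
  shows "\<exists>t h. (\<forall>N\<ge>1. \<exists>t' h'. P N t' h' \<and> (\<forall>u. length u \<le> N \<longrightarrow> t' u = t u) \<and> (\<forall>u. length u \<le> N \<longrightarrow> h' u = h u)) \<and>
     (\<forall>u. length u \<le> 1 \<longrightarrow> t u = t1 u)"
proof -
  define Q where "Q n = (\<lambda>(t, h). P (Suc n) t h \<and> (n = 0 \<longrightarrow> t = t1 \<and> h = h1))" for n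
  have "\<exists>s. \<forall>n. Q n (s n) \<and> (case s n of (t, h) \<Rightarrow> case s (Suc n) of (t', h') \<Rightarrow>
     (\<forall>u. length u \<le> Suc n \<longrightarrow> t' u = t u) \<and> (\<forall>u. length u \<le> Suc n \<longrightarrow> h' u = h u))"
  proof (rule dependent_nat_choice)
    show "\<exists>x. Q 0 x" using base by (auto simp: Q_def)
    fix x n assume "Q n x"
    then show "\<exists>y. Q (Suc n) y \<and> (case x of (t, h) \<Rightarrow> case y of (t', h') \<Rightarrow>
     (\<forall>u. length u \<le> Suc n \<longrightarrow> t' u = t u) \<and> (\<forall>u. length u \<le> Suc n \<longrightarrow> h' u = h u))"
      using step[of "Suc n" "fst x" "snd x"] by (auto simp: Q_def split_beta)
  qed
  then obtain s where Q: "\<And>n. Q n (s n)"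
    and s1: "\<And>n u. length u \<le> Suc n \<Longrightarrow> fst (s (Suc n)) u = fst (s n) u"
    and s2: "\<And>n u. length u \<le> Suc n \<Longrightarrow> snd (s (Suc n)) u = snd (s n) u"
    by (auto simp: split_beta)
  have st1: "fst (s (k + n)) u = fst (s n) u" if "length u \<le> Suc n" for k n u
    using that by (induction k) (simp_all add: s1)
  have st2: "snd (s (k + n)) u = snd (s n) u" if "length u \<le> Suc n" for k n u
    using that by (induction k) (simp_all add: s2)
  \<comment> \<open>\<open>s n\<close> is the stage at which arities up to \<open>n + 1\<close> are final\<close>
  define t where "t u = fst (s (length u - 1)) u" for u
  define h where "h u = snd (s (length u - 1)) u" for u
  have t: "fst (s n) u = t u" if "length u \<le> Suc n" for n u
    using st1[of u "length u - 1" "n - (length u - 1)"] that by (simp add: t_def)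
  have h: "snd (s n) u = h u" if "length u \<le> Suc n" for n u
    using st2[of u "length u - 1" "n - (length u - 1)"] that by (simp add: h_def)
  show ?thesis
  proof (rule exI[of _ t], rule exI[of _ h], rule conjI; intro allI impI)
    fix N :: nat assume N: "1 \<le> N"
    have "P N (fst (s (N - 1))) (snd (s (N - 1)))" using Q[of "N - 1"] N by (simp add: Q_def split_beta)
    then show "\<exists>t' h'. P N t' h' \<and> (\<forall>u. length u \<le> N \<longrightarrow> t' u = t u) \<and> (\<forall>u. length u \<le> N \<longrightarrow> h' u = h u)"
      using t[of _ "N - 1"] h[of _ "N - 1"] N by (intro exI[of _ "fst (s (N - 1))"] exI[of _ "snd (s (N - 1))"]) auto
  next
    fix u :: "'a list" assume "length u \<le> 1"
    then show "t u = t1 u" using t[of u 0] Q[of 0] by (simp add: Q_def split_beta)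
  qed
qed

lemma mlin_limit:
  assumes V: "graded_module V" and W: "graded_module W"
    and lim: "\<And>N. 1 \<le> N \<Longrightarrow> \<exists>f. mlin V W e f \<and> (\<forall>u. length u \<le> N \<longrightarrow> f u = t u)"
  shows "mlin V W e t"
  unfolding mlin_iff[OF V W]
proof (intro conjI ballI allI impI)
  fix w assume w: "w \<in> words V"
  from lim[OF words_len[OF w]] obtain f where "mlin V W e f" "f w = t w" by blast
  then show "t w \<in> part W (deg w + e)" using mlin_in[of V W e f w] w by simp
next
  fix u n a c b v assume w: "u @ (n, a) # v \<in> words V" "b \<in> part V n"
  from lim[OF words_len[OF w(1)]] obtain f where f: "mlin V W e f" "\<And>x. length x \<le> length (u @ (n, a) # v) \<Longrightarrow> f x = t x" by blast
  from f(1) w have "f (u @ (n, a + scl V c b) # v) = f (u @ (n, a) # v) + scl W c (f (u @ (n, b) # v))"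
    unfolding mlin_iff[OF V W] by blast
  then show "t (u @ (n, a + scl V c b) # v) = t (u @ (n, a) # v) + scl W c (t (u @ (n, b) # v))"
    by (simp add: f(2))
qed

lemma precomp_local:
  assumes "\<And>u. length u \<le> length w \<Longrightarrow> t' u = t u"
  shows "precomp W t' (mor_lift F) w = precomp W t (mor_lift F) w"
  unfolding precomp_def by (rule ev_cong[OF mor_lift_upto]) (simp add: assms)

text \<open>
  Precomposition with a morphism: \<open>\<delta>\<tau>\<phi> - \<tau>\<phi>\<delta> =
  (\<delta>\<tau> - \<tau>\<delta>)\<phi>\<close>.
\<close>

lemma defect_precomp:
  fixes U :: "('r::comm_ring_1, 'a::ab_group_add) dgmod" and V :: "('r, 'b::ab_group_add) dgmod" and W :: "('r, 'c::ab_group_add) dgmod"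
  assumes str: "ainf_str U mU" "ainf_str V mV" "ainf_str W mW"
    and F0: "fam_morphism U mU V mV F"
    and t: "mlin V W 0 t" and w: "w \<in> words U"
  shows "mor_defect W mU mW (precomp W t (mor_lift F)) w = ev (scl W) (mor_defect W mV mW t) (mor_lift F (sng w))"
proof -
  note F = fam_morphismD[OF F0]
  interpret P: ainf_pair U mU V mV using str by unfold_locales
  interpret Q: ainf_pair V mV W mW using str by unfold_locales
  have "mor_defect_map mU mV F (sng w) \<in> tensor_rel V" by (rule P.mor_defect_map_vanishes[OF F(1) F(2) w lessI])
  then have "ev (scl W) t (der_lift mV (mor_lift F (sng w))) = ev (scl W) t (mor_lift F (der_lift mU (sng w)))"
    unfolding mor_defect_map_def by (rule ev_eqv[OF Q.V Q.W t])
  moreover have "ev (scl W) mW (mor_lift (precomp W t (mor_lift F)) (sng w)) = ev (scl W) mW (mor_lift t (mor_lift F (sng w)))"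
    by (rule ev_eqv[OF Q.W Q.W Q.m' mor_lift_comp[OF P.V P.W Q.W F(1) t sng_elts(2)[OF w]], symmetric])
  ultimately show ?thesis
    by (simp add: Q.ev_D mor_defect_def[of W mU] ev_precomp[OF Q.W lin_lifts(1)])
qed

text \<open>
  Postcomposition with a morphism: \<open>\<delta>\<phi>\<sigma> - \<phi>\<sigma>\<delta> =
  \<phi>(\<delta>\<sigma> - \<sigma>\<delta>)\<close>, and at the first length where the defect of
  \<open>\<sigma>\<close> may be nonzero it is a letter, to which only the linear part of
  \<open>\<phi>\<close> applies.
\<close>

lemma defect_postcomp:
  fixes U :: "('r::comm_ring_1, 'a::ab_group_add) dgmod" and V :: "('r, 'b::ab_group_add) dgmod" and W :: "('r, 'c::ab_group_add) dgmod"
  assumes str: "ainf_str U mU" "ainf_str V mV" "ainf_str W mW"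
    and F0: "fam_morphism V mV W mW F"
    and s: "mlin U V 0 s" and van: "\<And>u. u \<in> words U \<Longrightarrow> length u < N \<Longrightarrow> mor_defect V mU mV s u = 0"
    and w: "w \<in> words U" "length w \<le> N"
  shows "mor_defect W mU mW (precomp W F (mor_lift s)) w = F [(deg w - 1, mor_defect V mU mV s w)]"
proof -
  note F = fam_morphismD[OF F0]
  interpret P: ainf_pair U mU V mV using str by unfold_locales
  interpret Q: ainf_pair V mV W mW using str by unfold_locales
  note sw = sng_elts(2)[OF w(1)]
  have "ev (scl W) (mor_defect W mV mW F) (mor_lift s (sng w)) = 0"
    by (rule ev_zero[OF Q.W_mod tensor_hom_elts[OF tensor_hom_mor_lift[OF P.V P.W s] sw, unfolded elts_supp] F(2)])
  then have 1: "ev (scl W) mW (mor_lift F (mor_lift s (sng w))) = ev (scl W) F (der_lift mV (mor_lift s (sng w)))"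
    by (simp add: Q.ev_D)
  have 2: "ev (scl W) mW (mor_lift (precomp W F (mor_lift s)) (sng w)) = ev (scl W) mW (mor_lift F (mor_lift s (sng w)))"
    by (rule ev_eqv[OF Q.W Q.W Q.m' mor_lift_comp[OF P.V P.W Q.W s F(1) sw], symmetric])
  have "ev (scl W) F (mor_defect_map mU mV s (sng w)) = F [(deg w - 1, mor_defect V mU mV s w)]"
    using ev_eqv[OF Q.V Q.W F(1) P.mor_defect_map_leading[OF s van w]] by (simp add: ev_sng[OF Q.W_mod])
  with 1 2 show ?thesis
    by (simp add: mor_defect_def[of W mU] ev_precomp[OF Q.W lin_lifts(1)] mor_defect_map_def module_hom.diff[OF ev_hom[OF Q.W_mod]])
qed

context ainf_pair begin

lemma D_leading:
  assumes van: "\<And>u. u \<in> words V \<Longrightarrow> length u < M \<Longrightarrow> f u = 0" and w: "w \<in> words V" "length w = M"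
  shows "evW f (der_lift m (sng w)) = evW (at_len M f) (der_lift (linpart m) (sng w))"
proof (rule ev_at_len_top[OF W_mod tensor_hom_elts[OF tensor_hom_der_lift[OF V m] sng_elts(2)[OF w(1)]]])
  show "der_lift m (sng w) \<in> supp (maxlen M)" using der_lift_upto[of m w] w by simp
  show "der_lift m (sng w) - der_lift (linpart m) (sng w) \<in> supp {v. length v < M}" using der_lift_trunc[of m w] w by simp
qed (fact van)

end

text \<open>
  A chain map \<open>t\<^sub>1\<close> with \<open>t\<^sub>1 f\<close> homotopic to the linear part
  of \<open>G\<close> extends to a morphism \<open>t\<close> with \<open>tF\<close> homotopic to
  \<open>G\<close>, provided that the linear part \<open>f\<close> of \<open>F\<close> is a homotopy
  equivalence.
\<close>

lemma morphism_extension: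
  fixes U :: "('r::comm_ring_1, 'a::ab_group_add) dgmod" and V :: "('r, 'b::ab_group_add) dgmod" and W :: "('r, 'c::ab_group_add) dgmod"
  assumes str: "ainf_str U mU" "ainf_str V mV" "ainf_str W mW"
    and F0: "fam_morphism U mU V mV F"
    and G0: "fam_morphism U mU W mW G"
    and equiv: "letter_equivalence U mU V mV F g l k"
    and t1: "mlin V W 0 t1" "letter_chain V mV mW t1"
    and h1: "mlin U W 1 h1" "letter_homotopy U mU mW (\<lambda>n a. G [(n, a)]) (\<lambda>n a. t1 [(n, F [(n, a)])]) h1"
  shows "\<exists>t h. fam_morphism V mV W mW t \<and> mlin U W 1 h \<and>
     (\<forall>w\<in>words U. htp_defect W mU mW G (precomp W t (mor_lift F)) h w = 0) \<and> (\<forall>l. t [l] = t1 [l])"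
proof -
  note F = fam_morphismD[OF F0] and G = fam_morphismD[OF G0]
  interpret P: ainf_pair U mU V mV using str by unfold_locales
  interpret Q: ainf_pair V mV W mW using str by unfold_locales
  interpret T: ainf_pair U mU W mW using str by unfold_locales
  note U = P.V and V = P.W and W = Q.W and mod = Q.W_mod
  let ?c = "\<lambda>t. precomp W t (mor_lift F)"
  have mc: "mlin U W 0 (?c t)" if "mlin V W 0 t" for t
    by (rule mlin_precomp[OF U V W that tensor_hom_mor_lift[OF U V F(1)]]) simp
  define Inv where "Inv N t h \<longleftrightarrow> mlin V W 0 t \<and> mlin U W 1 h \<and> (\<forall>w\<in>words V. length w \<le> N \<longrightarrow> Q.D t w = 0) \<and>
     (\<forall>w\<in>words U. length w \<le> N \<longrightarrow> T.E G (?c t) h w = 0)" for N t h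
  have "\<exists>t h. (\<forall>N\<ge>1. \<exists>t' h'. Inv N t' h' \<and> (\<forall>u. length u \<le> N \<longrightarrow> t' u = t u) \<and> (\<forall>u. length u \<le> N \<longrightarrow> h' u = h u)) \<and>
     (\<forall>u. length u \<le> 1 \<longrightarrow> t u = t1 u)"
  proof (rule length_induct_families)
    have "Q.D t1 w = 0" if w: "w \<in> words V" "length w \<le> 1" for w
    proof -
      obtain n a where "w = [(n, a)]" "a \<in> part V n" using word_cases1[of w V] words_len[OF w(1)] w by force
      then show ?thesis using t1(2)
        by (simp add: mor_defect_def lifts_letter ev_letter_of[OF W W Q.m'] ev_letter_of[OF V W t1(1)] letter_chain_def)
    qed
    moreover have "T.E G (?c t1) h1 w = 0" if w: "w \<in> words U" "length w \<le> 1" for w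
    proof -
      obtain n a where "w = [(n, a)]" "a \<in> part U n" using word_cases1[of w U] words_len[OF w(1)] w by force
      then show ?thesis using h1(2)
        by (simp add: htp_defect_def precomp_def lifts_letter ev_letter_of[OF W W Q.m'] ev_letter_of[OF V W t1(1)] ev_letter_of[OF U W h1(1)] letter_homotopy_def)
    qed
    ultimately show "Inv 1 t1 h1" using t1(1) h1(1) by (simp add: Inv_def)
  next
    fix N t h assume "1 \<le> N" and "Inv N t h"
    then have t: "mlin V W 0 t" and h: "mlin U W 1 h" and Dt: "\<And>w. w \<in> words V \<Longrightarrow> length w < Suc N \<Longrightarrow> Q.D t w = 0"
      and Eh: "\<And>w. w \<in> words U \<Longrightarrow> length w < Suc N \<Longrightarrow> T.E G (?c t) h w = 0"
      by (auto simp: Inv_def)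
    let ?M = "Suc N"
    \<comment> \<open>the obstructions in the next arity, a cycle in the cone\<close>
    define DD where "DD = at_len ?M (Q.D t)"
    define EE where "EE = at_len ?M (T.E G (?c t) h)"
    have mD: "mlin V W (-1) DD" unfolding DD_def by (rule mlin_at_len[OF V W Q.mlin_D[OF t]])
    have mE: "mlin U W 0 EE" unfolding EE_def by (rule mlin_at_len[OF U W T.mlin_E[OF G(1) mc[OF t] h]])
    have Dc: "T.D (?c t) w = ev (scl W) (Q.D t) (mor_lift F (sng w))" if "w \<in> words U" for w
      by (rule defect_precomp[OF str F0 t that])
    have Fhom: "mor_lift F (sng w) \<in> tensor_elts V" if "w \<in> words U" for w
      by (rule tensor_hom_elts[OF tensor_hom_mor_lift[OF U V F(1)] sng_elts(2)[OF that]])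
    have Dc_small: "T.D (?c t) w = 0" if "w \<in> words U" "length w < ?M" for w
    proof -
      have "(mor_lift F (sng w) :: _ \<Rightarrow>\<^sub>0 'r) \<in> supp (words V \<inter> maxlen (length w))"
        using supp_Int[OF Fhom[OF that(1), unfolded elts_supp] mor_lift_upto] .
      from ev_zero[OF mod this, of "Q.D t"] Dt that show ?thesis by (simp add: Dc)
    qed
    have "mW [(deg w - 1, DD w)] = - ev (scl W) DD (der_lift (linpart mV) (sng w))" if w: "w \<in> words V" for w
    proof (cases "length w = ?M")
      case True
      then have "mW [(deg w - 1, DD w)] = - ev (scl W) (Q.D t) (der_lift mV (sng w))"
        using Q.D_cycle[OF t Dt w, of ?M] by (simp add: DD_def at_len_def)
      then show ?thesis using Q.D_leading[OF Dt w True] by (simp add: DD_def)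
    next
      case False
      then show ?thesis unfolding DD_def
        by (simp add: ev_at_len_other[OF mod der_lift_linpart] letter_zero[OF W W Q.m'] at_len_def[of _ _ w])
    qed
    moreover have "mW [(deg w, EE w)] = ev (scl W) EE (der_lift (linpart mU) (sng w)) + ev (scl W) DD (mor_lift (linpart F) (sng w))"
      if w: "w \<in> words U" for w
    proof (cases "length w = ?M")
      case True
      then have "mW [(deg w, EE w)] = ev (scl W) (T.E G (?c t) h) (der_lift mU (sng w)) + T.D (?c t) w - T.D G w"
        using T.E_cycle[OF G(1) mc[OF t] h G(2) Dc_small Eh w, of ?M] by (simp add: EE_def at_len_def)
      moreover have "ev (scl W) (Q.D t) (mor_lift F (sng w)) = ev (scl W) DD (mor_lift (linpart F) (sng w))"
        unfolding DD_def
      proof (rule ev_at_len_top[OF mod Fhom[OF w]])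
        show "mor_lift F (sng w) \<in> supp (maxlen ?M)" using mor_lift_upto[of F w] True by simp
        show "mor_lift F (sng w) - mor_lift (linpart F) (sng w) \<in> supp {v. length v < ?M}" using mor_lift_trunc[of F w] True by simp
      qed (fact Dt)
      ultimately show ?thesis using T.D_leading[OF Eh w True] by (simp add: EE_def Dc[OF w] G(2)[OF w])
    next
      case False
      then show ?thesis unfolding DD_def EE_def
        by (simp add: ev_at_len_other[OF mod der_lift_linpart] ev_at_len_other[OF mod mor_lift_linpart] letter_zero[OF W W Q.m'] at_len_def[of _ _ w])
    qed
    ultimately obtain x y where x: "mlin V W 0 x" and y: "mlin U W 1 y"
      and xe: "\<And>w. w \<in> words V \<Longrightarrow> DD w + mW [(deg w, x w)] - ev (scl W) x (der_lift (linpart mV) (sng w)) = 0"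
      and ye: "\<And>w. w \<in> words U \<Longrightarrow> EE w + ev (scl W) x (mor_lift (linpart F) (sng w)) - mW [(deg w + 1, y w)] - ev (scl W) y (der_lift (linpart mU) (sng w)) = 0"
      using extension_solution[OF str equiv mD mE] by blast
    define t' where "t' w = t w + at_len ?M x w" for w
    define h' where "h' w = h w + at_len ?M y w" for w
    have mt': "mlin V W 0 t'" and mh': "mlin U W 1 h'" unfolding t'_def[abs_def] h'_def[abs_def]
      by (intro mlin_add[OF V W] mlin_add[OF U W] t h mlin_at_len[OF V W] mlin_at_len[OF U W] x y)+
    have ag: "t' u = t u" if "length u < ?M" for u using that by (simp add: t'_def at_len_def)
    have agh: "h' u = h u" if "length u < ?M" for u using that by (simp add: h'_def at_len_def)
    have agc: "?c t' u = ?c t u" if "length u < ?M" for u by (rule precomp_local) (use ag that in auto)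
    have dt: "(\<lambda>u. t' u - t u) = at_len ?M x" and dh: "(\<lambda>u. h' u - h u) = at_len ?M y" by (auto simp: t'_def h'_def)
    have "Q.D t' w = 0" if w: "w \<in> words V" "length w \<le> ?M" for w
    proof (cases "length w = ?M")
      case True
      have "ev (scl W) (at_len ?M x) (der_lift (linpart mV) (sng w)) = ev (scl W) x (der_lift (linpart mV) (sng w))"
        using ev_at_len der_lift_linpart[of mV w] True by metis
      with Q.D_change(2)[OF t mt' ag w(1) True] xe[OF w(1)] True show ?thesis
        by (simp add: dt) (simp add: t'_def DD_def at_len_def)
    next
      case False
      with Q.D_change(1)[OF t mt' ag w(1)] Dt w show ?thesis by simp
    qed
    moreover have "T.E G (?c t') h' w = 0" if w: "w \<in> words U" "length w \<le> ?M" for w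
    proof (cases "length w = ?M")
      case True
      have "?c t' w - ?c t w = ev (scl W) (at_len ?M x) (mor_lift F (sng w))"
        unfolding precomp_def ev_diff_fam[OF mod, symmetric] dt ..
      also have "\<dots> = ev (scl W) (at_len ?M (at_len ?M x)) (mor_lift (linpart F) (sng w))"
      proof (rule ev_at_len_top[OF mod Fhom[OF w(1)]])
        show "mor_lift F (sng w) \<in> supp (maxlen ?M)" using mor_lift_upto[of F w] True by simp
        show "mor_lift F (sng w) - mor_lift (linpart F) (sng w) \<in> supp {v. length v < ?M}" using mor_lift_trunc[of F w] True by simp
      qed (simp add: at_len_def)
      also have "\<dots> = ev (scl W) x (mor_lift (linpart F) (sng w))"
        using ev_at_len mor_lift_linpart[of F w] True by metis
      finally have 1: "?c t' w - ?c t w = ev (scl W) x (mor_lift (linpart F) (sng w))" .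
      have "ev (scl W) (at_len ?M y) (der_lift (linpart mU) (sng w)) = ev (scl W) y (der_lift (linpart mU) (sng w))"
        using ev_at_len der_lift_linpart[of mU w] True by metis
      with T.E_change(2)[OF h mh' _ agc agh w(1) True, where f'=G and f=G] ye[OF w(1)] True 1 show ?thesis
        by (simp add: dh) (simp add: h'_def EE_def at_len_def)
    next
      case False
      with T.E_change(1)[OF h mh' _ agc agh w(1), where f'=G and f=G] Eh w show ?thesis by simp
    qed
    ultimately have "Inv ?M t' h'" using mt' mh' by (simp add: Inv_def)
    then show "\<exists>t' h'. Inv (Suc N) t' h' \<and> (\<forall>u. length u \<le> N \<longrightarrow> t' u = t u) \<and> (\<forall>u. length u \<le> N \<longrightarrow> h' u = h u)"
      using ag agh by (intro exI[of _ t'] exI[of _ h']) auto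
  qed
  then obtain t h where lim0: "\<forall>N\<ge>1. \<exists>t' h'. Inv N t' h' \<and> (\<forall>u. length u \<le> N \<longrightarrow> t' u = t u) \<and> (\<forall>u. length u \<le> N \<longrightarrow> h' u = h u)"
    and tl0: "\<forall>u. length u \<le> 1 \<longrightarrow> t u = t1 u" by (elim exE conjE)
  note lim = lim0[rule_format] and tl = tl0[rule_format]
  have mt: "mlin V W 0 t" by (rule mlin_limit[OF V W]) (use lim in \<open>unfold Inv_def, blast\<close>)
  have mh: "mlin U W 1 h" by (rule mlin_limit[OF U W]) (use lim in \<open>unfold Inv_def, blast\<close>)
  have "Q.D t w = 0" if w: "w \<in> words V" for w
  proof -
    obtain t' h' where i: "Inv (length w) t' h'" and ag: "\<And>u. length u \<le> length w \<Longrightarrow> t' u = t u"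
      using lim[OF words_len[OF w]] by blast
    have t': "mlin V W 0 t'" "Q.D t' w = 0" using i w by (auto simp: Inv_def)
    then show ?thesis using Q.D_change(1)[OF t'(1) mt, of "Suc (length w)" w] ag w by simp
  qed
  moreover have "T.E G (?c t) h w = 0" if w: "w \<in> words U" for w
  proof -
    obtain t' h' where i: "Inv (length w) t' h'" and ag: "\<And>u. length u \<le> length w \<Longrightarrow> t' u = t u" "\<And>u. length u \<le> length w \<Longrightarrow> h' u = h u"
      using lim[OF words_len[OF w]] by blast
    have t': "mlin U W 1 h'" "T.E G (?c t') h' w = 0" using i w by (auto simp: Inv_def)
    have "?c t u = ?c t' u" if "length u < Suc (length w)" for u
      by (rule precomp_local) (use ag that in auto)
    then show ?thesis using T.E_change(1)[OF t'(1) mh, of "Suc (length w)" G G "?c t" "?c t'" w] ag w t'(2) by simp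
  qed
  ultimately show ?thesis using mt mh tl by (intro exI[of _ t] exI[of _ h]) (auto simp: fam_morphism_def)
qed

text \<open>
  Dually, a chain map \<open>s\<^sub>1\<close> with \<open>f s\<^sub>1\<close> homotopic to the
  linear part of \<open>G\<close> extends to a morphism \<open>s\<close> with \<open>Fs\<close>
  homotopic to \<open>G\<close>.
\<close>

lemma morphism_lifting:
  fixes U :: "('r::comm_ring_1, 'a::ab_group_add) dgmod" and V :: "('r, 'b::ab_group_add) dgmod" and W :: "('r, 'c::ab_group_add) dgmod"
  assumes str: "ainf_str U mU" "ainf_str V mV" "ainf_str W mW"
    and F0: "fam_morphism V mV W mW F"
    and G0: "fam_morphism U mU W mW G"
    and equiv: "letter_equivalence V mV W mW F g k l"
    and s1: "mlin U V 0 s1" "letter_chain U mU mV s1"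
    and h1: "mlin U W 1 h1" "letter_homotopy U mU mW (\<lambda>n a. F [(n, s1 [(n, a)])]) (\<lambda>n a. G [(n, a)]) h1"
  shows "\<exists>s h. fam_morphism U mU V mV s \<and> mlin U W 1 h \<and>
     (\<forall>w\<in>words U. htp_defect W mU mW (precomp W F (mor_lift s)) G h w = 0) \<and> (\<forall>l. s [l] = s1 [l])"
proof -
  note F = fam_morphismD[OF F0] and G = fam_morphismD[OF G0]
  interpret P: ainf_pair U mU V mV using str by unfold_locales
  interpret Q: ainf_pair V mV W mW using str by unfold_locales
  interpret T: ainf_pair U mU W mW using str by unfold_locales
  note U = P.V and V = P.W and W = Q.W and mod = Q.W_mod
  let ?c = "\<lambda>s. precomp W F (mor_lift s)"
  have mc: "mlin U W 0 (?c s)" if "mlin U V 0 s" for s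
    by (rule mlin_precomp[OF U V W F(1) tensor_hom_mor_lift[OF U V that]]) simp
  have c_local: "?c s' w = ?c s w" if "\<And>u. length u \<le> length w \<Longrightarrow> s' u = s u" for s s' w
  proof -
    have "(mor_lift s' (sng w) :: _ \<Rightarrow>\<^sub>0 'r) = mor_lift s (sng w)" unfolding mor_lift_def lin_ext_sng
      by (rule mor_of_local) (auto intro: letter_of_cong that)
    then show ?thesis by (simp add: precomp_def)
  qed
  define Inv where "Inv N s h \<longleftrightarrow> mlin U V 0 s \<and> mlin U W 1 h \<and> (\<forall>w\<in>words U. length w \<le> N \<longrightarrow> P.D s w = 0) \<and>
     (\<forall>w\<in>words U. length w \<le> N \<longrightarrow> T.E (?c s) G h w = 0)" for N s h
  have "\<exists>s h. (\<forall>N\<ge>1. \<exists>s' h'. Inv N s' h' \<and> (\<forall>u. length u \<le> N \<longrightarrow> s' u = s u) \<and> (\<forall>u. length u \<le> N \<longrightarrow> h' u = h u)) \<and>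
     (\<forall>u. length u \<le> 1 \<longrightarrow> s u = s1 u)"
  proof (rule length_induct_families)
    have "P.D s1 w = 0 \<and> T.E (?c s1) G h1 w = 0" if w: "w \<in> words U" "length w \<le> 1" for w
    proof -
      obtain n a where "w = [(n, a)]" "a \<in> part U n" using word_cases1[of w U] words_len[OF w(1)] w by force
      then show ?thesis using s1(2) h1(2)
        by (simp add: mor_defect_def htp_defect_def precomp_def lifts_letter ev_letter_of[OF V V P.m'] ev_letter_of[OF U V s1(1)] letter_chain_def
           ev_letter_of[OF W W Q.m'] ev_letter_of[OF V W F(1)] ev_letter_of[OF U W h1(1)] letter_homotopy_def)
    qed
    then show "Inv 1 s1 h1" using s1(1) h1(1) by (simp add: Inv_def)
  next
    fix N s h assume "1 \<le> N" and "Inv N s h"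
    then have s: "mlin U V 0 s" and h: "mlin U W 1 h" and Ds: "\<And>w. w \<in> words U \<Longrightarrow> length w < Suc N \<Longrightarrow> P.D s w = 0"
      and Eh: "\<And>w. w \<in> words U \<Longrightarrow> length w < Suc N \<Longrightarrow> T.E (?c s) G h w = 0"
      by (auto simp: Inv_def)
    let ?M = "Suc N"
    \<comment> \<open>the obstructions in the next arity; the sign of \<open>E\<close> is the one of \<open>lifting_solution\<close>\<close>
    define DD where "DD = at_len ?M (P.D s)"
    define EE where "EE w = - at_len ?M (T.E (?c s) G h) w" for w
    have mD: "mlin U V (-1) DD" unfolding DD_def by (rule mlin_at_len[OF U V P.mlin_D[OF s]])
    have mE: "mlin U W 0 EE" unfolding EE_def[abs_def] by (rule mlin_neg[OF U W mlin_at_len[OF U W T.mlin_E[OF mc[OF s] G(1) h]]])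
    have Dc: "T.D (?c s) w = F [(deg w - 1, P.D s w)]" if "w \<in> words U" "length w \<le> ?M" for w
      by (rule defect_postcomp[OF str F0 s Ds that])
    have Dc_small: "T.D (?c s) w = 0" if "w \<in> words U" "length w < ?M" for w
      using Dc[OF that(1)] that Ds by (simp add: letter_zero[OF V W F(1)])
    have "mV [(deg w - 1, DD w)] = - ev (scl V) DD (der_lift (linpart mU) (sng w))" if w: "w \<in> words U" for w
    proof (cases "length w = ?M")
      case True
      then have "mV [(deg w - 1, DD w)] = - ev (scl V) (P.D s) (der_lift mU (sng w))"
        using P.D_cycle[OF s Ds w, of ?M] by (simp add: DD_def at_len_def)
      then show ?thesis using P.D_leading[OF Ds w True] by (simp add: DD_def)
    next
      case False
      then show ?thesis unfolding DD_def
        by (simp add: ev_at_len_other[OF P.W_mod der_lift_linpart] letter_zero[OF V V P.m'] at_len_def[of _ _ w])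
    qed
    moreover have "mW [(deg w, EE w)] = ev (scl W) EE (der_lift (linpart mU) (sng w)) + F [(deg w - 1, DD w)]"
      if w: "w \<in> words U" for w
    proof (cases "length w = ?M")
      case True
      have "T.E (?c s) G h w \<in> part W (deg w)" using mlin_in[OF T.mlin_E[OF mc[OF s] G(1) h] w] by simp
      then have "mW [(deg w, EE w)] = - mW [(deg w, T.E (?c s) G h w)]"
        using True by (simp add: EE_def at_len_def letter_neg[OF W W Q.m'])
      also have "\<dots> = - (ev (scl W) (T.E (?c s) G h) (der_lift mU (sng w)) + T.D G w - T.D (?c s) w)"
        using T.E_cycle[OF mc[OF s] G(1) h Dc_small G(2) Eh w, of ?M] True by simp
      also have "ev (scl W) (T.E (?c s) G h) (der_lift mU (sng w)) = - ev (scl W) EE (der_lift (linpart mU) (sng w))"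
        using T.D_leading[OF Eh w True] by (simp add: EE_def[abs_def] ev_neg_fam[OF mod])
      finally show ?thesis using True by (simp add: G(2)[OF w] Dc[OF w] DD_def at_len_def)
    next
      case False
      then show ?thesis unfolding DD_def EE_def[abs_def] ev_neg_fam[OF mod]
        by (simp add: ev_at_len_other[OF mod der_lift_linpart] letter_zero[OF V W F(1)] letter_zero[OF W W Q.m'] at_len_def[of _ _ w])
    qed
    ultimately obtain x y where x: "mlin U V 0 x" and y: "mlin U W 1 y"
      and xe: "\<And>w. w \<in> words U \<Longrightarrow> DD w + mV [(deg w, x w)] - ev (scl V) x (der_lift (linpart mU) (sng w)) = 0"
      and ye: "\<And>w. w \<in> words U \<Longrightarrow> EE w + F [(deg w, x w)] + mW [(deg w + 1, y w)] + ev (scl W) y (der_lift (linpart mU) (sng w)) = 0"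
      using lifting_solution[OF str equiv mD mE] by blast
    define s' where "s' w = s w + at_len ?M x w" for w
    define h' where "h' w = h w + at_len ?M y w" for w
    have ms': "mlin U V 0 s'" and mh': "mlin U W 1 h'" unfolding s'_def[abs_def] h'_def[abs_def]
      by (intro mlin_add[OF U V] mlin_add[OF U W] s h mlin_at_len[OF U V] mlin_at_len[OF U W] x y)+
    have ag: "s' u = s u" if "length u < ?M" for u using that by (simp add: s'_def at_len_def)
    have agh: "h' u = h u" if "length u < ?M" for u using that by (simp add: h'_def at_len_def)
    have agc: "?c s' u = ?c s u" if "length u < ?M" for u by (rule c_local) (use ag that in auto)
    have ds: "(\<lambda>u. s' u - s u) = at_len ?M x" and dh: "(\<lambda>u. h' u - h u) = at_len ?M y" by (auto simp: s'_def h'_def)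
    have "P.D s' w = 0" if w: "w \<in> words U" "length w \<le> ?M" for w
    proof (cases "length w = ?M")
      case True
      have "ev (scl V) (at_len ?M x) (der_lift (linpart mU) (sng w)) = ev (scl V) x (der_lift (linpart mU) (sng w))"
        using ev_at_len der_lift_linpart[of mU w] True by metis
      with P.D_change(2)[OF s ms' ag w(1) True] xe[OF w(1)] True show ?thesis
        by (simp add: ds) (simp add: s'_def DD_def at_len_def)
    next
      case False
      with P.D_change(1)[OF s ms' ag w(1)] Ds w show ?thesis by simp
    qed
    moreover have "T.E (?c s') G h' w = 0" if w: "w \<in> words U" "length w \<le> ?M" for w
    proof (cases "length w = ?M")
      case True
      have ne: "w \<noteq> []" by (rule words_nonempty[OF w(1)])
      have "(mor_lift s' (sng w) :: _ \<Rightarrow>\<^sub>0 'r) - mor_lift s (sng w) = letter_of 0 s' w - letter_of 0 s w"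
        unfolding mor_lift_def lin_ext_sng by (rule mor_of_diff) (use ag True in \<open>auto intro: letter_of_cong\<close>)
      then have "?c s' w - ?c s w = ev (scl W) F (letter_of 0 s' w) - ev (scl W) F (letter_of 0 s w)"
        unfolding precomp_def by (metis module_hom.diff[OF ev_hom[OF mod]])
      also have "\<dots> = F [(deg w, x w)]"
        using letter_minus[OF V W F(1), of "s' w" "deg w" "s w"] mlin_in[OF s w(1)] mlin_in[OF ms' w(1)] True
        by (simp add: ev_letter_of[OF V W F(1) ne]) (simp add: s'_def at_len_def)
      finally have 1: "?c s' w - ?c s w = F [(deg w, x w)]" .
      have "ev (scl W) (at_len ?M y) (der_lift (linpart mU) (sng w)) = ev (scl W) y (der_lift (linpart mU) (sng w))"
        using ev_at_len der_lift_linpart[of mU w] True by metis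
      with T.E_change(2)[OF h mh' agc _ agh w(1) True, where g'=G and g=G] ye[OF w(1)] True 1 show ?thesis
        by (simp add: dh) (simp add: h'_def EE_def at_len_def algebra_simps)
    next
      case False
      with T.E_change(1)[OF h mh' agc _ agh w(1), where g'=G and g=G] Eh w show ?thesis by simp
    qed
    ultimately have "Inv ?M s' h'" using ms' mh' by (simp add: Inv_def)
    then show "\<exists>s' h'. Inv (Suc N) s' h' \<and> (\<forall>u. length u \<le> N \<longrightarrow> s' u = s u) \<and> (\<forall>u. length u \<le> N \<longrightarrow> h' u = h u)"
      using ag agh by (intro exI[of _ s'] exI[of _ h']) auto
  qed
  then obtain s h where lim0: "\<forall>N\<ge>1. \<exists>s' h'. Inv N s' h' \<and> (\<forall>u. length u \<le> N \<longrightarrow> s' u = s u) \<and> (\<forall>u. length u \<le> N \<longrightarrow> h' u = h u)"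
    and sl0: "\<forall>u. length u \<le> 1 \<longrightarrow> s u = s1 u" by (elim exE conjE)
  note lim = lim0[rule_format] and sl = sl0[rule_format]
  have ms: "mlin U V 0 s" by (rule mlin_limit[OF U V]) (use lim in \<open>unfold Inv_def, blast\<close>)
  have mh: "mlin U W 1 h" by (rule mlin_limit[OF U W]) (use lim in \<open>unfold Inv_def, blast\<close>)
  have "P.D s w = 0 \<and> T.E (?c s) G h w = 0" if w: "w \<in> words U" for w
  proof -
    obtain s' h' where i: "Inv (length w) s' h'" and ag: "\<And>u. length u \<le> length w \<Longrightarrow> s' u = s u" "\<And>u. length u \<le> length w \<Longrightarrow> h' u = h u"
      using lim[OF words_len[OF w]] by blast
    have s': "mlin U V 0 s'" "P.D s' w = 0" and h': "mlin U W 1 h'" "T.E (?c s') G h' w = 0" using i w by (auto simp: Inv_def)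
    have "?c s u = ?c s' u" if "length u < Suc (length w)" for u
      by (rule c_local) (use ag that in auto)
    then show ?thesis using T.E_change(1)[OF h'(1) mh, of "Suc (length w)" "?c s" "?c s'" G G w] ag w h'(2) s'(2)
       P.D_change(1)[OF s'(1) ms, of "Suc (length w)" w] by simp
  qed
  then show ?thesis using ms mh sl by (intro exI[of _ s] exI[of _ h]) (auto simp: fam_morphism_def)
qed


section \<open>Suspension\<close>

definition down :: "'a word \<Rightarrow> 'a word" where
  "down w = map (\<lambda>(n, a). (n - 1, a)) w"

text \<open>
  A family of components of a map of modules, transported to the suspensions with the sign by which
  \<open>component\<close> is normalised.
\<close>

definition sus :: "('a word \<Rightarrow> 'b::ab_group_add) \<Rightarrow> 'a word \<Rightarrow> 'b" where
  "sus M w = ksign (desusp_sign (down w)) (M (down w))"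

definition unsus :: "('a word \<Rightarrow> 'b::ab_group_add) \<Rightarrow> 'a word \<Rightarrow> 'b" where
  "unsus s w = ksign (desusp_sign w) (s (up w))"

lemma up_down [simp]: "up (down w) = w" "down (up w) = w"
  by (simp_all add: up_def down_def o_def case_prod_unfold)

lemma len_up_down [simp]: "length (up w) = length w" "length (down w) = length w"
  by (simp_all add: up_def down_def)

lemma down_simps [simp]: "down (u @ v) = down u @ down v" "down ((n, a) # v) = (n - 1, a) # down v" "down [] = []"
  by (simp_all add: down_def)

lemma up_simps [simp]: "up (u @ v) = up u @ up v" "up ((n, a) # v) = (n + 1, a) # up v" "up [] = []"
  by (simp_all add: up_def)

lemma deg_up: "deg (up w) = deg w + int (length w)"
  by (induction w) auto

lemma susp_simps [simp]: "scl (susp A) = scl A" "part (susp A) n = part A (n - 1)"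
  by (simp_all add: susp_def)

lemma words_susp: "w \<in> words (susp A) \<longleftrightarrow> down w \<in> words A"
  by (auto simp: words_def down_def)

lemma up_words: "up w \<in> words (susp A) \<longleftrightarrow> w \<in> words A"
  by (simp add: words_susp)

lemma graded_susp: "graded_module A \<Longrightarrow> graded_module (susp A)"
  by (simp add: graded_module_def)

lemma ksign_twice [simp]: "ksign n (ksign n x) = x"
  by (simp add: ksign_def)

lemma sus_unsus [simp]: "sus (unsus s) = s"
  by (rule ext) (simp add: sus_def unsus_def)

lemma desusp_sign_degs: "map fst w = map fst w' \<Longrightarrow> desusp_sign w = desusp_sign w'"
proof -
  assume a: "map fst w = map fst w'"
  then have l: "length w = length w'" by (metis length_map)
  have "fst (w ! i) = fst (w' ! i)" if "i < length w" for i
    using that l a by (metis nth_map)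
  then show ?thesis unfolding desusp_sign_def l[symmetric] by (intro sum.cong) auto
qed

lemma desusp_sign_letter: "desusp_sign (u @ (n, a) # v) = desusp_sign (u @ (n, b) # v)"
  by (rule desusp_sign_degs) simp

lemma desusp_sign_single [simp]: "desusp_sign [l] = 0"
  by (simp add: desusp_sign_def)

lemma sus_letter [simp]: "sus M [(n, a)] = M [(n - 1, a)]"
  by (simp add: sus_def ksign_simps)

text \<open>The arity-dependent degrees of components become constant after suspension.\<close>

lemma mlin_sus:
  assumes A: "graded_module A" and B: "graded_module B"
  shows "mlin (susp A) (susp B) e (sus M) \<longleftrightarrow> multilinear_family A B 1 (\<lambda>k. int k + (e - 1)) M"
proof -
  interpret B: module "scl B" by (rule gm_module[OF B])
  note sA = graded_susp[OF A] and sB = graded_susp[OF B]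
  have "mlin (susp A) (susp B) e (sus M)" if M: "multilinear_family A B 1 (\<lambda>k. int k + (e - 1)) M"
  proof -
    note Mi = M[unfolded multilinear_family_iff[OF A B]]
    show ?thesis unfolding mlin_iff[OF sA sB]
    proof (intro conjI ballI allI impI)
      fix w assume "w \<in> words (susp A)"
      then have w: "down w \<in> words A" by (simp add: words_susp)
      have "M (down w) \<in> part B (deg (down w) + (int (length (down w)) + (e - 1)))"
        using Mi w words_len[OF w] by blast
      also have "deg (down w) + (int (length (down w)) + (e - 1)) = deg w + e - 1"
        using deg_up[of "down w"] by simp
      finally show "sus M w \<in> part (susp B) (deg w + e)"
        unfolding sus_def by (simp add: ksign_subspace[OF B.module_axioms gm_part[OF B]])
    next
      fix u n a c b v assume w: "u @ (n, a) # v \<in> words (susp A)" "b \<in> part (susp A) n"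
      have d: "down u @ (n - 1, a) # down v \<in> words A" using w(1) unfolding words_susp by simp
      have "M (down u @ (n - 1, a + scl A c b) # down v) = M (down u @ (n - 1, a) # down v) + scl B c (M (down u @ (n - 1, b) # down v))"
        using Mi d w(2) by simp
      then show "sus M (u @ (n, a + scl (susp A) c b) # v) = sus M (u @ (n, a) # v) + scl (susp B) c (sus M (u @ (n, b) # v))"
        using desusp_sign_letter[of "down u" "n - 1" a "down v" "a + scl A c b"] desusp_sign_letter[of "down u" "n - 1" a "down v" b]
        by (simp add: sus_def ksign_scale[OF B.module_axioms] ksign_simps(3)[symmetric])
    qed
  qed
  moreover have "multilinear_family A B 1 (\<lambda>k. int k + (e - 1)) M" if M: "mlin (susp A) (susp B) e (sus M)"
  proof -
    note Mi = M[unfolded mlin_iff[OF sA sB]]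
    have M_eq: "M w = ksign (desusp_sign w) (sus M (up w))" for w by (simp add: sus_def)
    show ?thesis unfolding multilinear_family_iff[OF A B]
    proof (intro conjI ballI allI impI)
      fix w assume "w \<in> words A"
      then have "sus M (up w) \<in> part (susp B) (deg (up w) + e)" using Mi by (simp add: up_words)
      then have "sus M (up w) \<in> part B (deg w + (int (length w) + (e - 1)))" by (simp add: deg_up add_diff_eq add.assoc)
      then show "M w \<in> part B (deg w + (int (length w) + (e - 1)))"
        unfolding M_eq[of w] by (rule ksign_subspace[OF B.module_axioms gm_part[OF B]])
    next
      fix u n a c b v assume w: "u @ (n, a) # v \<in> words A" "b \<in> part A n"
      then have "up u @ (n + 1, a) # up v \<in> words (susp A)" using up_words[of "u @ (n, a) # v" A] by simp
      then have "sus M (up u @ (n + 1, a + scl A c b) # up v) = sus M (up u @ (n + 1, a) # up v) + scl B c (sus M (up u @ (n + 1, b) # up v))"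
        using Mi w by simp
      then show "M (u @ (n, a + scl A c b) # v) = M (u @ (n, a) # v) + scl B c (M (u @ (n, b) # v))"
        using desusp_sign_letter[of u n a v "a + scl A c b"] desusp_sign_letter[of u n a v b]
        by (simp add: M_eq ksign_scale[OF B.module_axioms] ksign_simps(3)[symmetric])
    qed
  qed
  ultimately show ?thesis by blast
qed

lemma proj_elts:
  assumes "x \<in> tensor_elts_deg W m"
  shows "proj W m x = ev (scl W) id_fam x"
  unfolding proj_def ev_def[symmetric]
  by (rule ev_cong[OF assms[unfolded elts_supp]]) (auto simp: id_fam_def split: list.splits)

lemma component_eq:
  assumes "tensor_hom (susp A) (susp B) e \<Phi>" "w \<in> words A"
  shows "component B e \<Phi> w = ksign (desusp_sign w) (ev (scl B) id_fam (\<Phi> (sng (up w))))"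
  using proj_elts[OF tensor_homD(2)[OF assms(1) sng_elts(1)], of "up w"] assms(2)
  by (simp add: component_def up_words)

lemma has_components_iff:
  assumes "tensor_hom (susp A) (susp B) e \<Phi>"
  shows "has_components A B e \<Phi> M \<longleftrightarrow> (\<forall>w\<in>words (susp A). ev (scl B) id_fam (\<Phi> (sng w)) = sus M w)"
proof
  assume h: "has_components A B e \<Phi> M"
  show "\<forall>w\<in>words (susp A). ev (scl B) id_fam (\<Phi> (sng w)) = sus M w"
  proof
    fix w assume "w \<in> words (susp A)"
    then have d: "down w \<in> words A" by (simp add: words_susp)
    then have "component B e \<Phi> (down w) = M (down w)" using h by (simp add: has_components_def)
    then have "M (down w) = ksign (desusp_sign (down w)) (ev (scl B) id_fam (\<Phi> (sng w)))"
      using component_eq[OF assms d] by simp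
    then show "ev (scl B) id_fam (\<Phi> (sng w)) = sus M w" by (simp add: sus_def)
  qed
next
  assume h: "\<forall>w\<in>words (susp A). ev (scl B) id_fam (\<Phi> (sng w)) = sus M w"
  show "has_components A B e \<Phi> M" unfolding has_components_def
    using h by (auto simp: component_eq[OF assms] up_words sus_def)
qed

section \<open>Agreement of the chosen lifts with the canonical ones\<close>

text \<open>
  An explicit lift with the required components exists, so the choice operator selects some lift,
  and uniqueness shows that it agrees with the explicit one modulo relations.
\<close>

lemma coder_lift:
  fixes A :: "('r::comm_ring_1, 'a::ab_group_add) dgmod"
  assumes A: "graded_module A" and m: "mlin (susp A) (susp A) (-1) (sus (ainf_ops A \<mu>))"
  shows "tensor_hom (susp A) (susp A) (-1) (coder A \<mu>)"
    "x \<in> tensor_elts (susp A) \<Longrightarrow> coder A \<mu> x - der_lift (sus (ainf_ops A \<mu>)) x \<in> tensor_rel (susp A)"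
proof -
  let ?V = "susp A" and ?m = "sus (ainf_ops A \<mu>)"
  note V = graded_susp[OF A]
  note hm = tensor_hom_der_lift[OF V m]
  have comp: "ev (scl A) id_fam (der_lift ?m (sng w)) = ?m w" if "w \<in> words ?V" for w
    using corestr_der_lift[OF V sng_elts(2)[OF that]] ev_sng[OF gm_module[OF A]] by simp
  have "coderivation ?V (der_lift ?m)"
    unfolding coderivation_def by (auto simp: hm coprod_der_lift_elt free.subspace_0[OF subspace_rel2])
  moreover have "has_components A A (-1) (der_lift ?m) (ainf_ops A \<mu>)"
    unfolding has_components_iff[OF hm] using comp by simp
  ultimately have "coderivation ?V (coder A \<mu>) \<and> has_components A A (-1) (coder A \<mu>) (ainf_ops A \<mu>)"
    unfolding coder_def by (rule someI[where P="\<lambda>\<delta>. coderivation ?V \<delta> \<and> has_components A A (-1) \<delta> (ainf_ops A \<mu>)", OF conjI])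
  then have c: "coderivation ?V (coder A \<mu>)" "has_components A A (-1) (coder A \<mu>) (ainf_ops A \<mu>)" by auto
  show h: "tensor_hom ?V ?V (-1) (coder A \<mu>)" using c by (simp add: coderivation_def)
  have "coder_along (-1) ?V ?V (\<lambda>x. x) (\<lambda>x. x) (coder A \<mu>)" unfolding coder_along_def
  proof (intro conjI ballI h)
    fix w assume "w \<in> words ?V"
    from sng_elts(2)[OF this] c(1)
    have "coprod (coder A \<mu> (sng w)) - (tens_map 0 (coder A \<mu>) id (coprod (sng w)) + tens_map (-1) id (coder A \<mu>) (coprod (sng w))) \<in> tensor_rel2 ?V"
      by (simp add: coderivation_def)
    then show "coprod (coder A \<mu> (sng w)) - (cuts (twist (-1) (on_word (\<lambda>x. x))) (on_word (coder A \<mu>)) w + cuts (on_word (coder A \<mu>)) (on_word (\<lambda>x. x)) w) \<in> tensor_rel2 ?V"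
      by (simp add: tens_map_coprod twist_def[abs_def] ksign_simps(1) add.commute)
  qed
  moreover have "coder_along (-1) ?V ?V (\<lambda>x. x) (\<lambda>x. x) (der_lift ?m)" unfolding coder_along_def
    by (auto simp: hm coprod_der_lift free.subspace_0[OF subspace_rel2])
  ultimately show "coder A \<mu> x - der_lift ?m x \<in> tensor_rel ?V" if "x \<in> tensor_elts ?V"
    by (rule coder_along_unique[OF V _ _ tensor_hom_id _ tensor_hom_id _ _ that])
      (use c(2)[unfolded has_components_iff[OF h]] comp in \<open>auto simp: free.subspace_0[OF subspace_rel]\<close>)
qed

lemma comor_lift:
  fixes A :: "('r::comm_ring_1, 'a::ab_group_add) dgmod" and B :: "('r, 'b::ab_group_add) dgmod"
  assumes A: "graded_module A" and B: "graded_module B" and f: "mlin (susp A) (susp B) 0 (sus F)"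
  shows "tensor_hom (susp A) (susp B) 0 (comor A B F)"
    "x \<in> tensor_elts (susp A) \<Longrightarrow> comor A B F x - mor_lift (sus F) x \<in> tensor_rel (susp B)"
proof -
  let ?V = "susp A" and ?W = "susp B"
  note V = graded_susp[OF A] and W = graded_susp[OF B]
  note hf = tensor_hom_mor_lift[OF V W f]
  have comp: "ev (scl B) id_fam (mor_lift (sus F) (sng w)) = sus F w" if "w \<in> words ?V" for w
    using corestr_mor_lift[OF W sng_elts(2)[OF that]] ev_sng[OF gm_module[OF B]] by simp
  have "coalgebra_morphism ?V ?W (mor_lift (sus F))"
    unfolding coalgebra_morphism_def by (auto simp: hf coprod_mor_lift_elt free.subspace_0[OF subspace_rel2])
  moreover have "has_components A B 0 (mor_lift (sus F)) F"
    unfolding has_components_iff[OF hf] using comp by simp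
  ultimately have "coalgebra_morphism ?V ?W (comor A B F) \<and> has_components A B 0 (comor A B F) F"
    unfolding comor_def by (rule someI[where P="\<lambda>\<phi>. coalgebra_morphism ?V ?W \<phi> \<and> has_components A B 0 \<phi> F", OF conjI])
  then have c: "coalgebra_morphism ?V ?W (comor A B F)" "has_components A B 0 (comor A B F) F" by auto
  show h: "tensor_hom ?V ?W 0 (comor A B F)" using c by (simp add: coalgebra_morphism_def)
  have cop: "coprod (comor A B F (sng w)) - cuts (on_word (comor A B F)) (on_word (comor A B F)) w \<in> tensor_rel2 ?W" if "w \<in> words ?V" for w
  proof -
    have "coprod (comor A B F (sng w)) - tens_map 0 (comor A B F) (comor A B F) (coprod (sng w)) \<in> tensor_rel2 ?W"
      using sng_elts(2)[OF that] c(1) by (simp add: coalgebra_morphism_def)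
    then show ?thesis by (simp add: tens_map_coprod ksign_simps(1))
  qed
  show "comor A B F x - mor_lift (sus F) x \<in> tensor_rel ?W" if "x \<in> tensor_elts ?V"
    by (rule morphism_unique[OF W h hf cop _ _ that])
      (use c(2)[unfolded has_components_iff[OF h]] comp in \<open>auto simp: coprod_mor_lift free.subspace_0[OF subspace_rel2]\<close>)
qed

text \<open>
  The explicit homotopy is a homotopy along the explicit morphisms. These differ from the chosen
  morphisms by relations, so it is also one along the chosen morphisms.
\<close>

lemma cohtp_lift:
  fixes A :: "('r::comm_ring_1, 'a::ab_group_add) dgmod" and B :: "('r, 'b::ab_group_add) dgmod"
  assumes A: "graded_module A" and B: "graded_module B" and f: "mlin (susp A) (susp B) 0 (sus F)" and g: "mlin (susp A) (susp B) 0 (sus G)"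
    and h: "mlin (susp A) (susp B) 1 (sus H)"
  shows "tensor_hom (susp A) (susp B) 1 (cohtp A B F G H)"
    "x \<in> tensor_elts (susp A) \<Longrightarrow> cohtp A B F G H x - htp_lift (sus F) (sus G) (sus H) x \<in> tensor_rel (susp B)"
proof -
  let ?V = "susp A" and ?W = "susp B" and ?\<phi> = "comor A B F" and ?\<psi> = "comor A B G" and ?\<eta> = "htp_lift (sus F) (sus G) (sus H) :: ('a word \<Rightarrow>\<^sub>0 'r) \<Rightarrow> _"
  note V = graded_susp[OF A] and W = graded_susp[OF B]
  note hh = tensor_hom_htp_lift[OF V W f g h]
  note hf = comor_lift[OF A B f] and hg = comor_lift[OF A B g]
  have comp: "ev (scl B) id_fam (?\<eta> (sng w)) = sus H w" if "w \<in> words ?V" for w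
    using corestr_htp_lift[OF W sng_elts(2)[OF that]] ev_sng[OF gm_module[OF B]] by simp
  have "homotopy_coderivation ?V ?W ?\<phi> ?\<psi> ?\<eta>"
    unfolding homotopy_coderivation_def
  proof (intro conjI ballI hh)
    fix x :: "'a word \<Rightarrow>\<^sub>0 'r" assume x: "x \<in> tensor_elts ?V"
    show "coprod (?\<eta> x) - (tens_map 1 ?\<phi> ?\<eta> (coprod x) + tens_map 0 ?\<eta> ?\<psi> (coprod x)) \<in> tensor_rel2 ?W"
    proof (rule hom_supp[OF _ subspace_rel2 _ x[unfolded elts_supp]])
      show "lin (\<lambda>x. coprod (?\<eta> x) - (tens_map 1 ?\<phi> ?\<eta> (coprod x) + tens_map 0 ?\<eta> ?\<psi> (coprod x)))"
        by (intro hom_diff hom_add hom_comp[OF lin_lifts(2) lin_coprod] hom_comp[OF lin_coprod lin_tens_map])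
      fix w assume w: "w \<in> words ?V"
      have "- cuts (twist 1 (\<lambda>w. ?\<phi> (sng w) - mor_lift (sus F) (sng w))) (on_word ?\<eta>) w - cuts (on_word ?\<eta>) (\<lambda>w. ?\<psi> (sng w) - mor_lift (sus G) (sng w)) w \<in> tensor_rel2 ?W"
        by (intro free.subspace_diff[OF subspace_rel2] free.subspace_neg[OF subspace_rel2] cuts_rel2(1)[OF w twist_rel[OF hf(2)]] cuts_rel2(2)[OF w _ hg(2)]
           tensor_hom_elts[OF hh] sng_elts)
      moreover have "twist 1 (\<lambda>w. ?\<phi> (sng w) - mor_lift (sus F) (sng w)) = (\<lambda>w. twist 1 (on_word ?\<phi>) w - twist 1 (on_word (mor_lift (sus F))) w)"
        by (simp add: twist_def[abs_def] ksign_simps)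
      ultimately show "coprod (?\<eta> (sng w)) - (tens_map 1 ?\<phi> ?\<eta> (coprod (sng w)) + tens_map 0 ?\<eta> ?\<psi> (coprod (sng w))) \<in> tensor_rel2 ?W"
        by (simp add: coprod_htp_lift tens_map_coprod cuts_diff ksign_simps(1)) (simp add: twist_def[abs_def] algebra_simps)
    qed
  qed
  moreover have "has_components A B 1 ?\<eta> H"
    unfolding has_components_iff[OF hh] using comp by simp
  ultimately have "homotopy_coderivation ?V ?W ?\<phi> ?\<psi> (cohtp A B F G H) \<and> has_components A B 1 (cohtp A B F G H) H"
    unfolding cohtp_def by (rule someI[where P="\<lambda>\<eta>. homotopy_coderivation ?V ?W ?\<phi> ?\<psi> \<eta> \<and> has_components A B 1 \<eta> H", OF conjI])
  then have c: "homotopy_coderivation ?V ?W ?\<phi> ?\<psi> (cohtp A B F G H)" "has_components A B 1 (cohtp A B F G H) H" by auto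
  show hc: "tensor_hom ?V ?W 1 (cohtp A B F G H)" using c by (simp add: homotopy_coderivation_def)
  have "coder_along 1 ?V ?W ?\<phi> ?\<psi> (cohtp A B F G H)" unfolding coder_along_def
  proof (intro conjI ballI hc)
    fix w assume "w \<in> words ?V"
    from sng_elts(2)[OF this] c(1)
    have "coprod (cohtp A B F G H (sng w)) - (tens_map 1 ?\<phi> (cohtp A B F G H) (coprod (sng w)) + tens_map 0 (cohtp A B F G H) ?\<psi> (coprod (sng w))) \<in> tensor_rel2 ?W"
      by (simp add: homotopy_coderivation_def)
    then show "coprod (cohtp A B F G H (sng w)) - (cuts (twist 1 (on_word ?\<phi>)) (on_word (cohtp A B F G H)) w + cuts (on_word (cohtp A B F G H)) (on_word ?\<psi>) w) \<in> tensor_rel2 ?W"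
      by (simp add: tens_map_coprod twist_def[abs_def] ksign_simps(1))
  qed
  moreover have "coder_along 1 ?V ?W (mor_lift (sus F)) (mor_lift (sus G)) ?\<eta>" unfolding coder_along_def
    by (auto simp: hh coprod_htp_lift free.subspace_0[OF subspace_rel2])
  ultimately show "cohtp A B F G H x - ?\<eta> x \<in> tensor_rel ?W" if "x \<in> tensor_elts ?V"
    by (rule coder_along_unique[OF W _ _ tensor_hom_mor_lift[OF V W f] hf(2) hg(1) hg(2) _ that])
      (use c(2)[unfolded has_components_iff[OF hc]] comp in \<open>auto simp: sng_elts\<close>)
qed

lemma comp_congruent:
  assumes "tensor_hom U V d \<Phi>" "tensor_hom V W e \<Psi>'"
    and "\<And>x. x \<in> tensor_elts U \<Longrightarrow> \<Phi> x - \<Phi>' x \<in> tensor_rel V" "\<And>y. y \<in> tensor_elts V \<Longrightarrow> \<Psi> y - \<Psi>' y \<in> tensor_rel W"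
    and x: "x \<in> tensor_elts U"
  shows "\<Psi> (\<Phi> x) - \<Psi>' (\<Phi>' x) \<in> tensor_rel W"
proof -
  have "\<Psi>' (\<Phi> x - \<Phi>' x) \<in> tensor_rel W" by (rule tensor_homD(3)[OF assms(2) assms(3)[OF x]])
  from free.subspace_add[OF subspace_rel assms(4)[OF tensor_hom_elts[OF assms(1) x]] this]
  show ?thesis by (simp add: module_hom.diff[OF tensor_homD(1)[OF assms(2)]])
qed

section \<open>Componentwise form of the \<open>A\<^sub>\<infinity>\<close> notions\<close>

abbreviation susp_ops :: "('r, 'a::ab_group_add) dgmod \<Rightarrow> ('a word \<Rightarrow> 'a) \<Rightarrow> 'a word \<Rightarrow> 'a" where
  "susp_ops A \<mu> \<equiv> sus (ainf_ops A \<mu>)"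

lemma ainf_ops_multilinear:
  assumes A: "chain_complex A" and \<mu>: "multilinear_family A A 2 (\<lambda>k. int k - 2) \<mu>"
  shows "mlin (susp A) (susp A) (-1) (susp_ops A \<mu>)"
proof -
  have gA: "graded_module A" and d: "graded_linear A A (-1) (diff A)" using A by (auto simp: chain_complex_def)
  note \<mu>i = \<mu>[unfolded multilinear_family_iff[OF gA gA]]
  have ops: "ainf_ops A \<mu> w = \<mu> w" if "2 \<le> length w" for w
    using that by (auto simp: ainf_ops_def split: list.splits)
  have "multilinear_family A A 1 (\<lambda>k. int k + (-1 - 1)) (ainf_ops A \<mu>)"
    unfolding multilinear_family_iff[OF gA gA]
  proof (intro conjI ballI allI impI)
    fix w assume w: "w \<in> words A" "1 \<le> length w"
    show "ainf_ops A \<mu> w \<in> part A (deg w + (int (length w) + (-1 - 1)))"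
    proof (cases "length w = 1")
      case True
      then obtain n a where "w = [(n, a)]" "a \<in> part A n" using word_cases1[OF w(1)] by blast
      then show ?thesis using d by (simp add: ainf_ops_def graded_linear_def)
    next
      case False
      with w have l: "2 \<le> length w" by simp
      then have "\<mu> w \<in> part A (deg w + (int (length w) - 2))" using \<mu>i w by blast
      then show ?thesis by (simp add: ops[OF l])
    qed
  next
    fix u n a c b v assume w: "u @ (n, a) # v \<in> words A" "b \<in> part A n"
    show "ainf_ops A \<mu> (u @ (n, a + scl A c b) # v) = ainf_ops A \<mu> (u @ (n, a) # v) + scl A c (ainf_ops A \<mu> (u @ (n, b) # v))"
    proof (cases "length (u @ (n, a) # v) = 1")
      case True
      then have uv: "u = []" "v = []" by auto
      have a: "a \<in> part A n" and cb: "scl A c b \<in> part A n"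
        using w uv module.subspace_scale[OF gm_module[OF gA] gm_part[OF gA] w(2)] by (simp_all add: words_Cons)
      have "diff A n (a + scl A c b) = diff A n a + scl A c (diff A n b)"
        using d a w(2) cb by (auto simp: graded_linear_def)
      then show ?thesis by (simp add: uv ainf_ops_def)
    next
      case False
      then have l: "2 \<le> length (u @ (n, x) # v)" for x by (cases u; cases v) auto
      have "\<mu> (u @ (n, a + scl A c b) # v) = \<mu> (u @ (n, a) # v) + scl A c (\<mu> (u @ (n, b) # v))"
        using \<mu>i w l[of a] by blast
      then show ?thesis by (simp only: ops[OF l])
    qed
  qed
  then show ?thesis using mlin_sus[OF gA gA, of "-1"] by simp
qed

lemma ainf_algebraD:
  fixes A :: "('r::comm_ring_1, 'a::ab_group_add) dgmod"
  assumes "ainf_algebra A \<mu>"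
  shows "chain_complex A" "graded_module A" "mlin (susp A) (susp A) (-1) (susp_ops A \<mu>)" "ainf_str (susp A) (susp_ops A \<mu>)"
proof -
  show cA: "chain_complex A" and gA: "graded_module A" using assms by (auto simp: ainf_algebra_def chain_complex_def)
  note V = graded_susp[OF gA]
  show m: "mlin (susp A) (susp A) (-1) (susp_ops A \<mu>)"
    using assms by (intro ainf_ops_multilinear) (auto simp: ainf_algebra_def)
  note L = coder_lift[OF gA m]
  have "ev (scl (susp A)) (susp_ops A \<mu>) (der_lift (susp_ops A \<mu>) (sng w)) = 0" if w: "w \<in> words (susp A)" for w
  proof -
    note s = sng_elts(2)[OF w]
    have "coder A \<mu> (coder A \<mu> (sng w)) \<in> tensor_rel (susp A)"
      using assms s by (simp add: ainf_algebra_def tensor_maps_eq_def)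
    from free.subspace_diff[OF subspace_rel this comp_congruent[OF L(1) tensor_hom_der_lift[OF V m] L(2) L(2) s]]
    have "der_lift (susp_ops A \<mu>) (der_lift (susp_ops A \<mu>) (sng w)) \<in> tensor_rel (susp A)" by simp
    from ev_mlin_rel[OF V V mlin_id_fam[OF V] this]
    show ?thesis by (simp only: corestr_der_lift[OF V tensor_hom_elts[OF tensor_hom_der_lift[OF V m] s]])
  qed
  with V m show "ainf_str (susp A) (susp_ops A \<mu>)" by (simp add: ainf_str_def)
qed

text \<open>
  Compatibility with the differentials is an equation between maps of coderivation type, hence
  equivalent to its corestriction.
\<close>

lemma ainf_morphism_iff:
  fixes A :: "('r::comm_ring_1, 'a::ab_group_add) dgmod" and B :: "('r, 'b::ab_group_add) dgmod"
  assumes a: "ainf_algebra A \<mu>" and b: "ainf_algebra B \<nu>"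
  shows "ainf_morphism A \<mu> B \<nu> F \<longleftrightarrow> fam_morphism (susp A) (susp_ops A \<mu>) (susp B) (susp_ops B \<nu>) (sus F)"
proof -
  note A = ainf_algebraD[OF a] and B = ainf_algebraD[OF b]
  interpret ainf_pair "susp A" "susp_ops A \<mu>" "susp B" "susp_ops B \<nu>" using A B by unfold_locales
  have fam: "multilinear_family A B 1 (\<lambda>k. int k - 1) F \<longleftrightarrow> mlin (susp A) (susp B) 0 (sus F)"
    using mlin_sus[OF A(2) B(2), of 0 F] by simp
  have "tensor_maps_eq (susp A) (susp B) (coder B \<nu> \<circ> comor A B F) (comor A B F \<circ> coder A \<mu>) \<longleftrightarrow>
      (\<forall>w\<in>words (susp A). D (sus F) w = 0)" if f: "mlin (susp A) (susp B) 0 (sus F)"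
  proof -
    note LF = comor_lift[OF A(2) B(2) f] and LA = coder_lift[OF A(2,3)] and LB = coder_lift[OF B(2,3)]
    note hF = tensor_hom_mor_lift[OF V W f] and hA = tensor_hom_der_lift[OF V m] and hB = tensor_hom_der_lift[OF W m']
    have diff: "coder B \<nu> (comor A B F x) - comor A B F (coder A \<mu> x) - mor_defect_map (susp_ops A \<mu>) (susp_ops B \<nu>) (sus F) x \<in> tensor_rel (susp B)"
      if x: "x \<in> tensor_elts (susp A)" for x
      using free.subspace_diff[OF subspace_rel comp_congruent[OF LF(1) hB LF(2) LB(2) x] comp_congruent[OF LA(1) hF LA(2) LF(2) x]]
      by (simp add: mor_defect_map_def algebra_simps)
    have "(\<forall>x\<in>tensor_elts (susp A). coder B \<nu> (comor A B F x) - comor A B F (coder A \<mu> x) \<in> tensor_rel (susp B)) \<longleftrightarrow>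
      (\<forall>x\<in>tensor_elts (susp A). mor_defect_map (susp_ops A \<mu>) (susp_ops B \<nu>) (sus F) x \<in> tensor_rel (susp B))"
      using free.subspace_diff[OF subspace_rel _ diff] free.subspace_add[OF subspace_rel diff] by fastforce
    also have "\<dots> \<longleftrightarrow> (\<forall>w\<in>words (susp A). D (sus F) w = 0)"
    proof
      assume r: "\<forall>x\<in>tensor_elts (susp A). mor_defect_map (susp_ops A \<mu>) (susp_ops B \<nu>) (sus F) x \<in> tensor_rel (susp B)"
      show "\<forall>w\<in>words (susp A). D (sus F) w = 0"
      proof
        fix w assume "w \<in> words (susp A)"
        note s = sng_elts(2)[OF this]
        from ev_mlin_rel[OF W W mlin_id_fam[OF W] r[rule_format, OF s]] show "D (sus F) w = 0"
          by (simp only: corestr_mor_defect_map[OF f s] ev_simps)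
      qed
    next
      assume r: "\<forall>w\<in>words (susp A). D (sus F) w = 0"
      show "\<forall>x\<in>tensor_elts (susp A). mor_defect_map (susp_ops A \<mu>) (susp_ops B \<nu>) (sus F) x \<in> tensor_rel (susp B)"
        by (intro ballI, rule hom_elts_rel[OF tensor_homD(1)[OF hom_mor_defect_map[OF f]]])
          (rule mor_defect_map_vanishes[OF f _ _ lessI], use r in auto)
    qed
    finally show ?thesis by (simp add: tensor_maps_eq_def)
  qed
  then show ?thesis unfolding ainf_morphism_def fam fam_morphism_def by blast
qed

lemma ainf_homotopy_iff:
  fixes A :: "('r::comm_ring_1, 'a::ab_group_add) dgmod" and B :: "('r, 'b::ab_group_add) dgmod"
  assumes a: "ainf_algebra A \<mu>" and b: "ainf_algebra B \<nu>"
    and f0: "fam_morphism (susp A) (susp_ops A \<mu>) (susp B) (susp_ops B \<nu>) (sus F)"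
    and g0: "fam_morphism (susp A) (susp_ops A \<mu>) (susp B) (susp_ops B \<nu>) (sus G)"
  shows "ainf_homotopy A \<mu> B \<nu> G F H \<longleftrightarrow> mlin (susp A) (susp B) 1 (sus H) \<and>
    (\<forall>w\<in>words (susp A). htp_defect (susp B) (susp_ops A \<mu>) (susp_ops B \<nu>) (sus F) (sus G) (sus H) w = 0)"
proof -
  note f = fam_morphismD[OF f0] and g = fam_morphismD[OF g0]
  note A = ainf_algebraD[OF a] and B = ainf_algebraD[OF b]
  interpret ainf_pair "susp A" "susp_ops A \<mu>" "susp B" "susp_ops B \<nu>" using A B by unfold_locales
  have fam: "multilinear_family A B 1 (\<lambda>k. int k) H \<longleftrightarrow> mlin (susp A) (susp B) 1 (sus H)"
    using mlin_sus[OF A(2) B(2), of 1 H] by simp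
  have "tensor_maps_eq (susp A) (susp B) (\<lambda>x. comor A B G x - comor A B F x)
       (\<lambda>x. coder B \<nu> (cohtp A B F G H x) + cohtp A B F G H (coder A \<mu> x)) \<longleftrightarrow>
      (\<forall>w\<in>words (susp A). E (sus F) (sus G) (sus H) w = 0)" if h: "mlin (susp A) (susp B) 1 (sus H)"
  proof -
    note LF = comor_lift[OF A(2) B(2) f(1)] and LG = comor_lift[OF A(2) B(2) g(1)] and LH = cohtp_lift[OF A(2) B(2) f(1) g(1) h]
     and LA = coder_lift[OF A(2,3)] and LB = coder_lift[OF B(2,3)]
    note hH = tensor_hom_htp_lift[OF V W f(1) g(1) h] and hA = tensor_hom_der_lift[OF V m] and hB = tensor_hom_der_lift[OF W m']
    let ?E = "htp_defect_map (susp_ops A \<mu>) (susp_ops B \<nu>) (sus F) (sus G) (sus H)"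
    let ?L = "\<lambda>x. comor A B G x - comor A B F x - (coder B \<nu> (cohtp A B F G H x) + cohtp A B F G H (coder A \<mu> x))"
    have diff: "?L x - ?E x \<in> tensor_rel (susp B)"
      if x: "x \<in> tensor_elts (susp A)" for x
    proof -
      have "(comor A B G x - mor_lift (sus G) x) - (comor A B F x - mor_lift (sus F) x)
         - (coder B \<nu> (cohtp A B F G H x) - der_lift (susp_ops B \<nu>) (htp_lift (sus F) (sus G) (sus H) x))
         - (cohtp A B F G H (coder A \<mu> x) - htp_lift (sus F) (sus G) (sus H) (der_lift (susp_ops A \<mu>) x)) \<in> tensor_rel (susp B)"
        by (intro free.subspace_diff[OF subspace_rel] LF(2)[OF x] LG(2)[OF x] comp_congruent[OF LH(1) hB LH(2) LB(2) x] comp_congruent[OF LA(1) hH LA(2) LH(2) x])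
      then show ?thesis by (simp add: htp_defect_map_def algebra_simps)
    qed
    have "(\<forall>x\<in>tensor_elts (susp A). ?L x \<in> tensor_rel (susp B)) \<longleftrightarrow> (\<forall>x\<in>tensor_elts (susp A). ?E x \<in> tensor_rel (susp B))"
    proof (intro ball_cong refl iffI)
      fix x assume x: "x \<in> tensor_elts (susp A)"
      show "?E x \<in> tensor_rel (susp B)" if "?L x \<in> tensor_rel (susp B)"
        using free.subspace_diff[OF subspace_rel that diff[OF x]] by simp
      show "?L x \<in> tensor_rel (susp B)" if "?E x \<in> tensor_rel (susp B)"
        using free.subspace_add[OF subspace_rel diff[OF x] that] by simp
    qed
    also have "\<dots> \<longleftrightarrow> (\<forall>w\<in>words (susp A). E (sus F) (sus G) (sus H) w = 0)"
    proof
      assume r: "\<forall>x\<in>tensor_elts (susp A). ?E x \<in> tensor_rel (susp B)"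
      show "\<forall>w\<in>words (susp A). E (sus F) (sus G) (sus H) w = 0"
      proof
        fix w assume "w \<in> words (susp A)"
        note s = sng_elts(2)[OF this]
        from ev_mlin_rel[OF W W mlin_id_fam[OF W] r[rule_format, OF s]] show "E (sus F) (sus G) (sus H) w = 0"
          by (simp only: corestr_htp_defect_map[OF f(1) g(1) h s] ev_simps)
      qed
    next
      assume r: "\<forall>w\<in>words (susp A). E (sus F) (sus G) (sus H) w = 0"
      show "\<forall>x\<in>tensor_elts (susp A). ?E x \<in> tensor_rel (susp B)"
        by (intro ballI, rule hom_elts_rel[OF tensor_homD(1)[OF hom_htp_defect_map[OF f(1) g(1) h]]])
          (rule htp_defect_map_vanishes[OF f(1) g(1) h f(2) g(2) _ _ lessI], use r in auto)
    qed
    finally show ?thesis by (simp add: tensor_maps_eq_def)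
  qed
  then show ?thesis unfolding ainf_homotopy_def fam by blast
qed

text \<open>
  The composite is defined through the chosen lifts, but its components are given by the explicit
  ones.
\<close>

lemma sus_comp:
  fixes A :: "('r::comm_ring_1, 'a::ab_group_add) dgmod" and B :: "('r, 'b::ab_group_add) dgmod" and C :: "('r, 'c::ab_group_add) dgmod"
  assumes A: "graded_module A" and B: "graded_module B" and C: "graded_module C"
    and f: "mlin (susp A) (susp B) 0 (sus F)" and g: "mlin (susp B) (susp C) 0 (sus G)" and w: "w \<in> words (susp A)"
  shows "sus (ainf_comp A B C G F) w = precomp (susp C) (sus G) (mor_lift (sus F)) w"
proof -
  note LF = comor_lift[OF A B f] and LG = comor_lift[OF B C g]
  note V = graded_susp[OF A] and U = graded_susp[OF B] and W = graded_susp[OF C]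
  have hc: "tensor_hom (susp A) (susp C) 0 (comor B C G \<circ> comor A B F)"
    using tensor_hom_comp[OF LF(1) LG(1), of 0] by (simp add: o_def)
  have "sus (ainf_comp A B C G F) w = ev (scl C) id_fam (comor B C G (comor A B F (sng w)))"
    using w component_eq[OF hc, of "down w"] by (simp add: sus_def ainf_comp_def words_susp)
  also have "\<dots> = ev (scl (susp C)) id_fam (mor_lift (sus G) (mor_lift (sus F) (sng w)))"
    using ev_eqv[OF W W mlin_id_fam[OF W] comp_congruent[OF LF(1) tensor_hom_mor_lift[OF U W g] LF(2) LG(2) sng_elts(2)[OF w]]] by simp
  also have "\<dots> = precomp (susp C) (sus G) (mor_lift (sus F)) w"
    by (simp only: precomp_def corestr_mor_lift[OF W tensor_hom_elts[OF tensor_hom_mor_lift[OF V U f] sng_elts(2)[OF w]]])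
  finally show ?thesis .
qed


section \<open>Chain maps and homotopies as families\<close>

text \<open>
  A map of complexes as a family concentrated in arity one on suspensions; letters of a suspension
  have their degree raised by one.
\<close>

definition letterwise :: "(int \<Rightarrow> 'a \<Rightarrow> 'b::zero) \<Rightarrow> 'a word \<Rightarrow> 'b" where
  "letterwise f w = (case w of [(n, a)] \<Rightarrow> f (n - 1) a | _ \<Rightarrow> 0)"

lemma letterwise_simps [simp]: "letterwise f [(n, a)] = f (n - 1) a" "length w \<noteq> 1 \<Longrightarrow> letterwise f w = 0"
  by (auto simp: letterwise_def split: list.split)

lemma ainf_ops_letter [simp]: "ainf_ops A \<mu> [(n, a)] = diff A n a"
  by (simp add: ainf_ops_def)

lemma graded_linear_comb:
  assumes "graded_module A" "graded_linear A B e f" "a \<in> part A n" "b \<in> part A n"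
  shows "f n (a + scl A c b) = f n a + scl B c (f n b)"
  using assms module.subspace_scale[OF gm_module gm_part, of A b n c] by (auto simp: graded_linear_def)

lemma mlin_letterwise:
  assumes A: "graded_module A" and B: "graded_module B" and f: "graded_linear A B e f"
  shows "mlin (susp A) (susp B) e (letterwise f)"
  unfolding mlin_iff[OF graded_susp[OF A] graded_susp[OF B]]
proof (intro conjI ballI allI impI)
  fix w assume w: "w \<in> words (susp A)"
  show "letterwise f w \<in> part (susp B) (deg w + e)"
  proof (cases "length w = 1")
    case True
    then obtain n a where na: "w = [(n, a)]" "a \<in> part (susp A) n" using word_cases1[OF w] by blast
    then have "f (n - 1) a \<in> part B (n - 1 + e)" using f by (auto simp: graded_linear_def)
    moreover have "n - 1 + e = n + e - 1" by simp
    ultimately show ?thesis using na by simp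
  next
    case False
    then show ?thesis using module.subspace_0[OF gm_module[OF B] gm_part[OF B]] by simp
  qed
next
  fix u n a c b v assume w: "u @ (n, a) # v \<in> words (susp A)" "b \<in> part (susp A) n"
  show "letterwise f (u @ (n, a + scl (susp A) c b) # v) = letterwise f (u @ (n, a) # v) + scl (susp B) c (letterwise f (u @ (n, b) # v))"
  proof (cases "u = [] \<and> v = []")
    case True
    with w show ?thesis by (simp add: words_Cons graded_linear_comb[OF A f])
  next
    case False
    then have "letterwise f (u @ (n, x) # v) = 0" for x by (intro letterwise_simps(2)) auto
    then show ?thesis by (simp add: module.scale_zero_right[OF gm_module[OF B]])
  qed
qed

lemma chain_homotopic_sym:
  assumes A: "chain_complex A" and B: "chain_complex B" and fg: "chain_homotopic A B f g"
  shows "chain_homotopic A B g f"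
proof -
  have gA: "graded_module A" and gB: "graded_module B" and dA: "graded_linear A A (-1) (diff A)" and dB: "graded_linear B B (-1) (diff B)"
    using A B by (auto simp: chain_complex_def)
  interpret B: module "scl B" by (rule gm_module[OF gB])
  obtain h where h: "graded_linear A B 1 h" and eq: "\<And>n a. a \<in> part A n \<Longrightarrow> g n a - f n a = diff B (n + 1) (h n a) + h (n - 1) (diff A n a)"
    using fg by (auto simp: chain_homotopic_def)
  have "graded_linear A B 1 (\<lambda>n a. - h n a)"
    using h by (auto simp: graded_linear_def B.subspace_neg[OF gm_part[OF gB]])
  moreover have "f n a - g n a = diff B (n + 1) (- h n a) + - h (n - 1) (diff A n a)" if a: "a \<in> part A n" for n a
  proof -
    have ha: "h n a \<in> part B (n + 1)" using h a by (auto simp: graded_linear_def)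
    have "diff B (n + 1) (0 + scl B (-1) (h n a)) = diff B (n + 1) 0 + scl B (-1) (diff B (n + 1) (h n a))"
      by (rule graded_linear_comb[OF gB dB B.subspace_0[OF gm_part[OF gB]] ha])
    moreover have "diff B (n + 1) 0 = 0"
      using graded_linear_comb[OF gB dB B.subspace_0[OF gm_part[OF gB]] B.subspace_0[OF gm_part[OF gB]], of "n + 1" 1] by simp
    ultimately have "diff B (n + 1) (- h n a) = - diff B (n + 1) (h n a)" by simp
    then show ?thesis using eq[OF a] by (simp add: algebra_simps)
  qed
  ultimately show ?thesis unfolding chain_homotopic_def by blast
qed

lemma letter_homotopy_of:
  assumes A: "graded_module A" and B: "graded_module B" and fg: "chain_homotopic A B f g"
    and f: "\<And>n a. a \<in> part (susp A) n \<Longrightarrow> f' n a = f (n - 1) a" and g: "\<And>n a. a \<in> part (susp A) n \<Longrightarrow> g' n a = g (n - 1) a"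
  shows "\<exists>h. mlin (susp A) (susp B) 1 h \<and> letter_homotopy (susp A) (susp_ops A \<mu>) (susp_ops B \<nu>) f' g' h"
proof -
  obtain h where h: "graded_linear A B 1 h" and eq: "\<And>n a. a \<in> part A n \<Longrightarrow> g n a - f n a = diff B (n + 1) (h n a) + h (n - 1) (diff A n a)"
    using fg by (auto simp: chain_homotopic_def)
  have "letter_homotopy (susp A) (susp_ops A \<mu>) (susp_ops B \<nu>) f' g' (letterwise h)"
    unfolding letter_homotopy_def
  proof (intro allI ballI)
    fix n a assume a: "a \<in> part (susp A) n"
    then show "g' n a - f' n a = susp_ops B \<nu> [(n + 1, letterwise h [(n, a)])] + letterwise h [(n - 1, susp_ops A \<mu> [(n, a)])]"
      using eq[of a "n - 1"] by (simp add: f g)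
  qed
  with mlin_letterwise[OF A B h] show ?thesis by blast
qed

lemma letter_equivalence_of:
  fixes A :: "('r::comm_ring_1, 'a::ab_group_add) dgmod" and B :: "('r, 'b::ab_group_add) dgmod"
  assumes a: "ainf_algebra A \<mu>" and b: "ainf_algebra B \<nu>" and f: "mlin (susp A) (susp B) 0 (sus F)"
    and equiv: "chain_homotopy_equivalence A B (linear_part F)"
  shows "\<exists>g k l. letter_equivalence (susp A) (susp_ops A \<mu>) (susp B) (susp_ops B \<nu>) (sus F) g k l"
proof -
  note A = ainf_algebraD[OF a] and B = ainf_algebraD[OF b]
  obtain g where f_chain: "chain_map A B (linear_part F)" and g_chain: "chain_map B A g"
    and gf: "chain_homotopic A A (\<lambda>n a. g n (linear_part F n a)) (\<lambda>n a. a)"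
    and fg: "chain_homotopic B B (\<lambda>n b. linear_part F n (g n b)) (\<lambda>n b. b)"
    using equiv by (auto simp: chain_homotopy_equivalence_def)
  have "letter_chain (susp A) (susp_ops A \<mu>) (susp_ops B \<nu>) (sus F)"
    using f_chain by (auto simp: letter_chain_def chain_map_def linear_part_def)
  moreover have "mlin (susp B) (susp A) 0 (letterwise g)" "letter_chain (susp B) (susp_ops B \<nu>) (susp_ops A \<mu>) (letterwise g)"
    using g_chain mlin_letterwise[OF B(2) A(2), of 0 g] by (auto simp: letter_chain_def chain_map_def)
  moreover have "\<exists>k. mlin (susp A) (susp A) 1 k \<and> letter_homotopy (susp A) (susp_ops A \<mu>) (susp_ops A \<mu>) (\<lambda>n a. a) (\<lambda>n a. letterwise g [(n, sus F [(n, a)])]) k"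
    by (rule letter_homotopy_of[OF A(2) A(2) chain_homotopic_sym[OF A(1) A(1) gf]]) (simp_all add: linear_part_def)
  moreover have "\<exists>l. mlin (susp B) (susp B) 1 l \<and> letter_homotopy (susp B) (susp_ops B \<nu>) (susp_ops B \<nu>) (\<lambda>n b. b) (\<lambda>n b. sus F [(n, letterwise g [(n, b)])]) l"
    by (rule letter_homotopy_of[OF B(2) B(2) chain_homotopic_sym[OF B(1) B(1) fg]]) (simp_all add: linear_part_def)
  ultimately show ?thesis using f unfolding letter_equivalence_def by blast
qed

section \<open>Families that agree on the words of a module\<close>

lemma mor_of_cong: "w \<in> words V \<Longrightarrow> (\<And>u. u \<in> words V \<Longrightarrow> c u = c' u) \<Longrightarrow> mor_of c w = mor_of c' w"
proof (induction w rule: length_induct)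
  case (1 w)
  have "mor_of c (drop i w) = mor_of c' (drop i w)" if "0 < i" "i < length w" for i
    using 1(1)[rule_format, of "drop i w"] that 1(3) words_drop[OF 1(2)] by simp
  then have "convol c (mor_of c) w = convol c' (mor_of c') w"
    by (intro convol_cong) (auto simp: 1(3)[OF words_take[OF 1(2)]])
  then show ?case using 1(2,3) by (simp add: mor_of_rec[of _ w])
qed

lemma der_of_cong:
  "w \<in> words V \<Longrightarrow> (\<And>u. u \<in> words V \<Longrightarrow> c u = c' u) \<Longrightarrow> (\<And>u. u \<in> words V \<Longrightarrow> P u = P' u) \<Longrightarrow>
   der_of e c P d w = der_of e c' P' d w"
proof (induction w rule: length_induct)
  case (1 w)
  have "der_of e c P d (drop i w) = der_of e c' P' d (drop i w)" if "0 < i" "i < length w" for i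
    using 1(1)[rule_format, of "drop i w"] that 1(3,4) words_drop[OF 1(2)] by simp
  then have "convol (twist e c) (der_of e c P d) w = convol (twist e c') (der_of e c' P' d) w"
    by (intro convol_cong) (auto simp: twist_def 1(3)[OF words_take[OF 1(2)]])
  moreover have "convol d P w = convol d P' w"
    by (intro convol_cong) (auto simp: 1(4)[OF words_drop[OF 1(2)]])
  ultimately show ?case by (simp add: der_of_rec[of _ _ _ _ w])
qed

text \<open>
  Components of composites agree with \<open>precomp\<close> only on words of the module, so defects
  have to be compared for families that agree there.
\<close>

lemma htp_defect_cong:
  fixes V :: "('r::comm_ring_1, 'a::ab_group_add) dgmod" and W :: "('r, 'b::ab_group_add) dgmod"
  assumes w: "w \<in> words V" and f: "\<And>u. u \<in> words V \<Longrightarrow> f u = f' u" and g: "\<And>u. u \<in> words V \<Longrightarrow> g u = g' u"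
  shows "htp_defect W m m' f g h w = htp_defect W m m' f' g' h w"
proof -
  have "htp_lift f g h (sng w) = (htp_lift f' g' h (sng w) :: _ \<Rightarrow>\<^sub>0 'r)"
    unfolding htp_lift_def lin_ext_sng
    by (rule der_of_cong[OF w]) (auto intro: letter_of_cong mor_of_cong[where V=V] f g)
  then show ?thesis by (simp add: htp_defect_def f[OF w] g[OF w])
qed

section \<open>Composites, isotopies and the four conditions\<close>

lemma isotopyD:
  assumes "ainf_algebra A \<mu>'" "ainf_algebra A \<mu>''" "isotopy A \<mu>' \<mu>'' S"
  shows "fam_morphism (susp A) (susp_ops A \<mu>') (susp A) (susp_ops A \<mu>'') (sus S)" "\<And>n a. a \<in> part A n \<Longrightarrow> S [(n, a)] = a"
  using assms ainf_morphism_iff[OF assms(1,2)] by (auto simp: isotopy_def linear_part_def)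

lemma isotopy_unsus:
  assumes "ainf_algebra A \<mu>'" "ainf_algebra A \<mu>''" "fam_morphism (susp A) (susp_ops A \<mu>') (susp A) (susp_ops A \<mu>'') t"
    "\<forall>l. t [l] = id_fam [l]"
  shows "isotopy A \<mu>' \<mu>'' (unsus t)"
  using assms ainf_morphism_iff[OF assms(1,2)] by (auto simp: isotopy_def linear_part_def unsus_def ksign_simps)

lemma composite_morphism:
  fixes U :: "('r::comm_ring_1, 'a::ab_group_add) dgmod" and V :: "('r, 'b::ab_group_add) dgmod" and W :: "('r, 'c::ab_group_add) dgmod"
  assumes str: "ainf_str U mU" "ainf_str V mV" "ainf_str W mW"
    and F: "fam_morphism U mU V mV F" and G: "fam_morphism V mV W mW G"
  shows "fam_morphism U mU W mW (precomp W G (mor_lift F))"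
  unfolding fam_morphism_def
proof (intro conjI ballI)
  have U: "graded_module U" and V: "graded_module V" and W: "graded_module W" using str by (auto simp: ainf_str_def)
  note hF = tensor_hom_mor_lift[OF U V fam_morphismD(1)[OF F]]
  show "mlin U W 0 (precomp W G (mor_lift F))" by (rule mlin_precomp[OF U V W fam_morphismD(1)[OF G] hF]) simp
  fix w assume w: "w \<in> words U"
  have "ev (scl W) (mor_defect W mV mW G) (mor_lift F (sng w)) = 0"
    by (rule ev_zero[OF gm_module[OF W] tensor_hom_elts[OF hF sng_elts(2)[OF w], unfolded elts_supp] fam_morphismD(2)[OF G]])
  then show "mor_defect W mU mW (precomp W G (mor_lift F)) w = 0"
    using defect_precomp[OF str F fam_morphismD(1)[OF G] w] by simp
qed

lemma fam_morphism_cong: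
  fixes V :: "('r::comm_ring_1, 'a::ab_group_add) dgmod" and W :: "('r, 'b::ab_group_add) dgmod"
  assumes V: "graded_module V" and W: "graded_module W" and m: "mlin V V (-1) m"
    and f: "fam_morphism V m W m' f" and eq: "\<And>u. u \<in> words V \<Longrightarrow> f' u = f u"
  shows "fam_morphism V m W m' f'"
  unfolding fam_morphism_def
proof (intro conjI ballI)
  show "mlin V W 0 f'" by (rule mlin_cong[OF V W fam_morphismD(1)[OF f]]) (rule eq[symmetric])
  fix w assume w: "w \<in> words V"
  have "mor_lift f' (sng w) = (mor_lift f (sng w) :: _ \<Rightarrow>\<^sub>0 'r)"
    unfolding mor_lift_def lin_ext_sng by (rule mor_of_cong[OF w]) (auto intro: letter_of_cong eq)
  moreover have "ev (scl W) f' (der_lift m (sng w)) = ev (scl W) f (der_lift m (sng w))"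
    by (rule ev_cong[OF tensor_hom_elts[OF tensor_hom_der_lift[OF V m] sng_elts(2)[OF w], unfolded elts_supp] eq])
  ultimately show "mor_defect W m m' f' w = 0" using fam_morphismD(2)[OF f w] by (simp add: mor_defect_def)
qed

lemma ainf_comp_morphism:
  fixes A :: "('r::comm_ring_1, 'a::ab_group_add) dgmod" and B :: "('r, 'b::ab_group_add) dgmod" and C :: "('r, 'c::ab_group_add) dgmod"
  assumes alg: "ainf_algebra A \<mu>" "ainf_algebra B \<nu>" "ainf_algebra C \<rho>"
    and f: "fam_morphism (susp A) (susp_ops A \<mu>) (susp B) (susp_ops B \<nu>) (sus F)"
    and g: "fam_morphism (susp B) (susp_ops B \<nu>) (susp C) (susp_ops C \<rho>) (sus G)"
  shows "fam_morphism (susp A) (susp_ops A \<mu>) (susp C) (susp_ops C \<rho>) (sus (ainf_comp A B C G F))"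
proof -
  note A = ainf_algebraD[OF alg(1)] and B = ainf_algebraD[OF alg(2)] and C = ainf_algebraD[OF alg(3)]
  show ?thesis
    by (rule fam_morphism_cong[OF graded_susp[OF A(2)] graded_susp[OF C(2)] A(3) composite_morphism[OF A(4) B(4) C(4) f g]])
      (rule sus_comp[OF A(2) B(2) C(2) fam_morphismD(1)[OF f] fam_morphismD(1)[OF g]])
qed

text \<open>
  The homotopy in condition (iv) in terms of families. This is the form in which
  \<open>morphism_extension\<close> and \<open>morphism_lifting\<close> produce it.
\<close>

lemma ainf_homotopic_comp:
  fixes A :: "('r::comm_ring_1, 'a::ab_group_add) dgmod" and B :: "('r, 'b::ab_group_add) dgmod"
  assumes alg: "ainf_algebra A \<mu>'" "ainf_algebra A \<mu>''" "ainf_algebra B \<nu>'" "ainf_algebra B \<nu>''"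
    and F': "fam_morphism (susp A) (susp_ops A \<mu>') (susp B) (susp_ops B \<nu>') (sus F')"
    and F'': "fam_morphism (susp A) (susp_ops A \<mu>'') (susp B) (susp_ops B \<nu>'') (sus F'')"
    and S: "fam_morphism (susp A) (susp_ops A \<mu>') (susp A) (susp_ops A \<mu>'') (sus S)"
    and T: "fam_morphism (susp B) (susp_ops B \<nu>') (susp B) (susp_ops B \<nu>'') (sus T)"
  shows "ainf_homotopic A \<mu>' B \<nu>'' (ainf_comp A B B T F') (ainf_comp A A B F'' S) \<longleftrightarrow>
    (\<exists>h. mlin (susp A) (susp B) 1 h \<and> (\<forall>w\<in>words (susp A). htp_defect (susp B) (susp_ops A \<mu>') (susp_ops B \<nu>'')
       (precomp (susp B) (sus F'') (mor_lift (sus S))) (precomp (susp B) (sus T) (mor_lift (sus F'))) h w = 0))"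
proof -
  note gA = ainf_algebraD(2)[OF alg(1)] and gB = ainf_algebraD(2)[OF alg(3)]
  note FS = sus_comp[OF gA gA gB fam_morphismD(1)[OF S] fam_morphismD(1)[OF F'']]
   and TF = sus_comp[OF gA gB gB fam_morphismD(1)[OF F'] fam_morphismD(1)[OF T]]
  have "htp_defect (susp B) (susp_ops A \<mu>') (susp_ops B \<nu>'') (sus (ainf_comp A A B F'' S)) (sus (ainf_comp A B B T F')) h w =
     htp_defect (susp B) (susp_ops A \<mu>') (susp_ops B \<nu>'') (precomp (susp B) (sus F'') (mor_lift (sus S))) (precomp (susp B) (sus T) (mor_lift (sus F'))) h w"
    if w: "w \<in> words (susp A)" for h w
    by (rule htp_defect_cong[OF w FS TF])
  then have "ainf_homotopic A \<mu>' B \<nu>'' (ainf_comp A B B T F') (ainf_comp A A B F'' S) \<longleftrightarrow>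
    (\<exists>h. mlin (susp A) (susp B) 1 (sus h) \<and> (\<forall>w\<in>words (susp A). htp_defect (susp B) (susp_ops A \<mu>') (susp_ops B \<nu>'')
       (precomp (susp B) (sus F'') (mor_lift (sus S))) (precomp (susp B) (sus T) (mor_lift (sus F'))) (sus h) w = 0))"
    unfolding ainf_homotopic_def ainf_homotopy_iff[OF alg(1,4) ainf_comp_morphism[OF alg(1,2,4) S F''] ainf_comp_morphism[OF alg(1,3,4) F' T]]
    by auto
  also have "\<dots> \<longleftrightarrow> (\<exists>h. mlin (susp A) (susp B) 1 h \<and> (\<forall>w\<in>words (susp A). htp_defect (susp B) (susp_ops A \<mu>') (susp_ops B \<nu>'')
       (precomp (susp B) (sus F'') (mor_lift (sus S))) (precomp (susp B) (sus T) (mor_lift (sus F'))) h w = 0))"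
    by (metis sus_unsus)
  finally show ?thesis .
qed

theorem proposition5:
  fixes A :: "('r::comm_ring_1, 'a::ab_group_add) dgmod"
    and B :: "('r, 'b::ab_group_add) dgmod"
    and \<mu>' \<mu>'' :: "'a word \<Rightarrow> 'a" and \<nu>' \<nu>'' :: "'b word \<Rightarrow> 'b"
    and F' F'' :: "'a word \<Rightarrow> 'b"
  assumes "ainf_algebra A \<mu>'" and "ainf_algebra A \<mu>''"
    and "ainf_algebra B \<nu>'" and "ainf_algebra B \<nu>''"
    and "ainf_morphism A \<mu>' B \<nu>' F'" and "ainf_morphism A \<mu>'' B \<nu>'' F''"
    and "chain_homotopy_equivalence A B (linear_part F')"
    and "chain_homotopy_equivalence A B (linear_part F'')"
  defines "i \<equiv> chain_homotopic A B (linear_part F') (linear_part F'') \<and> isotopic A \<mu>' \<mu>''"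
    and "ii \<equiv> chain_homotopic A B (linear_part F') (linear_part F'') \<and> isotopic B \<nu>' \<nu>''"
    and "iii \<equiv> chain_homotopic A B (linear_part F') (linear_part F'') \<and>
                isotopic A \<mu>' \<mu>'' \<and> isotopic B \<nu>' \<nu>''"
    and "iv \<equiv> \<exists>S T. isotopy A \<mu>' \<mu>'' S \<and> isotopy B \<nu>' \<nu>'' T \<and>
                ainf_homotopic A \<mu>' B \<nu>'' (ainf_comp A B B T F') (ainf_comp A A B F'' S)"
  shows "(i \<longleftrightarrow> ii) \<and> (ii \<longleftrightarrow> iii) \<and> (iii \<longleftrightarrow> iv)"
proof -
  note alg = assms(1-4)
  note A' = ainf_algebraD[OF alg(1)] and A'' = ainf_algebraD[OF alg(2)] and B' = ainf_algebraD[OF alg(3)] and B'' = ainf_algebraD[OF alg(4)]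
  let ?A = "susp A" and ?B = "susp B"
  note V = graded_susp[OF A'(2)] and W = graded_susp[OF B'(2)]
  have F': "fam_morphism ?A (susp_ops A \<mu>') ?B (susp_ops B \<nu>') (sus F')"
    using assms(5) ainf_morphism_iff[OF alg(1,3)] by simp
  have F'': "fam_morphism ?A (susp_ops A \<mu>'') ?B (susp_ops B \<nu>'') (sus F'')"
    using assms(6) ainf_morphism_iff[OF alg(2,4)] by simp
  note mF' = fam_morphismD(1)[OF F'] and mF'' = fam_morphismD(1)[OF F'']
  note homotopic_iff = ainf_homotopic_comp[OF alg F' F'']
  have letters: "precomp ?B G (mor_lift F) [(n, a)] = G [(n, F [(n, a)])]"
    if "mlin U ?B 0 G" "graded_module U" for U :: "('r, 'c::ab_group_add) dgmod" and G and F :: "'a word \<Rightarrow> 'c" and n a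
    using ev_letter_of[OF that(2) W that(1), of "[(n, a)]" 0 F] by (simp add: precomp_def lifts_letter)
  have idA: "letter_chain ?A (susp_ops A \<mu>') (susp_ops A \<mu>'') id_fam" and idB: "letter_chain ?B (susp_ops B \<nu>') (susp_ops B \<nu>'') id_fam"
    by (simp_all add: letter_chain_def)
  have "iv" if i
  proof -
    obtain S where S: "isotopy A \<mu>' \<mu>'' S" and ff: "chain_homotopic A B (linear_part F') (linear_part F'')"
      using \<open>i\<close> by (auto simp: i_def isotopic_def)
    note S' = isotopyD[OF alg(1,2) S]
    obtain g k l where eq: "letter_equivalence ?A (susp_ops A \<mu>') ?B (susp_ops B \<nu>') (sus F') g k l"
      using letter_equivalence_of[OF alg(1,3) mF' assms(7)] by blast
    let ?G = "precomp ?B (sus F'') (mor_lift (sus S))"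
    note G = composite_morphism[OF A'(4) A''(4) B''(4) S'(1) F'']
    obtain h1 where h1: "mlin ?A ?B 1 h1" "letter_homotopy ?A (susp_ops A \<mu>') (susp_ops B \<nu>'') (\<lambda>n a. ?G [(n, a)]) (\<lambda>n a. id_fam [(n, sus F' [(n, a)])]) h1"
      using letter_homotopy_of[OF A'(2) B'(2) chain_homotopic_sym[OF A'(1) B'(1) ff], of "\<lambda>n a. ?G [(n, a)]" "\<lambda>n a. id_fam [(n, sus F' [(n, a)])]"]
      by (auto simp: letters[OF mF'' V] S'(2) linear_part_def)
    obtain t h where t: "fam_morphism ?B (susp_ops B \<nu>') ?B (susp_ops B \<nu>'') t" "\<forall>l. t [l] = id_fam [l]"
      and h: "mlin ?A ?B 1 h" "\<forall>w\<in>words ?A. htp_defect ?B (susp_ops A \<mu>') (susp_ops B \<nu>'') ?G (precomp ?B t (mor_lift (sus F'))) h w = 0"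
      using morphism_extension[OF A'(4) B'(4) B''(4) F' G eq mlin_id_fam[OF W] idB h1] by blast
    have T: "isotopy B \<nu>' \<nu>'' (unsus t)" by (rule isotopy_unsus[OF alg(3,4) t])
    note T' = isotopyD[OF alg(3,4) T]
    have "ainf_homotopic A \<mu>' B \<nu>'' (ainf_comp A B B (unsus t) F') (ainf_comp A A B F'' S)"
      unfolding homotopic_iff[OF S'(1) T'(1)] using h by auto
    with S T show iv unfolding iv_def by blast
  qed
  moreover have "iv" if ii
  proof -
    obtain T where T: "isotopy B \<nu>' \<nu>'' T" and ff: "chain_homotopic A B (linear_part F') (linear_part F'')"
      using \<open>ii\<close> by (auto simp: ii_def isotopic_def)
    note T' = isotopyD[OF alg(3,4) T]
    obtain g k l where eq: "letter_equivalence ?A (susp_ops A \<mu>'') ?B (susp_ops B \<nu>'') (sus F'') g k l"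
      using letter_equivalence_of[OF alg(2,4) mF'' assms(8)] by blast
    let ?G = "precomp ?B (sus T) (mor_lift (sus F'))"
    note G = composite_morphism[OF A'(4) B'(4) B''(4) F' T'(1)]
    have F'in: "F' [(n - 1, a)] \<in> part B (n - 1)" if "a \<in> part A (n - 1)" for n a
      using mlin_in[OF mF', of "[(n, a)]"] that by (simp add: words_Cons)
    obtain h1 where h1: "mlin ?A ?B 1 h1" "letter_homotopy ?A (susp_ops A \<mu>') (susp_ops B \<nu>'') (\<lambda>n a. sus F'' [(n, id_fam [(n, a)])]) (\<lambda>n a. ?G [(n, a)]) h1"
      using letter_homotopy_of[OF A'(2) B'(2) chain_homotopic_sym[OF A'(1) B'(1) ff], of "\<lambda>n a. sus F'' [(n, id_fam [(n, a)])]" "\<lambda>n a. ?G [(n, a)]"]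
      by (auto simp: letters[OF fam_morphismD(1)[OF T'(1)] W] T'(2) F'in linear_part_def)
    obtain s h where s: "fam_morphism ?A (susp_ops A \<mu>') ?A (susp_ops A \<mu>'') s" "\<forall>l. s [l] = id_fam [l]"
      and h: "mlin ?A ?B 1 h" "\<forall>w\<in>words ?A. htp_defect ?B (susp_ops A \<mu>') (susp_ops B \<nu>'') (precomp ?B (sus F'') (mor_lift s)) ?G h w = 0"
      using morphism_lifting[OF A'(4) A''(4) B''(4) F'' G eq mlin_id_fam[OF V] idA h1] by blast
    have S: "isotopy A \<mu>' \<mu>'' (unsus s)" by (rule isotopy_unsus[OF alg(1,2) s])
    note S' = isotopyD[OF alg(1,2) S]
    have "ainf_homotopic A \<mu>' B \<nu>'' (ainf_comp A B B T F') (ainf_comp A A B F'' (unsus s))"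
      unfolding homotopic_iff[OF S'(1) T'(1)] using h by auto
    with S T show iv unfolding iv_def by blast
  qed
  moreover have "iii" if iv
  proof -
    obtain S T where S: "isotopy A \<mu>' \<mu>'' S" and T: "isotopy B \<nu>' \<nu>'' T" and
      hom: "ainf_homotopic A \<mu>' B \<nu>'' (ainf_comp A B B T F') (ainf_comp A A B F'' S)"
      using \<open>iv\<close> by (auto simp: iv_def)
    note S' = isotopyD[OF alg(1,2) S] and T' = isotopyD[OF alg(3,4) T]
    obtain h where h: "mlin ?A ?B 1 h" "\<And>w. w \<in> words ?A \<Longrightarrow> htp_defect ?B (susp_ops A \<mu>') (susp_ops B \<nu>'')
        (precomp ?B (sus F'') (mor_lift (sus S))) (precomp ?B (sus T) (mor_lift (sus F'))) h w = 0"
      using hom unfolding homotopic_iff[OF S'(1) T'(1)] by blast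
    interpret B: module "scl B" by (rule gm_module[OF B'(2)])
    \<comment> \<open>the linear part of the homotopy, desuspended\<close>
    let ?h = "\<lambda>n a. h [(n + 1, a)]"
    have "chain_homotopic A B (linear_part F'') (linear_part F')"
      unfolding chain_homotopic_def
    proof (intro exI[of _ ?h] conjI allI ballI)
      show "graded_linear A B 1 ?h"
        using mlin_in[OF h(1)] letter_add[OF V W h(1)] letter_scale[OF V W h(1)]
        by (auto simp: graded_linear_def words_Cons)
          (metis add_diff_cancel_right' deg_simps(2,3) add.right_neutral list.distinct(1) mlin_in[OF h(1)] susp_simps(2) words_Cons)
      fix n a assume a: "a \<in> part A n"
      have F'in: "F' [(n, a)] \<in> part B n"
        using mlin_in[OF mF', of "[(n + 1, a)]"] a by (simp add: words_Cons)
      have "htp_defect ?B (susp_ops A \<mu>') (susp_ops B \<nu>'') (precomp ?B (sus F'') (mor_lift (sus S))) (precomp ?B (sus T) (mor_lift (sus F'))) h [(n + 1, a)] = 0"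
        using a by (intro h(2)) (simp add: words_Cons)
      then have "linear_part F' n a - linear_part F'' n a - diff B (n + 1) (?h n a) = ?h (n - 1) (diff A n a)"
        using a by (simp add: htp_defect_def letters[OF mF'' V] letters[OF fam_morphismD(1)[OF T'(1)] W] S'(2) T'(2) F'in linear_part_def
            lifts_letter ev_letter_of[OF W W B''(3), unfolded susp_simps] ev_letter_of[OF V W h(1), unfolded susp_simps] add.commute[of 1 n])
      then show "linear_part F' n a - linear_part F'' n a = diff B (n + 1) (?h n a) + ?h (n - 1) (diff A n a)"
        by (simp only: diff_eq_eq ac_simps)
    qed
    from chain_homotopic_sym[OF A'(1) B'(1) this] S T show iii by (auto simp: iii_def isotopic_def)
  qed
  moreover have "i \<and> ii" if iii using that by (auto simp: i_def ii_def iii_def)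
  ultimately show ?thesis by blast
qed


end
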